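(* As $x \to \infty$, \[ S_{0,1}(x) = \sum_{n \le x} r_0(n)\, r_1(n) = \frac{x}{2} + O\!\left(\frac{x \log\log x}{\log x}\right). \]
   Context: $\mathbb{P}$ denotes the set of primes and $\mathbb{N}$ the natural numbers. For $n \in \mathbb{N}$ define $r_0(n) = \#\{(a,b) \in \mathbb{N}^2 : n = a^2+b^2\}$ and $r_1(n) = \#\{(a,p) \in \mathbb{N}\times\mathbb{P} : n = a^2+p^2\}$. (The paper also uses the identity $r_0(n)=\sum_{d\mid n}\chi_4(d)$, where $\chi_4$ is the non-principal Dirichlet character modulo $4$.) *)

theory Defs
  imports Complex_Main "HOL-Computational_Algebra.Primes" "HOL-Library.Landau_Symbols"
begin

text \<open>Here the natural numbers are the positive integers, whence the conditions \<open>0 < a\<close>,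
  \<open>0 < b\<close> and \<open>0 < n\<close> on the type \<^typ>\<open>nat\<close>, which contains \<open>0\<close>.\<close>

definition r0 :: "nat \<Rightarrow> nat" where
  "r0 n = card {(a::nat, b::nat). 0 < a \<and> 0 < b \<and> n = a\<^sup>2 + b\<^sup>2}"

definition r1 :: "nat \<Rightarrow> nat" where
  "r1 n = card {(a::nat, p::nat). 0 < a \<and> prime p \<and> n = a\<^sup>2 + p\<^sup>2}"

definition S01 :: "real \<Rightarrow> real" where
  "S01 x = (\<Sum>n | 0 < n \<and> real n \<le> x. real (r0 n) * real (r1 n))"

end

theory Submission
  imports Defs "HOL-Complex_Analysis.Complex_Analysis" "HOL-Number_Theory.Prime_Powers"
begin

text \<open>
  The sum counts the solutions of \<open>a\<^sup>2 + b\<^sup>2 = c\<^sup>2 + p\<^sup>2 \<le> x\<close> with \<open>p\<close> prime. For fixed \<open>p\<close> the equation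
  says that the matrix with rows \<open>(c + a, b + p)\<close> and \<open>(b - p, c - a)\<close> is singular, hence a product
  of two vectors \<open>z\<close> and \<open>w\<close>; after a discussion of parities, solutions correspond to pairs of integer
  vectors with \<open>w\<close> primitive, determinant \<open>p\<close> and \<open>|z| |w| \<le> sqrt x\<close>. By symmetry one may take
  \<open>|w| \<le> |z|\<close>. For given \<open>w\<close> the admissible \<open>z\<close> are then the points of an arithmetic progression on a
  chord, namely \<open>2 sqrt (x - p\<^sup>2) / |w|\<^sup>2 + O(1)\<close> of them, and summing over the primitive \<open>w\<close> with
  \<open>|w|\<^sup>2 \<le> sqrt x\<close> gives \<open>(2/pi) sqrt (x - p\<^sup>2) ln (sqrt x) + O(sqrt x)\<close> solutions on average over \<open>p\<close>.

  The sum over \<open>p\<close> is evaluated with the prime number theorem, in the form that the sum of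
  \<open>(\<Lambda>(n) - 1) ln\<^sup>2 n\<close> over \<open>n \<le> y\<close> is \<open>O(y ln y)\<close>. This follows from Perron's formula on the line
  \<open>Re s = 1 + 1 / ln y\<close>, where the second derivative of \<open>- \<zeta>'/\<zeta> - \<zeta>\<close> is \<open>O(sqrt (1 + |Im s|))\<close>:
  the pole at \<open>1\<close> cancels, and \<open>3 + 4 cos \<theta> + cos (2\<theta>) \<ge> 0\<close> bounds \<open>\<zeta>\<close> from below.
\<close>

section \<open>Dirichlet series\<close>

text \<open>The constant is \<open>2/pi * pi/4 = 1/2\<close>: the logarithm in the number of
  solutions for one \<open>p\<close> cancels the density of the primes near \<open>sqrt x\<close>,
  and what remains is the area of a quarter disc. Every \<open>w\<close> costs an error O(1), so
  only O(sqrt x) vectors \<open>w\<close> can be afforded; hence the longer vector has to be the one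
  counted along a chord. Exchanging \<open>z\<close> and \<open>w\<close> requires both to be
  primitive, and here the primality of \<open>p\<close> enters the geometry: the gcd of an
  imprimitive \<open>z\<close> divides the determinant \<open>p\<close>, so \<open>z\<close> is
  \<open>p\<close> times a vector, and such pairs are few. On the analytic side no zero-free region
  is used. The integral on the line \<open>1 + 1 / ln y\<close> is estimated absolutely and has only
  the trivial order \<open>y\<close>; the whole saving lies in the weight ln^2, that is, in two
  derivatives. Removing the smoothing spends one of the two logarithms, and the relative error
  \<open>1 / ln y\<close> that is left is enough. The kernel \<open>1 / (s (s + 1))\<close>
  tolerates a growth of the series below \<open>|t|\<close>, so it suffices to continue zeta
  slightly to the left of the line, where it grows like \<open>|s| powr (1/30)\<close>.\<close>

text \<open>The term with index \<open>0\<close> vanishes, because \<open>0 powr s = 0\<close>.\<close>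

definition dirichlet :: "(nat \<Rightarrow> real) \<Rightarrow> complex \<Rightarrow> complex" where
  "dirichlet a s = (\<Sum>n. of_real (a n) * of_nat n powr (-s))"

text \<open>Abscissa of absolute convergence at most 1. Asking for all \<open>\<sigma> > 1\<close>
  instead of a growth bound keeps the class closed under multiplication by ln, that is, under
  differentiation of the series.\<close>

definition tame :: "(nat \<Rightarrow> real) \<Rightarrow> bool" where
  "tame a \<longleftrightarrow> (\<forall>\<sigma>>1. summable (\<lambda>n. \<bar>a n\<bar> * real n powr (-\<sigma>)))"

lemma norm_dirichlet_term:
  "norm (complex_of_real (a n) * of_nat n powr (-s)) = \<bar>a n\<bar> * real n powr (- Re s)"
  by (simp add: norm_mult norm_powr_real_powr)

text \<open>Half of the distance from \<open>\<sigma>\<close> to 1 is spent on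
  \<open>ln n \<le> n powr \<delta> / \<delta>\<close>; the other half keeps the series
  convergent.\<close>

lemma tame_mult_ln:
  assumes "tame a"
  shows "tame (\<lambda>n. a n * ln (real n))"
  unfolding tame_def
proof (intro allI impI)
  fix \<sigma> :: real assume \<sigma>: "\<sigma> > 1"
  define \<delta> where "\<delta> = (\<sigma> - 1) / 2"
  have \<delta>: "\<delta> > 0" "\<sigma> - \<delta> > 1" using \<sigma> by (auto simp: \<delta>_def field_simps)
  have "summable (\<lambda>n. (1 / \<delta>) * (\<bar>a n\<bar> * real n powr (-(\<sigma> - \<delta>))))"
    using assms \<delta> by (intro summable_mult) (auto simp: tame_def)
  then show "summable (\<lambda>n. \<bar>a n * ln (real n)\<bar> * real n powr (-\<sigma>))"
  proof (rule summable_comparison_test')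
    fix n :: nat assume "n \<ge> 1"
    then have n: "real n \<ge> 1" by simp
    have "ln (real n) \<le> real n powr \<delta> / \<delta>" using n \<delta> by (intro ln_powr_bound)
    then have "\<bar>a n\<bar> * ln (real n) * real n powr (-\<sigma>) \<le> \<bar>a n\<bar> * (real n powr \<delta> / \<delta>) * real n powr (-\<sigma>)"
      by (intro mult_right_mono mult_left_mono) auto
    also have "\<dots> = (1 / \<delta>) * (\<bar>a n\<bar> * (real n powr \<delta> * real n powr (-\<sigma>)))" by simp
    also have "real n powr \<delta> * real n powr (-\<sigma>) = real n powr (-(\<sigma> - \<delta>))"
      by (simp add: powr_add [symmetric])
    finally show "norm (\<bar>a n * ln (real n)\<bar> * real n powr (-\<sigma>)) \<le> (1 / \<delta>) * (\<bar>a n\<bar> * real n powr (-(\<sigma> - \<delta>)))"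
      using n by (simp add: abs_mult)
  qed
qed

lemma tame_1: "tame (\<lambda>_. 1)"
  by (simp add: tame_def summable_real_powr_iff)

lemma tame_mono:
  assumes "tame b" "\<And>n. n \<ge> 1 \<Longrightarrow> \<bar>a n\<bar> \<le> \<bar>b n\<bar>"
  shows "tame a"
  unfolding tame_def
proof (intro allI impI)
  fix \<sigma> :: real assume "\<sigma> > 1"
  then have "summable (\<lambda>n. \<bar>b n\<bar> * real n powr (-\<sigma>))" using assms by (auto simp: tame_def)
  then show "summable (\<lambda>n. \<bar>a n\<bar> * real n powr (-\<sigma>))"
    by (rule summable_comparison_test'[where N = 1]) (auto intro!: mult_right_mono assms(2))
qed

lemma tame_diff:
  assumes "tame a" "tame b"
  shows "tame (\<lambda>n. a n - b n)"
  unfolding tame_def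
proof (intro allI impI)
  fix \<sigma> :: real assume "\<sigma> > 1"
  then have "summable (\<lambda>n. \<bar>a n\<bar> * real n powr (-\<sigma>) + \<bar>b n\<bar> * real n powr (-\<sigma>))"
    using assms by (intro summable_add) (auto simp: tame_def)
  then show "summable (\<lambda>n. \<bar>a n - b n\<bar> * real n powr (-\<sigma>))"
    by (rule summable_comparison_test') (auto simp: abs_mult ring_distribs(2)[symmetric] intro!: mult_right_mono)
qed

lemma tame_ln: "tame (\<lambda>n. ln (real n))"
  using tame_mult_ln[OF tame_1] by simp

lemma tame_mangoldt: "tame mangoldt"
  by (rule tame_mono[OF tame_ln]) (auto intro!: mangoldt_le order_trans[OF mangoldt_le abs_ge_self])

text \<open>These quotients are the coefficients of the logarithm of zeta. At \<open>n = 1\<close>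
  the quotient is 0 / 0, which is 0.\<close>

lemma mangoldt_div_ln_le: "mangoldt n / ln (real n) \<le> (1::real)" "mangoldt n / ln (real n) \<ge> (0::real)"
proof -
  consider "n = 0" | "n = 1" | "n \<ge> 2" by linarith
  then show "mangoldt n / ln (real n) \<le> (1::real)"
    by cases (auto simp: mangoldt_le)
  show "mangoldt n / ln (real n) \<ge> (0::real)"
    by (cases "n = 0") (auto intro!: divide_nonneg_nonneg simp: mangoldt_nonneg)
qed

lemma mangoldt_div_ln_mult: "mangoldt n / ln (real n) * ln (real n) = (mangoldt n :: real)"
proof -
  consider "n = 0" | "n = 1" | "n \<ge> 2" by linarith
  then show ?thesis by cases auto
qed

lemma tame_mangoldt_div_ln: "tame (\<lambda>n. mangoldt n / ln (real n))"
  by (rule tame_mono[OF tame_1]) (use mangoldt_div_ln_le in \<open>auto simp: abs_le_iff intro: order_trans[of _ 0]\<close>)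

lemma summable_norm_dirichlet:
  "tame a \<Longrightarrow> Re s > 1 \<Longrightarrow> summable (\<lambda>n. norm (complex_of_real (a n) * of_nat n powr (-s)))"
  unfolding norm_dirichlet_term tame_def by blast

lemma dirichlet_sums:
  assumes "tame a" "Re s > 1"
  shows "(\<lambda>n. of_real (a n) * of_nat n powr (-s)) sums dirichlet a s"
  unfolding dirichlet_def using summable_norm_cancel[OF summable_norm_dirichlet[OF assms]] by (rule summable_sums)

lemma dirichlet_diff:
  assumes "tame a" "tame b" "Re s > 1"
  shows "dirichlet (\<lambda>n. a n - b n) s = dirichlet a s - dirichlet b s"
proof (rule sums_unique2[OF dirichlet_sums[OF tame_diff[OF assms(1,2)] assms(3)]])
  show "(\<lambda>n. complex_of_real (a n - b n) * of_nat n powr (-s)) sums (dirichlet a s - dirichlet b s)"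
    using sums_diff[OF dirichlet_sums[OF assms(1,3)] dirichlet_sums[OF assms(2,3)]]
    by (simp add: algebra_simps)
qed

lemma dirichlet_has_field_derivative:
  assumes a: "tame a" and s: "Re s > 1"
  shows "(dirichlet a has_field_derivative - dirichlet (\<lambda>n. a n * ln (real n)) s) (at s)"
proof -
  define S where "S = {s. Re s > 1}"
  have S: "open S" unfolding S_def by (rule open_halfspace_Re_gt)
  define f where "f n s = complex_of_real (a n) * of_nat n powr (-s)" for n s
  define f' where "f' n s = - (complex_of_real (a n * ln (real n)) * of_nat n powr (-s))" for n s
  have 1: "(f n has_field_derivative f' n x) (at x)" if "x \<in> S" for n x
  proof (cases "n = 0")
    case True
    then have "f n = (\<lambda>s. 0)" "f' n x = 0" by (auto simp: f_def f'_def)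
    then show ?thesis by simp
  next
    case False
    then have *: "Ln (of_nat n) = of_real (ln (real n))" by (metis Ln_of_nat of_nat_0_less_iff bot_nat_0.not_eq_extremum)
    have "of_nat n powr (-w) = exp (- (w * of_real (ln (real n))))" for w :: complex
      using False by (simp add: powr_def *)
    then show ?thesis unfolding f_def f'_def
      by (auto intro!: derivative_eq_intros)
  qed
  have 2: "\<exists>d h. 0 < d \<and> summable h \<and> range h \<subseteq> \<real>\<^sub>\<ge>\<^sub>0 \<and> (\<forall>\<^sub>F n in sequentially. \<forall>y\<in>ball x d \<inter> S. cmod (f n y) \<le> cmod (h n))"
    if x: "x \<in> S" for x
  proof -
    \<comment> \<open>Half the distance from \<open>x\<close> to the line Re = 1, so that one
      convergent majorant serves the whole ball around \<open>x\<close>.\<close>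
    define d where "d = (Re x - 1) / 2"
    define h where "h n = complex_of_real (\<bar>a n\<bar> * real n powr (-(Re x - d)))" for n
    have d: "d > 0" "Re x - d > 1" using x by (auto simp: d_def S_def field_simps)
    have "summable h" unfolding h_def using a d by (intro summable_of_real) (auto simp: tame_def)
    moreover have "range h \<subseteq> \<real>\<^sub>\<ge>\<^sub>0" by (auto simp: h_def)
    moreover have "\<forall>\<^sub>F n in sequentially. \<forall>y\<in>ball x d \<inter> S. cmod (f n y) \<le> cmod (h n)"
    proof (intro eventually_sequentiallyI[of 1] ballI)
      fix n :: nat and y assume n: "1 \<le> n" and y: "y \<in> ball x d \<inter> S"
      have "\<bar>Re (x - y)\<bar> \<le> norm (x - y)" by (rule abs_Re_le_cmod)
      then have "Re y \<ge> Re x - d" using y by (auto simp: dist_norm)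
      then have "real n powr (- Re y) \<le> real n powr (-(Re x - d))" using n by (intro powr_mono) auto
      then show "cmod (f n y) \<le> cmod (h n)" unfolding f_def norm_dirichlet_term h_def norm_of_real
        by (simp add: abs_mult mult_left_mono)
    qed
    ultimately show ?thesis using d by blast
  qed
  obtain g g' where g: "\<And>x. x \<in> S \<Longrightarrow> ((\<lambda>n. f n x) sums g x) \<and> ((\<lambda>n. f' n x) sums g' x) \<and> (g has_field_derivative g' x) (at x)"
    using series_and_derivative_comparison_complex[of S f f', OF S 1 2] by blast
  have geq: "g x = dirichlet a x" if "x \<in> S" for x
    using g[OF that] dirichlet_sums[OF a, of x] that unfolding f_def S_def by (auto intro: sums_unique2)
  have g'eq: "g' x = - dirichlet (\<lambda>n. a n * ln (real n)) x" if "x \<in> S" for x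
    using g[OF that] sums_minus[OF dirichlet_sums[OF tame_mult_ln[OF a], of x]] that
    unfolding f'_def S_def by (auto intro: sums_unique2)
  have sS: "s \<in> S" using s by (simp add: S_def)
  have "(g has_field_derivative - dirichlet (\<lambda>n. a n * ln (real n)) s) (at s)"
    using g[OF sS] g'eq[OF sS] by simp
  then show ?thesis
    by (rule has_field_derivative_transform_within_open[OF _ S sS geq])
qed

section \<open>The zeta function on Re s > 1: convolution with the von Mangoldt function and
  exponential form\<close>

definition zeta :: "complex \<Rightarrow> complex" where "zeta = dirichlet (\<lambda>_. 1)"

text \<open>The product of the two absolutely convergent series is rearranged along
  \<open>n = d * m\<close>, and the divisor sum of the von Mangoldt function is ln. The right-hand
  side is minus the derivative of zeta, so this is the logarithmic derivative in a form free of
  division.\<close>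

lemma dirichlet_mangoldt_mult_zeta:
  assumes s: "Re s > 1"
  shows "dirichlet mangoldt s * zeta s = dirichlet (\<lambda>n. ln (real n)) s"
proof -
  define A where "A n = complex_of_real (mangoldt n) * of_nat n powr (-s)" for n :: nat
  define B where "B n = complex_of_real 1 * of_nat n powr (-s)" for n :: nat
  define SA where "SA = dirichlet mangoldt s"
  have A: "(A has_sum SA) UNIV" unfolding A_def SA_def
    by (rule norm_summable_imp_has_sum[OF summable_norm_dirichlet[OF tame_mangoldt s] dirichlet_sums[OF tame_mangoldt s]])
  have B: "(B has_sum zeta s) UNIV" unfolding B_def zeta_def
    by (rule norm_summable_imp_has_sum[OF summable_norm_dirichlet[OF tame_1 s] dirichlet_sums[OF tame_1 s]])
  have A': "(\<lambda>n. norm (A n)) summable_on UNIV" unfolding A_def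
    using summable_norm_dirichlet[OF tame_mangoldt s] by (intro norm_summable_imp_summable_on) simp
  have B': "(\<lambda>n. norm (B n)) summable_on UNIV" unfolding B_def
    using summable_norm_dirichlet[OF tame_1 s] by (intro norm_summable_imp_summable_on) simp
  \<comment> \<open>Index 0 must go before the sum is sorted by products, since the divisors of 0
    form an infinite set.\<close>
  define N where "N = {1::nat..}"
  have AN: "(A has_sum SA) N"
    by (rule has_sum_cong_neutral[THEN iffD1, OF _ _ _ A]) (auto simp: N_def A_def not_less_eq_eq)
  have BN: "(B has_sum zeta s) N"
    by (rule has_sum_cong_neutral[THEN iffD1, OF _ _ _ B]) (auto simp: N_def B_def not_less_eq_eq)
  have AN': "(\<lambda>n. norm (A n)) summable_on N" by (rule summable_on_subset_banach[OF A']) auto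
  have BN': "(\<lambda>n. norm (B n)) summable_on N" by (rule summable_on_subset_banach[OF B']) auto
  have "(\<lambda>x. norm ((\<lambda>(d,m). A d * B m) x)) summable_on N \<times> N"
    unfolding Infinite_Sum.abs_summable_on_Sigma_iff
  proof (intro conjI ballI)
    fix d
    show "(\<lambda>m. norm ((\<lambda>(d,m). A d * B m) (d, m))) summable_on N"
      using BN' by (simp add: norm_mult summable_on_cmult_right)
  next
    define K where "K = (\<Sum>\<^sub>\<infinity>m\<in>N. norm (B m))"
    have K: "K \<ge> 0" unfolding K_def by (intro infsum_nonneg) auto
    have "(\<Sum>\<^sub>\<infinity>m\<in>N. norm ((\<lambda>(d,m). A d * B m) (d, m))) = norm (A d) * K" for d
      unfolding K_def by (simp add: norm_mult infsum_cmult_right')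
    then have "norm (\<Sum>\<^sub>\<infinity>m\<in>N. norm ((\<lambda>(d,m). A d * B m) (d, m))) = norm (A d) * K" for d
      using K by simp
    then show "(\<lambda>d. norm (\<Sum>\<^sub>\<infinity>m\<in>N. norm ((\<lambda>(d,m). A d * B m) (d, m)))) summable_on N"
      using summable_on_cmult_left[OF AN', of K] by (simp only:)
  qed
  then have sm: "(\<lambda>(d,m). A d * B m) summable_on N \<times> N" by (rule Infinite_Sum.abs_summable_summable)
  have "((\<lambda>(d,m). A d * B m) has_sum (SA * zeta s)) (N \<times> N)"
    by (rule has_sum_SigmaI[where g = "\<lambda>d. A d * zeta s"])
      (use sm AN BN in \<open>auto intro!: has_sum_cmult_right has_sum_cmult_left\<close>)
  also have "?this \<longleftrightarrow> ((\<lambda>(n,d). A d * B (n div d)) has_sum (SA * zeta s)) (SIGMA n:N. {d. d dvd n})"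
    by (rule has_sum_reindex_bij_witness[where j = "\<lambda>(d,m). (d*m, d)" and i = "\<lambda>(n,d). (d, n div d)"])
      (auto simp: N_def dvd_imp_le Suc_le_eq intro!: Nat.gr0I)
  finally have "((\<lambda>n. \<Sum>d | d dvd n. A d * B (n div d)) has_sum (SA * zeta s)) N"
    by (rule has_sum_SigmaD) (auto simp: N_def intro!: has_sum_finite)
  moreover have "(\<Sum>d | d dvd n. A d * B (n div d)) = of_real (ln (real n)) * of_nat n powr (-s)" if n: "n \<in> N" for n
  proof -
    have "A d * B (n div d) = of_real (mangoldt d) * of_nat n powr (-s)" if d: "d dvd n" for d
    proof -
      obtain m where m: "n = d * m" using d by blast
      with n have "d > 0" "m > 0" by (auto simp: N_def intro!: Nat.gr0I)
      then show ?thesis unfolding A_def B_def m by (simp add: powr_times_real)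
    qed
    then have "(\<Sum>d | d dvd n. A d * B (n div d)) = (\<Sum>d | d dvd n. of_real (mangoldt d)) * of_nat n powr (-s)"
      by (simp add: sum_distrib_right)
    also have "(\<Sum>d | d dvd n. complex_of_real (mangoldt d)) = of_real (ln (real n))"
      using mangoldt_sum[of n, where ?'a = complex] n by (simp add: N_def)
    finally show ?thesis .
  qed
  ultimately have "((\<lambda>n. of_real (ln (real n)) * of_nat n powr (-s)) has_sum (SA * zeta s)) N"
    using has_sum_cong by force
  then have "((\<lambda>n. of_real (ln (real n)) * of_nat n powr (-s)) has_sum (SA * zeta s)) UNIV"
    by (rule has_sum_cong_neutral[THEN iffD1, rotated 3]) (auto simp: N_def not_less_eq_eq)
  then have "(\<lambda>n. of_real (ln (real n)) * of_nat n powr (-s)) sums (SA * zeta s)"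
    by (rule has_sum_imp_sums)
  with dirichlet_sums[OF tame_ln s] show ?thesis unfolding SA_def by (rule sums_unique2[symmetric])
qed

lemma zeta_has_field_derivative:
  assumes "Re s > 1"
  shows "(zeta has_field_derivative - (dirichlet mangoldt s * zeta s)) (at s)"
  using dirichlet_has_field_derivative[OF tame_1 assms] unfolding dirichlet_mangoldt_mult_zeta[OF assms]
  by (simp add: zeta_def)

lemma zeta_2_nonzero: "zeta 2 \<noteq> 0"
proof -
  have "(\<lambda>n. complex_of_real (real n powr (-2))) sums zeta 2"
    using dirichlet_sums[OF tame_1, of 2] by (simp add: zeta_def powr_of_real[symmetric])
  moreover have s: "summable (\<lambda>n. real n powr (-2))" by (simp add: summable_real_powr_iff)
  ultimately have "zeta 2 = of_real (\<Sum>n. real n powr (-2))"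
    by (rule sums_unique2[OF _ sums_of_real[OF summable_sums]])
  moreover have "(\<Sum>n. real n powr (-2)) > 0"
    using s by (rule suminf_pos2[of _ 1]) auto
  ultimately show ?thesis by simp
qed

text \<open>Takes the place of the Euler product: \<open>zeta s * exp (- P s)\<close> has derivative
  0 on a convex half-plane and is therefore a constant. Its value stays undetermined; it is nonzero
  because \<open>zeta 2\<close> is.\<close>

lemma zeta_exp:
  obtains \<kappa> where "\<kappa> \<noteq> 0"
    "\<And>s. Re s > 1 \<Longrightarrow> zeta s = \<kappa> * exp (dirichlet (\<lambda>n. mangoldt n / ln (real n)) s)"
proof -
  define P where "P = dirichlet (\<lambda>n. mangoldt n / ln (real n))"
  have P: "(P has_field_derivative - dirichlet mangoldt s) (at s)" if "Re s > 1" for s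
    using dirichlet_has_field_derivative[OF tame_mangoldt_div_ln that]
    unfolding mangoldt_div_ln_mult P_def .
  have "\<exists>\<kappa>. \<forall>s \<in> {s. Re s > 1}. zeta s * exp (- P s) = \<kappa>"
  proof (rule has_field_derivative_zero_constant)
    show "convex {s. Re s > 1}" by (rule convex_halfspace_Re_gt)
    fix s assume s: "s \<in> {s. Re s > 1}"
    have "((\<lambda>s. zeta s * exp (- P s)) has_field_derivative 0) (at s)"
      using s by (auto intro!: derivative_eq_intros zeta_has_field_derivative P simp: algebra_simps)
    then show "((\<lambda>s. zeta s * exp (- P s)) has_field_derivative 0) (at s within {s. Re s > 1})"
      by (rule has_field_derivative_at_within)
  qed
  then obtain \<kappa> where \<kappa>: "\<And>s. Re s > 1 \<Longrightarrow> zeta s * exp (- P s) = \<kappa>" by auto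
  then have "zeta s = \<kappa> * exp (P s)" if "Re s > 1" for s
    using \<kappa>[OF that] by (auto simp: exp_minus field_simps)
  moreover have "\<kappa> \<noteq> 0" using \<kappa>[of 2] zeta_2_nonzero by auto
  ultimately show ?thesis using that unfolding P_def by blast
qed

lemma zeta_nonzero: "Re s > 1 \<Longrightarrow> zeta s \<noteq> 0"
  using zeta_exp by (metis exp_not_eq_zero mult_eq_0_iff)

text \<open>By the exponential form the product is \<open>norm \<kappa> ^ 8\<close>, with 8 = 3 + 4
  + 1, times the exponential of a series with the nonnegative weights
  \<open>2 * (1 + cos (t * ln n))^2\<close>, which is 3 + 4 cos + cos of the double angle.\<close>

lemma zeta_341:
  obtains \<kappa> :: real where "\<kappa> > 0"
    "\<And>\<sigma> t. \<sigma> > 1 \<Longrightarrow> norm (zeta (of_real \<sigma>)) ^ 3 * norm (zeta (Complex \<sigma> t)) ^ 4 * norm (zeta (Complex \<sigma> (2*t))) \<ge> \<kappa>"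
proof -
  obtain \<kappa> where \<kappa>: "\<kappa> \<noteq> 0" and z:
    "\<And>s. Re s > 1 \<Longrightarrow> zeta s = \<kappa> * exp (dirichlet (\<lambda>n. mangoldt n / ln (real n)) s)"
    using zeta_exp by blast
  define a where "a n = mangoldt n / ln (real n)" for n
  have a: "tame a" unfolding a_def by (rule tame_mangoldt_div_ln)
  have "norm \<kappa> ^ 8 \<le> norm (zeta (of_real \<sigma>)) ^ 3 * norm (zeta (Complex \<sigma> t)) ^ 4 * norm (zeta (Complex \<sigma> (2*t)))"
    if \<sigma>: "\<sigma> > 1" for \<sigma> t
  proof -
    have re: "(\<lambda>n. a n * (real n powr (-\<sigma>) * cos (u * ln (real n)))) sums Re (dirichlet a (Complex \<sigma> u))" for u
    proof -
      have "(\<lambda>n. Re (of_real (a n) * of_nat n powr (- Complex \<sigma> u))) sums Re (dirichlet a (Complex \<sigma> u))"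
        using \<sigma> by (intro sums_Re dirichlet_sums a) auto
      moreover have "Re (of_real (a n) * of_nat n powr (- Complex \<sigma> u)) = a n * (real n powr (-\<sigma>) * cos (u * ln (real n)))" for n
      proof (cases "n = 0")
        case False
        then have *: "Ln (of_nat n) = of_real (ln (real n))" by (metis Ln_of_nat of_nat_0_less_iff bot_nat_0.not_eq_extremum)
        show ?thesis using False by (simp add: powr_def * Re_exp)
      qed simp
      ultimately show ?thesis by (simp only:)
    qed
    have fS: "(\<lambda>n. 3 * (a n * (real n powr (-\<sigma>) * cos (0 * ln (real n)))) + 4 * (a n * (real n powr (-\<sigma>) * cos (t * ln (real n))))
        + a n * (real n powr (-\<sigma>) * cos ((2*t) * ln (real n)))) sums
        (3 * Re (dirichlet a (Complex \<sigma> 0)) + 4 * Re (dirichlet a (Complex \<sigma> t)) + Re (dirichlet a (Complex \<sigma> (2*t))))"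
      (is "?f sums ?S")
      by (intro sums_add sums_mult re)
    have S: "0 \<le> ?S"
    proof (rule sums_le[OF _ sums_zero fS])
      fix n
      have c: "cos ((2*t) * ln (real n)) = 2 * (cos (t * ln (real n)))\<^sup>2 - 1"
        using cos_double_cos[of "t * ln (real n)"] by (simp add: mult.assoc)
      have "?f n = a n * real n powr (-\<sigma>) * (2 * (1 + cos (t * ln (real n)))\<^sup>2)"
        unfolding c by (simp add: algebra_simps power2_eq_square)
      moreover have "a n \<ge> 0" unfolding a_def by (rule mangoldt_div_ln_le)
      then have "a n * real n powr (-\<sigma>) * (2 * (1 + cos (t * ln (real n)))\<^sup>2) \<ge> 0"
        by (intro mult_nonneg_nonneg) auto
      ultimately show "0 \<le> ?f n" by (simp only:)
    qed
    have nz: "norm (zeta (Complex \<sigma> u)) = norm \<kappa> * exp (Re (dirichlet a (Complex \<sigma> u)))" for u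
      using z[of "Complex \<sigma> u"] \<sigma> unfolding a_def[symmetric] by (simp add: norm_mult)
    have c0: "of_real \<sigma> = Complex \<sigma> 0" by (simp add: complex_eq_iff)
    have "norm (zeta (of_real \<sigma>)) ^ 3 * norm (zeta (Complex \<sigma> t)) ^ 4 * norm (zeta (Complex \<sigma> (2*t)))
      = norm \<kappa> ^ 8 * exp ?S"
    proof -
      have "exp (3 * x + 4 * y + z) = exp x ^ 3 * exp y ^ 4 * exp z" for x y z :: real
        using exp_of_nat_mult[of 3 x] exp_of_nat_mult[of 4 y] by (simp add: exp_add)
      moreover have "(k * x) ^ 3 * (k * y) ^ 4 * (k * z) = k ^ 8 * (x ^ 3 * y ^ 4 * z)" for k x y z :: real
        by (simp add: power_mult_distrib) (simp add: eval_nat_numeral)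
      ultimately show ?thesis unfolding c0 nz by (simp only:)
    qed
    then show ?thesis using S by (simp add: mult_le_cancel_left1)
  qed
  then show ?thesis using that[of "norm \<kappa> ^ 8"] \<kappa> by simp
qed

section \<open>The zeta function near the line Re s = 1\<close>

text \<open>The difference between \<open>(s - 1) * m powr (-s)\<close> and the integral of
  \<open>(s - 1) * u powr (-s)\<close> over \<open>[m, m + 1]\<close>, where
  \<open>m = Suc n\<close>. The integrals telescope, so the sum of these terms is
  \<open>(s - 1) * zeta s - 1\<close>, but it converges further to the left.\<close>

definition zterm :: "nat \<Rightarrow> complex \<Rightarrow> complex" where
  "zterm n s = (s - 1) * of_nat (Suc n) powr (-s) + of_nat (Suc (Suc n)) powr (1 - s) - of_nat (Suc n) powr (1 - s)"

lemma norm_powr_diff_le: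
  fixes m x :: real and s :: complex
  assumes m: "m > 0" "m \<le> x" "x \<le> m + 1" and s: "Re s > 0"
  shows "norm (of_real m powr (-s) - of_real x powr (-s)) \<le> norm s * m powr (- Re s - 1)"
proof -
  define S where "S = closed_segment (complex_of_real m) (of_real x)"
  have S: "\<exists>v. z = of_real v \<and> m \<le> v \<and> v \<le> x" if "z \<in> S" for z
    using that m unfolding S_def closed_segment_of_real by (auto simp: closed_segment_eq_real_ivl)
  have "norm (of_real m powr (-s) - of_real x powr (-s)) \<le> (norm s * m powr (- Re s - 1)) * norm (complex_of_real m - of_real x)"
  proof (rule field_differentiable_bound[of S "\<lambda>z. z powr (-s)" "\<lambda>z. (-s) * z powr (-s-1)"])
    show "convex S" by (simp add: S_def)
    fix z assume "z \<in> S"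
    then obtain v where v: "z = of_real v" "m \<le> v" "v \<le> x" using S by blast
    then have "z \<notin> \<real>\<^sub>\<le>\<^sub>0" using m by (auto simp: complex_nonpos_Reals_iff)
    then show "((\<lambda>z. z powr (-s)) has_field_derivative (-s) * z powr (-s-1)) (at z within S)"
      using has_field_derivative_powr has_field_derivative_at_within by blast
    have "v powr (- Re s - 1) \<le> m powr (- Re s - 1)"
      using v m s by (intro powr_mono2') auto
    then show "norm ((-s) * z powr (-s-1)) \<le> norm s * m powr (- Re s - 1)"
      using v m by (simp add: norm_mult norm_powr_real_powr mult_left_mono)
  qed (auto simp: S_def)
  also have "\<dots> \<le> (norm s * m powr (- Re s - 1)) * 1"
    using m by (intro mult_left_mono) (auto simp flip: of_real_diff)
  finally show ?thesis by simp
qed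

lemma norm_powr_diff_le2:
  fixes m x :: real and s :: complex
  assumes m: "m > 0" "m \<le> x" and s: "Re s > 0"
  shows "norm (of_real m powr (-s) - of_real x powr (-s)) \<le> 2 * m powr (- Re s)"
proof -
  have "norm (of_real m powr (-s) - of_real x powr (-s)) \<le> norm (of_real m powr (-s)) + norm (of_real x powr (-s))"
    by (rule norm_triangle_ineq4)
  also have "\<dots> = m powr (- Re s) + x powr (- Re s)" using m by (simp add: norm_powr_real_powr)
  also have "x powr (- Re s) \<le> m powr (- Re s)" using m s by (intro powr_mono2') auto
  finally show ?thesis by simp
qed

text \<open>Interpolates between the trivial bound, used when \<open>norm s \<ge> m\<close>, and the
  mean value bound, used otherwise. The gain \<open>m powr (-\<eta>)\<close> is paid for by
  \<open>norm s powr \<eta>\<close> only, instead of by \<open>norm s\<close>.\<close>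

lemma norm_powr_diff_interpolated:
  fixes m x \<eta> :: real and s :: complex
  assumes m: "m > 0" "m \<le> x" "x \<le> m + 1" and s: "Re s > 0" and \<eta>: "0 < \<eta>" "\<eta> < 1"
  shows "norm (of_real m powr (-s) - of_real x powr (-s)) \<le> 2 * norm s powr \<eta> * m powr (- Re s - \<eta>)"
proof (cases "norm s \<ge> m")
  case True
  have "2 * m powr (- Re s) = 2 * m powr \<eta> * m powr (- Re s - \<eta>)" using m by (simp flip: powr_add)
  also have "\<dots> \<le> 2 * norm s powr \<eta> * m powr (- Re s - \<eta>)"
    using True m \<eta> by (intro mult_right_mono mult_left_mono powr_mono2) auto
  finally show ?thesis using norm_powr_diff_le2[OF m(1,2) s] by simp
next
  case False
  have sn: "norm s > 0" using s by auto
  have "norm s * m powr (- Re s - 1) = norm s powr \<eta> * norm s powr (1 - \<eta>) * m powr (- Re s - 1)"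
    using sn by (simp flip: powr_add)
  also have "\<dots> \<le> norm s powr \<eta> * m powr (1 - \<eta>) * m powr (- Re s - 1)"
    using False m \<eta> by (intro mult_right_mono mult_left_mono powr_mono2) auto
  also have "\<dots> = norm s powr \<eta> * m powr (- Re s - \<eta>)" using m by (simp add: mult.assoc minus_diff_commute flip: powr_add)
  also have "\<dots> \<le> 2 * norm s powr \<eta> * m powr (- Re s - \<eta>)" by simp
  finally show ?thesis using norm_powr_diff_le[OF m s] by simp
qed

text \<open>The exponent \<open>1/30\<close> is such that the bounds for the second derivative of the logarithmic
  derivative of zeta, which lose it fifteen times, end up with the harmless factor \<open>\<bar>t\<bar> powr (1/2)\<close>.\<close>

lemma norm_zterm_le:
  assumes s: "Re s \<ge> 59/60"
  shows "norm (zterm n s) \<le> norm (s - 1) * (2 * norm s powr (1/30) * real (Suc n) powr (-61/60))"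
proof -
  define m where "m = real (Suc n)"
  have m: "m \<ge> 1" by (simp add: m_def)
  define B where "B = 2 * norm s powr (1/30) * m powr (-61/60)"
  define S where "S = closed_segment (complex_of_real m) (of_real (m+1))"
  have S: "\<exists>v. z = of_real v \<and> m \<le> v \<and> v \<le> m+1" if "z \<in> S" for z
    using that m unfolding S_def closed_segment_of_real by (auto simp: closed_segment_eq_real_ivl)
  \<comment> \<open>Chosen so that its increment over \<open>[m, m + 1]\<close> is
    \<open>zterm n s\<close>, while its derivative is \<open>s - 1\<close> times a difference of
    powers.\<close>
  define h where "h z = (s - 1) * of_real m powr (-s) * (z - of_real m) + z powr (1 - s)" for z
  have "norm (h (of_real (m+1)) - h (of_real m)) \<le> (norm (s-1) * B) * norm (complex_of_real (m+1) - of_real m)"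
  proof (rule field_differentiable_bound[of S h "\<lambda>z. (s - 1) * (of_real m powr (-s) - z powr (-s))"])
    show "convex S" by (simp add: S_def)
    fix z assume "z \<in> S"
    then obtain v where v: "z = of_real v" "m \<le> v" "v \<le> m+1" using S by blast
    then have z: "z \<notin> \<real>\<^sub>\<le>\<^sub>0" using m by (auto simp: complex_nonpos_Reals_iff)
    have "(h has_field_derivative (s - 1) * of_real m powr (-s) + (1 - s) * z powr (1 - s - 1)) (at z)"
      unfolding h_def by (auto intro!: derivative_eq_intros has_field_derivative_powr z)
    also have "(s - 1) * of_real m powr (-s) + (1 - s) * z powr (1 - s - 1) = (s - 1) * (of_real m powr (-s) - z powr (-s))"
      by (simp add: algebra_simps)
    finally show "(h has_field_derivative (s - 1) * (of_real m powr (-s) - z powr (-s))) (at z within S)"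
      by (rule has_field_derivative_at_within)
    have "norm (of_real m powr (-s) - z powr (-s)) \<le> 2 * norm s powr (1/30) * m powr (- Re s - 1/30)"
      unfolding v(1) using m v s by (intro norm_powr_diff_interpolated) auto
    \<comment> \<open>Here \<open>- Re s - 1/30 \<le> -59/60 - 2/60 = -61/60\<close>, which is below
      -1 and makes the series of terms converge.\<close>
    also have "\<dots> \<le> B" unfolding B_def using m s by (intro mult_left_mono powr_mono) auto
    finally show "norm ((s - 1) * (of_real m powr (-s) - z powr (-s))) \<le> norm (s - 1) * B"
      by (simp add: norm_mult mult_left_mono)
  qed (auto simp: S_def)
  also have "h (of_real (m+1)) - h (of_real m) = zterm n s"
    by (simp add: h_def zterm_def m_def algebra_simps)
  finally show ?thesis by (simp add: B_def m_def)
qed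

definition zsum :: "complex \<Rightarrow> complex" where
  "zsum s = 1 + (\<Sum>n. zterm n s)"

lemma summable_zconst: "summable (\<lambda>n. real (Suc n) powr (-61/60))"
  using summable_real_powr_iff[of "-61/60"] by (subst summable_Suc_iff) auto

lemma zterm_sums:
  assumes s: "Re s \<ge> 59/60"
  shows "(\<lambda>n. zterm n s) sums (zsum s - 1)"
    "norm (zsum s - 1) \<le> norm (s - 1) * (2 * norm s powr (1/30) * (\<Sum>n. real (Suc n) powr (-61/60)))"
proof -
  have sm: "summable (\<lambda>n. norm (s - 1) * (2 * norm s powr (1/30) * real (Suc n) powr (-61/60)))"
    by (intro summable_mult summable_zconst)
  have sn: "summable (\<lambda>n. norm (zterm n s))"
    by (rule summable_comparison_test'[OF sm, of 0]) (use norm_zterm_le[OF s] in simp)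
  then show "(\<lambda>n. zterm n s) sums (zsum s - 1)"
    unfolding zsum_def by (simp add: summable_norm_cancel summable_sums)
  have "norm (zsum s - 1) \<le> (\<Sum>n. norm (zterm n s))"
    unfolding zsum_def using summable_norm[OF sn] by simp
  also have "\<dots> \<le> (\<Sum>n. norm (s - 1) * (2 * norm s powr (1/30) * real (Suc n) powr (-61/60)))"
    by (intro suminf_le norm_zterm_le s sn sm)
  also have "\<dots> = norm (s - 1) * (2 * norm s powr (1/30) * (\<Sum>n. real (Suc n) powr (-61/60)))"
    by (simp only: suminf_mult summable_mult summable_zconst)
  finally show "norm (zsum s - 1) \<le> norm (s - 1) * (2 * norm s powr (1/30) * (\<Sum>n. real (Suc n) powr (-61/60)))" .
qed

lemma zsum_holomorphic: "zsum holomorphic_on {s. Re s > 59/60}"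
proof -
  define S where "S = {s. Re s > 59/60}"
  have S: "open S" unfolding S_def by (rule open_halfspace_Re_gt)
  have 1: "zterm n field_differentiable (at x)" if "x \<in> S" for n x
  proof -
    have "zterm n holomorphic_on UNIV" unfolding zterm_def by (intro holomorphic_intros)
    then show ?thesis using holomorphic_on_imp_differentiable_at[OF _ open_UNIV] by blast
  qed
  have 2: "\<exists>d h. 0 < d \<and> summable h \<and> range h \<subseteq> \<real>\<^sub>\<ge>\<^sub>0 \<and> (\<forall>\<^sub>F n in sequentially. \<forall>y\<in>ball x d \<inter> S. cmod (zterm n y) \<le> cmod (h n))"
    if x: "x \<in> S" for x
  proof -
    define K where "K = (norm x + 2) * (2 * (norm x + 1) powr (1/30))"
    have K: "K \<ge> 0" by (simp add: K_def)
    define h where "h n = complex_of_real (K * real (Suc n) powr (-61/60))" for n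
    have "summable h" unfolding h_def by (intro summable_of_real summable_mult summable_zconst)
    moreover have "range h \<subseteq> \<real>\<^sub>\<ge>\<^sub>0" using K by (auto simp: h_def)
    moreover have "\<forall>\<^sub>F n in sequentially. \<forall>y\<in>ball x 1 \<inter> S. cmod (zterm n y) \<le> cmod (h n)"
    proof (intro eventually_sequentiallyI[of 0] ballI)
      fix n :: nat and y assume y: "y \<in> ball x 1 \<inter> S"
      have ny: "norm y \<le> norm x + 1" using y norm_triangle_sub[of y x] by (auto simp: dist_norm norm_minus_commute)
      have ny1: "norm (y - 1) \<le> norm x + 2" using ny norm_triangle_ineq4[of y 1] by simp
      have "norm (zterm n y) \<le> norm (y - 1) * (2 * norm y powr (1/30) * real (Suc n) powr (-61/60))"
        using y by (intro norm_zterm_le) (auto simp: S_def)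
      also have "\<dots> \<le> (norm x + 2) * (2 * (norm x + 1) powr (1/30) * real (Suc n) powr (-61/60))"
        using ny ny1 by (intro mult_mono mult_right_mono mult_left_mono powr_mono2) auto
      finally show "cmod (zterm n y) \<le> cmod (h n)" unfolding h_def norm_of_real using K
        by (simp add: K_def abs_mult mult_ac)
    qed
    ultimately show ?thesis using zero_less_one[where ?'a = real] by blast
  qed
  obtain g where g: "\<And>x. x \<in> S \<Longrightarrow> ((\<lambda>n. zterm n x) sums g x) \<and> g field_differentiable (at x)"
    using series_differentiable_comparison_complex[OF S 1 2] by metis
  have "(\<lambda>x. 1 + g x) holomorphic_on S"
    using g by (intro holomorphic_intros) (auto simp: holomorphic_on_def field_differentiable_at_within)
  then show ?thesis unfolding S_def[symmetric]
    by (rule holomorphic_transform) (use g in \<open>auto simp: zsum_def sums_iff\<close>)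
qed

lemma zsum_1: "zsum 1 = 1"
  by (simp add: zsum_def zterm_def del: of_nat_Suc)

text \<open>For Re s > 1 the telescoping part converges by itself, to -1, because
  \<open>n powr (1 - s)\<close> tends to 0; the leading 1 in \<open>zsum\<close> compensates
  it.\<close>

lemma zsum_eq_zeta:
  assumes s: "Re s > 1"
  shows "zsum s = (s - 1) * zeta s"
proof -
  have "(\<lambda>n. of_nat n powr (-s)) sums zeta s"
    using dirichlet_sums[OF tame_1 s] by (simp add: zeta_def)
  then have "(\<lambda>n. of_nat (Suc n) powr (-s)) sums zeta s"
    by (subst sums_Suc_iff) simp
  then have 1: "(\<lambda>n. (s - 1) * of_nat (Suc n) powr (-s)) sums ((s - 1) * zeta s)" by (rule sums_mult)
  have "(\<lambda>n. complex_of_nat (Suc n) powr (1 - s)) \<longlonglongrightarrow> 0"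
  proof (rule tendsto_norm_zero_cancel)
    have "(\<lambda>n. real (Suc n) powr (1 - Re s)) \<longlonglongrightarrow> 0"
      using s by (intro tendsto_neg_powr filterlim_compose[OF filterlim_real_sequentially filterlim_Suc]) auto
    moreover have "norm (complex_of_nat (Suc n) powr (1 - s)) = real (Suc n) powr (1 - Re s)" for n
      by (subst norm_powr_real_powr) auto
    ultimately show "(\<lambda>n. norm (complex_of_nat (Suc n) powr (1 - s))) \<longlonglongrightarrow> 0" by simp
  qed
  from telescope_sums[OF this]
  have "(\<lambda>n. of_nat (Suc (Suc n)) powr (1 - s) - complex_of_nat (Suc n) powr (1 - s)) sums (- 1)" by simp
  from sums_add[OF 1 this] have "(\<lambda>n. zterm n s) sums ((s - 1) * zeta s - 1)"
    by (simp add: zterm_def algebra_simps)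
  then show ?thesis unfolding zsum_def by (simp add: sums_iff)
qed

text \<open>The continuation of \<open>zeta s - 1 / (s - 1)\<close> to Re s > 59/60. The value at 1
  removes the singularity, since \<open>zsum 1 = 1\<close>.\<close>

definition zreg :: "complex \<Rightarrow> complex" where
  "zreg s = (if s = 1 then deriv zsum 1 else (zsum s - zsum 1) / (s - 1))"

lemma zreg_holomorphic: "zreg holomorphic_on {s. Re s > 59/60}"
  unfolding zreg_def using pole_lemma_open[OF zsum_holomorphic open_halfspace_Re_gt] .

text \<open>The bound for \<open>zsum s - 1\<close> carries a factor \<open>norm (s - 1)\<close>, so
  that division by \<open>s - 1\<close> leaves the growth \<open>norm s powr (1/30)\<close> even
  near the point 1.\<close>

lemma zreg_bound:
  obtains M where "M > 0" "\<And>s. Re s > 59/60 \<Longrightarrow> norm (zreg s) \<le> M * norm s powr (1/30)"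
proof
  define K where "K = 2 * (\<Sum>n. real (Suc n) powr (-61/60))"
  define M where "M = max 1 (max K (norm (zreg 1)))"
  show "M > 0" by (simp add: M_def)
  fix s :: complex assume s: "Re s > 59/60"
  show "norm (zreg s) \<le> M * norm s powr (1/30)"
  proof (cases "s = 1")
    case True then show ?thesis by (simp add: M_def)
  next
    case False
    have "norm (zreg s) = norm (zsum s - 1) / norm (s - 1)" using False by (simp add: zreg_def zsum_1 norm_divide)
    also have "\<dots> \<le> K * norm s powr (1/30)"
      using zterm_sums(2)[of s] s False by (simp add: K_def field_simps)
    also have "\<dots> \<le> M * norm s powr (1/30)" by (intro mult_right_mono) (auto simp: M_def)
    finally show ?thesis .
  qed
qed

lemma zeta_eq_zreg:
  assumes "Re s > 1"
  shows "zeta s = 1 / (s - 1) + zreg s"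
proof -
  have "s \<noteq> 1" using assms by auto
  then show ?thesis using zsum_eq_zeta[OF assms] by (simp add: zreg_def zsum_1 field_simps)
qed

section \<open>Derivatives of zeta, and bounds for zeta and its logarithmic derivative near the line
  Re s = 1\<close>

lemma tame_ln_power:
  assumes "tame a"
  shows "tame (\<lambda>n. a n * ln (real n) ^ k)"
proof (induction k)
  case (Suc k)
  then show ?case using tame_mult_ln[OF Suc.IH] by (simp add: mult_ac)
qed (use assms in simp)

lemma higher_deriv_dirichlet:
  assumes "tame a" "Re s > 1"
  shows "(deriv ^^ k) (dirichlet a) s = (-1) ^ k * dirichlet (\<lambda>n. a n * ln (real n) ^ k) s"
  using assms
proof (induction k arbitrary: s)
  case (Suc k)

  have "((deriv ^^ k) (dirichlet a) has_field_derivative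
      (-1) ^ k * - dirichlet (\<lambda>n. a n * ln (real n) ^ k * ln (real n)) s) (at s)"
  proof (rule has_field_derivative_transform_within_open)
    show "((\<lambda>s. (-1) ^ k * dirichlet (\<lambda>n. a n * ln (real n) ^ k) s) has_field_derivative
      (-1) ^ k * - dirichlet (\<lambda>n. a n * ln (real n) ^ k * ln (real n)) s) (at s)"
      by (intro DERIV_cmult dirichlet_has_field_derivative tame_ln_power Suc.prems)
    show "open {s. Re s > 1}" by (rule open_halfspace_Re_gt)
  qed (use Suc in auto)
  then show ?case by (simp add: DERIV_imp_deriv mult_ac)
qed simp

text \<open>Cauchy's inequality on the disc of radius \<open>r / 2\<close> about \<open>s\<close>.
  Since \<open>\<bar>Im s\<bar> \<ge> r\<close> the disc avoids the pole, and since
  \<open>r < 1/120\<close> it stays in Re > 59/60, so differentiation does not worsen the exponent.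
  The second derivative of the logarithmic derivative involves derivatives of zeta up to
  \<open>k = 3\<close>.\<close>

lemma zeta_higher_deriv_bound:
  assumes r: "r > 0" "r < 1/120"
  obtains C where "C > 0" "\<And>k s. k \<le> 3 \<Longrightarrow> 1 < Re s \<Longrightarrow> Re s \<le> 2 \<Longrightarrow> \<bar>Im s\<bar> \<ge> r \<Longrightarrow>
    norm (dirichlet (\<lambda>n. ln (real n) ^ k) s) \<le> C * (1 + \<bar>Im s\<bar>) powr (1/30)"
proof -
  obtain M where M: "M > 0" "\<And>s. Re s > 59/60 \<Longrightarrow> norm (zreg s) \<le> M * norm s powr (1/30)"
    using zreg_bound by blast
  define \<rho> where "\<rho> = r / 2"
  have \<rho>: "\<rho> > 0" "\<rho> < 1" using r by (auto simp: \<rho>_def)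
  define C where "C = 6 * (1/\<rho> + M * 4) / \<rho>^3"
  have C: "C > 0" using \<rho> M by (simp add: C_def add_pos_pos)
  show ?thesis
  proof (rule that[OF C])
    fix k s assume k: "k \<le> (3::nat)" and s: "1 < Re s" "Re s \<le> 2" "\<bar>Im s\<bar> \<ge> r"
    define f where "f w = 1 / (w - 1) + zreg w" for w
    have near: "Re w > 59/60" "\<bar>Im w\<bar> \<ge> \<rho>" "w \<noteq> 1" "norm w \<le> 4 * (1 + \<bar>Im s\<bar>)" if "w \<in> cball s \<rho>" for w
    proof -
      have d: "norm (s - w) \<le> \<rho>" using that by (simp add: dist_norm)
      have d1: "\<bar>Re (s - w)\<bar> \<le> \<rho>" "\<bar>Im (s - w)\<bar> \<le> \<rho>" using d abs_Re_le_cmod[of "s-w"] abs_Im_le_cmod[of "s-w"] by linarith+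
      then show "Re w > 59/60" "\<bar>Im w\<bar> \<ge> \<rho>" using s r unfolding \<rho>_def minus_complex.sel by linarith+
      then show "w \<noteq> 1" using \<rho> by auto
      have "norm w \<le> \<bar>Re w\<bar> + \<bar>Im w\<bar>" by (rule cmod_le)
      also have "\<dots> \<le> 4 * (1 + \<bar>Im s\<bar>)" using d1 s \<rho> by (auto simp: abs_if split: if_splits)
      finally show "norm w \<le> 4 * (1 + \<bar>Im s\<bar>)" .
    qed
    have zr: "zreg holomorphic_on cball s \<rho>"
      by (rule holomorphic_on_subset[OF zreg_holomorphic]) (use near in auto)
    have hol: "f holomorphic_on cball s \<rho>"
      unfolding f_def using near by (intro holomorphic_intros zr) auto
    have bd: "norm (f w) \<le> (1/\<rho> + M * 4) * (1 + \<bar>Im s\<bar>) powr (1/30)" if "w \<in> cball s \<rho>" for w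
    proof -
      note n = near[OF that]
      have "norm (w - 1) \<ge> \<rho>" using n(2) abs_Im_le_cmod[of "w - 1"] by simp
      then have "norm (1 / (w - 1)) \<le> 1 / \<rho>" using \<rho> by (simp add: norm_divide frac_le)
      also have "\<dots> \<le> 1/\<rho> * (1 + \<bar>Im s\<bar>) powr (1/30)"
        using \<rho> by (simp add: ge_one_powr_ge_zero divide_right_mono)
      finally have 1: "norm (1 / (w - 1)) \<le> 1/\<rho> * (1 + \<bar>Im s\<bar>) powr (1/30)" .
      have "norm (zreg w) \<le> M * norm w powr (1/30)" using M n by auto
      also have "\<dots> \<le> M * (4 * (1 + \<bar>Im s\<bar>)) powr (1/30)"
        using M n by (intro mult_left_mono powr_mono2) auto
      also have "\<dots> = M * (4 powr (1/30) * (1 + \<bar>Im s\<bar>) powr (1/30))" by (subst powr_mult) auto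
      also have "\<dots> \<le> M * (4 powr 1 * (1 + \<bar>Im s\<bar>) powr (1/30))"
        using M by (intro mult_left_mono mult_right_mono powr_mono) auto
      finally have 2: "norm (zreg w) \<le> M * 4 * (1 + \<bar>Im s\<bar>) powr (1/30)" by simp
      have "norm (f w) \<le> norm (1 / (w - 1)) + norm (zreg w)" unfolding f_def by (rule norm_triangle_ineq)
      with 1 2 show ?thesis by (simp only: ring_distribs)
    qed
    have "norm ((deriv ^^ k) f s) \<le> fact k * ((1/\<rho> + M * 4) * (1 + \<bar>Im s\<bar>) powr (1/30)) / \<rho> ^ k"
      by (rule Cauchy_inequality)
        (use hol bd \<rho> in \<open>auto simp: dist_norm intro!: holomorphic_on_imp_continuous_on intro: holomorphic_on_subset\<close>)
    also have "\<dots> = (fact k / \<rho> ^ k) * ((1/\<rho> + M * 4) * (1 + \<bar>Im s\<bar>) powr (1/30))" by simp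
    also have "fact k / \<rho> ^ k \<le> 6 / \<rho> ^ 3"
    proof (rule frac_le)
      show "fact k \<le> (6::real)" using fact_mono[OF k, where ?'a = real] by (simp add: eval_nat_numeral)
      show "\<rho> ^ 3 \<le> \<rho> ^ k" using k \<rho> by (intro power_decreasing) auto
    qed (use \<rho> in auto)
    also have "(6 / \<rho> ^ 3) * ((1/\<rho> + M * 4) * (1 + \<bar>Im s\<bar>) powr (1/30)) = C * (1 + \<bar>Im s\<bar>) powr (1/30)"
      by (simp add: C_def)
    finally have "norm ((deriv ^^ k) f s) \<le> C * (1 + \<bar>Im s\<bar>) powr (1/30)"
      using M \<rho> by (simp add: mult_right_mono)
    also have "(deriv ^^ k) f s = (deriv ^^ k) zeta s"
    proof (rule higher_deriv_cong_ev)
      show "\<forall>\<^sub>F x in nhds s. f x = zeta x"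
        using eventually_nhds_in_open[OF open_halfspace_Re_gt, of s 1] s
        by (auto elim!: eventually_mono simp: f_def zeta_eq_zreg)
    qed simp
    also have "norm \<dots> = norm (dirichlet (\<lambda>n. ln (real n) ^ k) s)"
      unfolding zeta_def using higher_deriv_dirichlet[OF tame_1, of s k] s by (simp add: norm_mult norm_power)
    finally show "norm (dirichlet (\<lambda>n. ln (real n) ^ k) s) \<le> C * (1 + \<bar>Im s\<bar>) powr (1/30)" .
  qed
qed

lemma zeta_real_bound:
  obtains B where "B > 0" "\<And>\<sigma>. 1 < \<sigma> \<Longrightarrow> \<sigma> \<le> 2 \<Longrightarrow> norm (zeta (of_real \<sigma>)) \<le> B / (\<sigma> - 1)"
proof -
  obtain M where M: "M > 0" "\<And>s. Re s > 59/60 \<Longrightarrow> norm (zreg s) \<le> M * norm s powr (1/30)"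
    using zreg_bound by blast
  have "norm (zeta (of_real \<sigma>)) \<le> (1 + 2 * M) / (\<sigma> - 1)" if \<sigma>: "1 < \<sigma>" "\<sigma> \<le> 2" for \<sigma>
  proof -
    have "norm (zeta (of_real \<sigma>)) \<le> norm (1 / (complex_of_real \<sigma> - 1)) + norm (zreg (of_real \<sigma>))"
      using zeta_eq_zreg[of "of_real \<sigma>"] \<sigma> norm_triangle_ineq by simp
    also have "norm (1 / (complex_of_real \<sigma> - 1)) = 1 / (\<sigma> - 1)"
      using \<sigma> norm_of_real[of "\<sigma> - 1", where ?'a = complex] by (simp add: norm_divide)
    also have "norm (zreg (of_real \<sigma>)) \<le> M * \<sigma> powr (1/30)" using M(2)[of "of_real \<sigma>"] \<sigma> by simp
    also have "\<dots> \<le> M * \<sigma> powr 1" using \<sigma> M by (intro mult_left_mono powr_mono) auto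
    also have "\<dots> \<le> M * 2" using \<sigma> M by simp
    also have "\<dots> \<le> M * 2 / (\<sigma> - 1)" using \<sigma> M by (simp add: field_simps)
    finally show ?thesis by (simp add: add_divide_distrib mult.commute)
  qed
  then show ?thesis using that[of "1 + 2 * M"] M by simp
qed

text \<open>At distance at least \<open>\<delta>\<close> from the line the 3-4-1 inequality bounds
  \<open>norm (zeta s) ^ 4\<close> below by a constant times
  \<open>\<delta>^3 * \<tau> powr (-1/30)\<close>. Closer to the line one moves horizontally to
  abscissa \<open>1 + \<delta>\<close>, which changes zeta by at most \<open>\<delta>\<close> times
  the bound for its derivative. Equating \<open>\<delta> powr (3/4) * \<tau> powr (-1/120)\<close>
  with \<open>\<delta> * \<tau> powr (1/30)\<close> forces \<open>\<delta>\<close> to be of order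
  \<open>\<tau> powr (-5/30)\<close>.\<close>

lemma zeta_lower_bound:
  assumes r: "r > 0" "r < 1/120"
  obtains c where "c > 0" "\<And>s. 1 < Re s \<Longrightarrow> Re s \<le> 2 \<Longrightarrow> \<bar>Im s\<bar> \<ge> r \<Longrightarrow>
    norm (zeta s) \<ge> c * (1 + \<bar>Im s\<bar>) powr (-4/30)"
proof -
  obtain C where C: "C > 0" and Cb: "\<And>k s. k \<le> 3 \<Longrightarrow> 1 < Re s \<Longrightarrow> Re s \<le> 2 \<Longrightarrow> \<bar>Im s\<bar> \<ge> r \<Longrightarrow>
    norm (dirichlet (\<lambda>n. ln (real n) ^ k) s) \<le> C * (1 + \<bar>Im s\<bar>) powr (1/30)"
    using zeta_higher_deriv_bound[OF r] by blast
  obtain B where B: "B > 0" and Bb: "\<And>\<sigma>. 1 < \<sigma> \<Longrightarrow> \<sigma> \<le> 2 \<Longrightarrow> norm (zeta (of_real \<sigma>)) \<le> B / (\<sigma> - 1)"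
    using zeta_real_bound by blast
  obtain \<kappa> where \<kappa>: "\<kappa> > 0" and \<kappa>b:
    "\<And>\<sigma> t. \<sigma> > 1 \<Longrightarrow> norm (zeta (of_real \<sigma>)) ^ 3 * norm (zeta (Complex \<sigma> t)) ^ 4 * norm (zeta (Complex \<sigma> (2*t))) \<ge> \<kappa>"
    using zeta_341 by metis
  define \<kappa>' where "\<kappa>' = \<kappa> / (2 * B^3 * C)"
  have \<kappa>': "\<kappa>' > 0" using \<kappa> B C by (simp add: \<kappa>'_def)
  \<comment> \<open>With \<open>16 * C^4 * d \<le> \<kappa>'\<close> zeta is at least
    \<open>2 * C * d * \<tau> powr (-4/30)\<close> at abscissa \<open>1 + \<delta>\<close>, twice
    what the horizontal move can lose; 16 is the fourth power of this 2.\<close>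
  define d where "d = min 1 (\<kappa>' / (16 * C^4))"
  have d: "d > 0" "d \<le> 1" "16 * C^4 * d \<le> \<kappa>'" using \<kappa>' C by (auto simp: d_def min_def field_simps)
  have z0: "norm (zeta s) \<le> C * (1 + \<bar>Im s\<bar>) powr (1/30)" if "1 < Re s" "Re s \<le> 2" "\<bar>Im s\<bar> \<ge> r" for s
    using Cb[of 0 s] that by (simp add: zeta_def)
  have q: "norm (zeta (Complex \<sigma> t)) ^ 4 \<ge> \<kappa>' * (\<sigma> - 1) ^ 3 * (1 + \<bar>t\<bar>) powr (-1/30)"
    if \<sigma>: "1 < \<sigma>" "\<sigma> \<le> 2" and t: "\<bar>t\<bar> \<ge> r" for \<sigma> t
  proof -
    define X where "X = norm (zeta (Complex \<sigma> t)) ^ 4"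
    have "norm (zeta (Complex \<sigma> (2*t))) \<le> C * (1 + \<bar>2*t\<bar>) powr (1/30)"
      using z0[of "Complex \<sigma> (2*t)"] \<sigma> t r by simp
    also have "\<dots> \<le> C * (2 * (1 + \<bar>t\<bar>)) powr (1/30)"
      using C by (intro mult_left_mono powr_mono2) auto
    also have "\<dots> = C * (2 powr (1/30) * (1 + \<bar>t\<bar>) powr (1/30))" by (subst powr_mult) auto
    also have "\<dots> \<le> C * (2 powr 1 * (1 + \<bar>t\<bar>) powr (1/30))"
      using C by (intro mult_left_mono mult_right_mono powr_mono) auto
    finally have 2: "norm (zeta (Complex \<sigma> (2*t))) \<le> 2 * C * (1 + \<bar>t\<bar>) powr (1/30)" by simp
    have "\<kappa> \<le> norm (zeta (of_real \<sigma>)) ^ 3 * X * norm (zeta (Complex \<sigma> (2*t)))"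
      using \<kappa>b[OF \<sigma>(1)] by (simp add: X_def)
    also have "\<dots> \<le> (B / (\<sigma> - 1)) ^ 3 * X * (2 * C * (1 + \<bar>t\<bar>) powr (1/30))"
      using Bb[OF \<sigma>] 2 B \<sigma> by (intro mult_mono power_mono mult_right_mono) (auto simp: X_def)
    finally have "\<kappa> \<le> (B / (\<sigma> - 1)) ^ 3 * X * (2 * C * (1 + \<bar>t\<bar>) powr (1/30))" .
    then have "\<kappa>' * (\<sigma> - 1) ^ 3 \<le> X * (1 + \<bar>t\<bar>) powr (1/30)"
      using \<sigma> B C by (simp add: \<kappa>'_def field_simps)
    then have "\<kappa>' * (\<sigma> - 1) ^ 3 * (1 + \<bar>t\<bar>) powr (-1/30) \<le> X * (1 + \<bar>t\<bar>) powr (1/30) * (1 + \<bar>t\<bar>) powr (-1/30)"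
      by (intro mult_right_mono) auto
    also have "\<dots> = X" by (simp add: mult.assoc flip: powr_add)
    finally show ?thesis by (simp add: X_def)
  qed
  show ?thesis
  proof (rule that[of "C * d"])
    show "C * d > 0" using C d by simp
    fix s assume s: "1 < Re s" "Re s \<le> 2" "\<bar>Im s\<bar> \<ge> r"
    define t where "t = Im s"
    define \<tau> where "\<tau> = 1 + \<bar>t\<bar>"
    have \<tau>: "\<tau> \<ge> 1" by (simp add: \<tau>_def)
    have tr: "\<bar>t\<bar> \<ge> r" using s by (simp add: t_def)
    define \<delta> where "\<delta> = d * \<tau> powr (-5/30)"
    have p1: "\<tau> powr (-5/30) \<le> 1" using powr_mono[of "-5/30" 0 \<tau>] \<tau> by simp
    have \<delta>: "\<delta> > 0" "\<delta> \<le> 1" using d \<tau> p1 mult_mono[of d 1 "\<tau> powr (-5/30)" 1] by (auto simp: \<delta>_def)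
    have big: "norm (zeta (Complex \<sigma> t)) \<ge> 2 * (C * d * \<tau> powr (-4/30))" if \<sigma>: "1 + \<delta> \<le> \<sigma>" "\<sigma> \<le> 2" for \<sigma>
    proof -
      have "(2 * (C * d * \<tau> powr (-4/30))) ^ 4 = 16 * C^4 * d * (d^3 * \<tau> powr (-16/30))"
        using \<tau> by (simp add: power_mult_distrib powr_power) (simp add: eval_nat_numeral)
      also have "\<dots> \<le> \<kappa>' * (d^3 * \<tau> powr (-16/30))"
        using d by (intro mult_right_mono) auto
      also have "d^3 * \<tau> powr (-16/30) = \<delta> ^ 3 * \<tau> powr (-1/30)"
        using \<tau> by (simp add: \<delta>_def power_mult_distrib powr_power mult.assoc flip: powr_add)
      also have "\<kappa>' * (\<delta> ^ 3 * \<tau> powr (-1/30)) \<le> \<kappa>' * ((\<sigma> - 1) ^ 3 * \<tau> powr (-1/30))"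
        using \<kappa>' \<delta> \<sigma> by (intro mult_left_mono mult_right_mono power_mono) auto
      also have "\<dots> \<le> norm (zeta (Complex \<sigma> t)) ^ 4"
        using q[of \<sigma> t] \<sigma> \<delta> tr by (simp add: \<tau>_def mult.assoc)
      finally show ?thesis by (rule power_le_imp_le_base[where n = 3, simplified]) simp
    qed
    have st: "s = Complex (Re s) t" by (simp add: t_def)
    have "norm (zeta s) \<ge> C * d * \<tau> powr (-4/30)"
    proof (cases "Re s \<ge> 1 + \<delta>")
      case True
      have "C * d * \<tau> powr (-4/30) \<ge> 0" using C d by simp
      with big[OF True s(2)] st show ?thesis by simp
    next
      case False
      define S where "S = {w. 1 < Re w \<and> Re w \<le> 2 \<and> Im w = t}"
      have "S = {w. Re w > 1} \<inter> {w. Re w \<le> 2} \<inter> {w. Im w \<le> t} \<inter> {w. Im w \<ge> t}" by (auto simp: S_def)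
      then have cS: "convex S"
        by (simp only:) (intro convex_Int convex_halfspace_Re_gt convex_halfspace_Re_le convex_halfspace_Im_le convex_halfspace_Im_ge)
      define w where "w = Complex (1 + \<delta>) t"
      have "norm (zeta w - zeta s) \<le> (C * \<tau> powr (1/30)) * norm (w - s)"
      proof (rule field_differentiable_bound[OF cS, where f = zeta and f' = "\<lambda>z. - (dirichlet mangoldt z * zeta z)"])
        fix z assume z: "z \<in> S"
        then have "Re z > 1" by (simp add: S_def)
        then show "(zeta has_field_derivative - (dirichlet mangoldt z * zeta z)) (at z within S)"
          by (rule has_field_derivative_at_within[OF zeta_has_field_derivative])
        show "norm (- (dirichlet mangoldt z * zeta z)) \<le> C * \<tau> powr (1/30)"
          using Cb[of 1 z] z tr dirichlet_mangoldt_mult_zeta[of z] by (auto simp: S_def \<tau>_def)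
      qed (use \<delta> s in \<open>auto simp: S_def w_def t_def\<close>)
      also have "norm (w - s) \<le> \<delta>"
      proof -
        have "w - s = of_real (1 + \<delta> - Re s)" by (simp add: w_def t_def complex_eq_iff)
        then show ?thesis using False s by (simp only: norm_of_real)
      qed
      also have "(C * \<tau> powr (1/30)) * \<delta> = C * d * (\<tau> powr (1/30) * \<tau> powr (-5/30))" by (simp add: \<delta>_def)
      also have "\<tau> powr (1/30) * \<tau> powr (-5/30) = \<tau> powr (-4/30)" by (simp flip: powr_add)
      finally have "norm (zeta w - zeta s) \<le> C * d * \<tau> powr (-4/30)" using C by (simp add: mult_left_mono)
      moreover have "norm (zeta w) \<ge> 2 * (C * d * \<tau> powr (-4/30))"
        unfolding w_def by (rule big) (use \<delta> in auto)
      ultimately show ?thesis using norm_triangle_ineq2[of "zeta w" "zeta s"] by linarith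
    qed
    then show "norm (zeta s) \<ge> C * d * (1 + \<bar>Im s\<bar>) powr (-4/30)" by (simp add: \<tau>_def t_def)
  qed
qed

text \<open>Up to sign, \<open>F k\<close> and \<open>z k\<close> are the k-th derivatives of the
  negative logarithmic derivative of zeta and of zeta. The second and third identities come from
  differentiating the first by the product rule; each is therefore first proved on the whole open
  half-plane.\<close>

lemma mangoldt_ln_identities:
  assumes s: "Re s > 1"
  defines "F \<equiv> (\<lambda>k. dirichlet (\<lambda>n. mangoldt n * ln (real n) ^ k) s)"
    and "z \<equiv> (\<lambda>k. dirichlet (\<lambda>n. ln (real n) ^ k) s)"
  shows "F 0 * z 0 = z 1" "F 1 * z 0 + F 0 * z 1 = z 2" "F 2 * z 0 + 2 * F 1 * z 1 + F 0 * z 2 = z 3"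
proof -
  define f where "f k = dirichlet (\<lambda>n. mangoldt n * ln (real n) ^ k)" for k
  define g where "g k = dirichlet (\<lambda>n. ln (real n) ^ k)" for k
  have f': "(f k has_field_derivative - f (Suc k) w) (at w)" if "Re w > 1" for k w
    using dirichlet_has_field_derivative[OF tame_ln_power[OF tame_mangoldt] that, of k]
    by (simp add: f_def mult_ac)
  have g': "(g k has_field_derivative - g (Suc k) w) (at w)" if "Re w > 1" for k w
    using dirichlet_has_field_derivative[OF tame_ln_power[OF tame_1] that, of k]
    by (simp add: g_def mult_ac)
  have 0: "f 0 w * g 0 w = g 1 w" if "Re w > 1" for w
    using dirichlet_mangoldt_mult_zeta[OF that] by (simp add: f_def g_def zeta_def)
  have 1: "f 1 w * g 0 w + f 0 w * g 1 w = g 2 w" if w: "Re w > 1" for w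
  proof -
    have "((\<lambda>w. f 0 w * g 0 w) has_field_derivative - (f 1 w * g 0 w + f 0 w * g 1 w)) (at w)"
      using f'[OF w, of 0] g'[OF w, of 0] by (auto intro!: derivative_eq_intros)
    then have "(g 1 has_field_derivative - (f 1 w * g 0 w + f 0 w * g 1 w)) (at w)"
      by (rule has_field_derivative_transform_within_open[OF _ open_halfspace_Re_gt[of 1]]) (use w 0 in auto)
    from DERIV_unique[OF this g'[OF w, of 1]] show ?thesis by (simp only: neg_equal_iff_equal Suc_1)
  qed
  have 2: "f 2 w * g 0 w + 2 * f 1 w * g 1 w + f 0 w * g 2 w = g 3 w" if w: "Re w > 1" for w
  proof -
    have "((\<lambda>w. f 1 w * g 0 w + f 0 w * g 1 w) has_field_derivative - (f 2 w * g 0 w + 2 * f 1 w * g 1 w + f 0 w * g 2 w)) (at w)"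
      using f'[OF w, of 0] g'[OF w, of 0] f'[OF w, of 1] g'[OF w, of 1]
      by (auto intro!: derivative_eq_intros simp: numeral_2_eq_2 algebra_simps)
    then have "(g 2 has_field_derivative - (f 2 w * g 0 w + 2 * f 1 w * g 1 w + f 0 w * g 2 w)) (at w)"
      by (rule has_field_derivative_transform_within_open[OF _ open_halfspace_Re_gt[of 1]]) (use w 1 in auto)
    moreover have "Suc 2 = 3" by simp
    ultimately show ?thesis using DERIV_unique[OF _ g'[OF w, of 2]] by (metis neg_equal_iff_equal)
  qed
  show "F 0 * z 0 = z 1" "F 1 * z 0 + F 0 * z 1 = z 2" "F 2 * z 0 + 2 * F 1 * z 1 + F 0 * z 2 = z 3"
    using 0[OF s] 1[OF s] 2[OF s] unfolding f_def g_def F_def z_def by auto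
qed

text \<open>The identities are solved successively for \<open>F 0\<close>, \<open>F 1\<close> and
  \<open>F 2\<close>. The only division is by \<open>z 0 = zeta s\<close>, which the lower bound
  controls, so \<open>F 2\<close> becomes a polynomial of degree three in the quotients
  \<open>z k / z 0\<close>.\<close>

lemma mangoldt_series_bound_far:
  assumes r: "r > 0" "r < 1/120"
  obtains C where "\<And>s. 1 < Re s \<Longrightarrow> Re s \<le> 2 \<Longrightarrow> \<bar>Im s\<bar> \<ge> r \<Longrightarrow>
    norm (dirichlet (\<lambda>n. (mangoldt n - 1) * ln (real n) ^ 2) s) \<le> C * sqrt (1 + \<bar>Im s\<bar>)"
proof -
  obtain C where C: "C > 0" and Cb: "\<And>k s. k \<le> 3 \<Longrightarrow> 1 < Re s \<Longrightarrow> Re s \<le> 2 \<Longrightarrow> \<bar>Im s\<bar> \<ge> r \<Longrightarrow>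
    norm (dirichlet (\<lambda>n. ln (real n) ^ k) s) \<le> C * (1 + \<bar>Im s\<bar>) powr (1/30)"
    using zeta_higher_deriv_bound[OF r] by blast
  obtain c where c: "c > 0" and cb: "\<And>s. 1 < Re s \<Longrightarrow> Re s \<le> 2 \<Longrightarrow> \<bar>Im s\<bar> \<ge> r \<Longrightarrow>
    norm (zeta s) \<ge> c * (1 + \<bar>Im s\<bar>) powr (-4/30)"
    using zeta_lower_bound[OF r] by blast
  define A where "A = max 1 (C / c)"
  show ?thesis
  proof (rule that[of "6 * A^3 + C"])
    fix s assume s: "1 < Re s" "Re s \<le> 2" "\<bar>Im s\<bar> \<ge> r"
    define \<tau> where "\<tau> = 1 + \<bar>Im s\<bar>"
    have \<tau>: "\<tau> \<ge> 1" by (simp add: \<tau>_def)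
    define F where "F = (\<lambda>k. dirichlet (\<lambda>n. mangoldt n * ln (real n) ^ k) s)"
    define z where "z = (\<lambda>k. dirichlet (\<lambda>n. ln (real n) ^ k) s)"
    have id: "F 0 * z 0 = z 1" "F 1 * z 0 + F 0 * z 1 = z 2" "F 2 * z 0 + 2 * F 1 * z 1 + F 0 * z 2 = z 3"
      unfolding F_def z_def by (rule mangoldt_ln_identities[OF s(1)])+
    \<comment> \<open>A common bound for the quotients: 1/30 from the numerator and 4/30 from zeta
      in the denominator give 1/6, and \<open>Y^3\<close> then has the square root.
      \<open>A \<ge> 1\<close> makes \<open>Y \<ge> 1\<close>, so that lower powers of
      \<open>Y\<close> are absorbed.\<close>
    define Y where "Y = A * \<tau> powr (1/6)"
    have Y1: "Y \<ge> 1" using mult_mono[of 1 A 1 "\<tau> powr (1/6)"] ge_one_powr_ge_zero[OF \<tau>, of "1/6"]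
      by (simp add: Y_def A_def)
    have z0: "z 0 = zeta s" by (simp add: z_def zeta_def)
    have nz: "z 0 \<noteq> 0" using zeta_nonzero[OF s(1)] z0 by simp
    have q: "norm (z k) / norm (z 0) \<le> Y" if k: "k \<le> 3" for k
    proof -
      have "norm (z k) / norm (z 0) \<le> (C * \<tau> powr (1/30)) / (c * \<tau> powr (-4/30))"
        using Cb[OF k s] cb[OF s] c C \<tau> unfolding z0 by (intro frac_le) (auto simp: z_def \<tau>_def)
      also have "\<dots> = (C / c) * (\<tau> powr (1/30) / \<tau> powr (-4/30))" by simp
      also have "\<tau> powr (1/30) / \<tau> powr (-4/30) = \<tau> powr (1/6)" by (simp flip: powr_diff)
      also have "(C / c) * \<tau> powr (1/6) \<le> Y" unfolding Y_def by (intro mult_right_mono) (auto simp: A_def)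
      finally show ?thesis .
    qed
    have F0: "norm (F 0) \<le> Y"
    proof -
      have "F 0 = z 1 / z 0" using id(1) nz by (simp add: field_simps)
      then show ?thesis using q[of 1] by (simp add: norm_divide)
    qed
    have F1: "norm (F 1) \<le> 2 * Y^2"
    proof -
      have "F 1 = z 2 / z 0 - F 0 * (z 1 / z 0)" using id(2) nz by (simp add: field_simps)
      then have "norm (F 1) \<le> norm (z 2) / norm (z 0) + norm (F 0) * (norm (z 1) / norm (z 0))"
        by (metis norm_divide norm_mult norm_triangle_ineq4)
      also have "\<dots> \<le> Y + Y * Y" using q[of 2] q[of 1] F0 Y1 by (intro add_mono mult_mono) auto
      also have "\<dots> \<le> 2 * Y^2" using Y1 by (simp add: power2_eq_square)
      finally show ?thesis .
    qed
    have F2: "norm (F 2) \<le> 6 * Y^3"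
    proof -
      have "F 2 = z 3 / z 0 - (2 * F 1 * (z 1 / z 0) + F 0 * (z 2 / z 0))" using id(3) nz by (simp add: field_simps)
      then have "norm (F 2) \<le> norm (z 3 / z 0) + norm (2 * F 1 * (z 1 / z 0) + F 0 * (z 2 / z 0))"
        by (simp add: norm_triangle_ineq4)
      also have "norm (2 * F 1 * (z 1 / z 0) + F 0 * (z 2 / z 0)) \<le> norm (2 * F 1 * (z 1 / z 0)) + norm (F 0 * (z 2 / z 0))"
        by (rule norm_triangle_ineq)
      also have "norm (z 3 / z 0) + (norm (2 * F 1 * (z 1 / z 0)) + norm (F 0 * (z 2 / z 0)))
        = norm (z 3) / norm (z 0) + (2 * norm (F 1) * (norm (z 1) / norm (z 0)) + norm (F 0) * (norm (z 2) / norm (z 0)))"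
        by (simp add: norm_mult norm_divide)
      also have "\<dots> \<le> Y + (2 * (2 * Y^2) * Y + Y * Y)"
        using q[of 3] q[of 2] q[of 1] F0 F1 Y1 by (intro add_mono mult_mono) auto
      also have "\<dots> \<le> 6 * Y^3"
      proof -
        have "Y \<le> Y^3" "Y^2 \<le> Y^3" using Y1 power_increasing[of 1 3 Y] power_increasing[of 2 3 Y] by auto
        then show ?thesis by (simp add: power2_eq_square power3_eq_cube)
      qed
      finally show ?thesis by simp
    qed
    have Y3: "Y^3 = A^3 * sqrt \<tau>"
      using \<tau> by (simp add: Y_def power_mult_distrib powr_power powr_half_sqrt)
    have "norm (z 2) \<le> C * \<tau> powr (1/30)" using Cb[of 2 s] s by (simp add: z_def \<tau>_def)
    also have "\<dots> \<le> C * \<tau> powr (1/2)" using C \<tau> by (intro mult_left_mono powr_mono) auto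
    finally have z2: "norm (z 2) \<le> C * sqrt \<tau>" using \<tau> by (simp add: powr_half_sqrt)
    have "dirichlet (\<lambda>n. (mangoldt n - 1) * ln (real n) ^ 2) s = F 2 - z 2"
      using dirichlet_diff[OF tame_ln_power[OF tame_mangoldt] tame_ln_power[OF tame_1] s(1), of 2 2]
      by (simp add: F_def z_def ring_distribs)
    then have "norm (dirichlet (\<lambda>n. (mangoldt n - 1) * ln (real n) ^ 2) s) \<le> norm (F 2) + norm (z 2)"
      by (simp add: norm_triangle_ineq4)
    also have "\<dots> \<le> (6 * A^3 + C) * sqrt \<tau>" using F2 z2 Y3 by (simp add: ring_distribs)
    finally show "norm (dirichlet (\<lambda>n. (mangoldt n - 1) * ln (real n) ^ 2) s) \<le> (6 * A^3 + C) * sqrt (1 + \<bar>Im s\<bar>)"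
      by (simp add: \<tau>_def)
  qed
qed

text \<open>It remains to treat a neighbourhood of 1. There both the negative logarithmic derivative
  and zeta have principal part \<open>1 / (s - 1)\<close>, so their difference extends to the
  holomorphic function \<open>\<Psi>\<close>, written with \<open>zsum\<close>, which does not
  vanish near 1, and \<open>zreg\<close>. Its second derivative is bounded on a compact
  disc.\<close>

lemma mangoldt_series_bound:
  obtains C r where "C > 0" "r > 0" "\<And>\<sigma> t. 1 < \<sigma> \<Longrightarrow> \<sigma> < 1 + r \<Longrightarrow>
    norm (dirichlet (\<lambda>n. (mangoldt n - 1) * ln (real n) ^ 2) (Complex \<sigma> t)) \<le> C * sqrt (1 + \<bar>t\<bar>)"
proof -
  let ?H = "{s. Re s > 59/60}"
  have oH: "open ?H" by (rule open_halfspace_Re_gt)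
  have "isCont zsum 1"
    using holomorphic_on_imp_continuous_on[OF zsum_holomorphic] oH by (simp add: continuous_on_eq_continuous_at)
  then obtain \<epsilon> where \<epsilon>: "\<epsilon> > 0" "\<And>w. dist 1 w < \<epsilon> \<Longrightarrow> zsum w \<noteq> 0"
    using continuous_at_avoid[of 1 zsum 0] by (auto simp: zsum_1)
  \<comment> \<open>\<open>\<Psi>\<close> lives on the disc of radius \<open>3 * r\<close>; the
    compact disc of radius \<open>2 * r\<close> contains every point with
    \<open>1 < \<sigma> < 1 + r\<close> and \<open>\<bar>t\<bar> < r\<close>. The number 1/200 keeps
    \<open>3 * r\<close> below 1/60, inside the domain of \<open>zreg\<close>, and \<open>r\<close>
    below 1/120.\<close>
  define r where "r = min (\<epsilon> / 3) (1 / 200)"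
  have r: "r > 0" "r < 1/120" "3 * r \<le> \<epsilon>" "3 * r < 1/60" using \<epsilon> by (auto simp: r_def)
  let ?U = "ball (1::complex) (3 * r)"
  have UH: "?U \<subseteq> ?H"
  proof
    fix w :: complex assume "w \<in> ?U"
    then have "norm (1 - w) < 1/60" using r by (auto simp: dist_norm)
    then show "w \<in> ?H" using abs_Re_le_cmod[of "1 - w"] by simp
  qed
  define \<Psi> where "\<Psi> w = - deriv zsum w / zsum w - zreg w" for w
  have \<Psi>: "\<Psi> holomorphic_on ?U" unfolding \<Psi>_def
    by (intro holomorphic_intros holomorphic_on_subset[OF zreg_holomorphic UH]
      holomorphic_on_subset[OF zsum_holomorphic UH] holomorphic_on_subset[OF holomorphic_deriv[OF zsum_holomorphic oH] UH])
      (use \<epsilon> r in auto)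
  have eq: "dirichlet (\<lambda>n. mangoldt n - 1) w = \<Psi> w" if w: "w \<in> ?U" "Re w > 1" for w
  proof -
    have w1: "w \<noteq> 1" using w by auto
    have zn: "zeta w \<noteq> 0" using zeta_nonzero w by simp
    have "((\<lambda>s. (s - 1) * zeta s) has_field_derivative (zeta w - (w - 1) * (dirichlet mangoldt w * zeta w))) (at w)"
      using w by (auto intro!: derivative_eq_intros zeta_has_field_derivative)
    then have "(zsum has_field_derivative (zeta w - (w - 1) * (dirichlet mangoldt w * zeta w))) (at w)"
      by (rule has_field_derivative_transform_within_open[OF _ open_halfspace_Re_gt[of 1]])
        (use w zsum_eq_zeta in auto)
    then have "deriv zsum w = zeta w - (w - 1) * (dirichlet mangoldt w * zeta w)" by (rule DERIV_imp_deriv)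
    then have "deriv zsum w / zsum w = (zeta w - (w - 1) * (dirichlet mangoldt w * zeta w)) / ((w - 1) * zeta w)"
      using zsum_eq_zeta[OF w(2)] by simp
    also have "\<dots> = 1 / (w - 1) - dirichlet mangoldt w"
      using w1 zn by (simp add: diff_divide_distrib)
    finally have "deriv zsum w / zsum w = 1 / (w - 1) - dirichlet mangoldt w" .
    then have "\<Psi> w = dirichlet mangoldt w - zeta w" unfolding \<Psi>_def using zeta_eq_zreg[OF w(2)] by simp
    then show ?thesis using dirichlet_diff[OF tame_mangoldt tame_1 w(2)] by (simp add: zeta_def)
  qed
  have "continuous_on (cball 1 (2 * r)) ((deriv ^^ 2) \<Psi>)"
    by (rule holomorphic_on_imp_continuous_on[OF holomorphic_on_subset[OF holomorphic_higher_deriv[OF \<Psi>]]])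
      (use r in auto)
  then have "compact ((deriv ^^ 2) \<Psi> ` cball 1 (2 * r))" by (rule compact_continuous_image) (rule compact_cball)
  then have "bounded ((deriv ^^ 2) \<Psi> ` cball 1 (2 * r))" by (rule compact_imp_bounded)
  then obtain K where K: "\<And>w. w \<in> cball 1 (2 * r) \<Longrightarrow> norm ((deriv ^^ 2) \<Psi> w) \<le> K"
    unfolding bounded_iff by blast
  obtain C where C: "\<And>s. 1 < Re s \<Longrightarrow> Re s \<le> 2 \<Longrightarrow> \<bar>Im s\<bar> \<ge> r \<Longrightarrow>
    norm (dirichlet (\<lambda>n. (mangoldt n - 1) * ln (real n) ^ 2) s) \<le> C * sqrt (1 + \<bar>Im s\<bar>)"
    using mangoldt_series_bound_far[OF r(1,2)] by blast
  show ?thesis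
  proof (rule that[of "max 1 (max C K)" r])
    fix \<sigma> t :: real assume \<sigma>: "1 < \<sigma>" "\<sigma> < 1 + r"
    define s where "s = Complex \<sigma> t"
    show "norm (dirichlet (\<lambda>n. (mangoldt n - 1) * ln (real n) ^ 2) (Complex \<sigma> t)) \<le> max 1 (max C K) * sqrt (1 + \<bar>t\<bar>)"
    proof (cases "\<bar>t\<bar> \<ge> r")
      case True
      have "norm (dirichlet (\<lambda>n. (mangoldt n - 1) * ln (real n) ^ 2) s) \<le> C * sqrt (1 + \<bar>t\<bar>)"
        using C[of s] \<sigma> r True by (simp add: s_def)
      also have "\<dots> \<le> max 1 (max C K) * sqrt (1 + \<bar>t\<bar>)" by (intro mult_right_mono) auto
      finally show ?thesis by (simp add: s_def)
    next
      case False
      have "norm (s - 1) \<le> \<bar>\<sigma> - 1\<bar> + \<bar>t\<bar>" using cmod_le[of "s - 1"] by (simp add: s_def)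
      also have "\<dots> < 2 * r" using \<sigma> False by simp
      finally have s1: "dist 1 s < 2 * r" by (simp add: dist_norm norm_minus_commute)
      have sU: "s \<in> ?U \<inter> {s. Re s > 1}" using s1 r \<sigma> by (auto simp: s_def)
      have oU: "open (?U \<inter> {s. Re s > 1})" by (intro open_Int open_halfspace_Re_gt open_ball)
      have "(deriv ^^ 2) (dirichlet (\<lambda>n. mangoldt n - 1)) s = (deriv ^^ 2) \<Psi> s"
        by (rule higher_deriv_cong_ev[OF eventually_mono[OF eventually_nhds_in_open[OF oU sU]]]) (use eq in auto)
      moreover have "(deriv ^^ 2) (dirichlet (\<lambda>n. mangoldt n - 1)) s = dirichlet (\<lambda>n. (mangoldt n - 1) * ln (real n) ^ 2) s"
        using higher_deriv_dirichlet[OF tame_diff[OF tame_mangoldt tame_1], of s 2] \<sigma> by (simp add: s_def)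
      ultimately have "norm (dirichlet (\<lambda>n. (mangoldt n - 1) * ln (real n) ^ 2) s) \<le> K"
        using K[of s] s1 by simp
      also have "K \<le> max 1 (max C K) * 1" by simp
      also have "\<dots> \<le> max 1 (max C K) * sqrt (1 + \<bar>t\<bar>)" by (intro mult_left_mono) auto
      finally show ?thesis by (simp add: s_def)
    qed
  qed (use r in auto)
qed

section \<open>Perron's formula\<close>

lemma perron_integrand_integrable:
  fixes u :: real
  assumes "\<And>z. z \<in> closed_segment a b \<Longrightarrow> z \<noteq> 0 \<and> z \<noteq> -1"
  shows "(\<lambda>s. of_real u powr s / (s * (s + 1))) contour_integrable_on (linepath a b)"
proof (rule contour_integrable_continuous_linepath, rule holomorphic_on_imp_continuous_on)
  show "(\<lambda>s. of_real u powr s / (s * (s + 1))) holomorphic_on closed_segment a b"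
    using assms by (intro holomorphic_intros) (auto simp: add_eq_0_iff2)
qed

lemma perron_integrand_norm_le:
  fixes u :: real
  assumes "u > 0" "0 < A" "A \<le> norm s" "0 < B" "B \<le> norm (s + 1)" "u powr Re s \<le> V"
  shows "norm (of_real u powr s / (s * (s + 1))) \<le> V / (A * B)"
proof -
  have "norm (of_real u powr s / (s * (s + 1))) = u powr Re s / (norm s * norm (s + 1))"
    using assms by (simp add: norm_divide norm_mult norm_powr_real_powr)
  also have "\<dots> \<le> V / (A * B)"
    using assms by (intro frac_le mult_mono) (auto intro: order_trans[of 0 "u powr Re s"])
  finally show ?thesis .
qed

lemma perron_vertical_bound:
  fixes u x T :: real
  assumes u: "u > 0" and T: "T > 0" and AB: "0 < A" "A \<le> \<bar>x\<bar>" "0 < B" "B \<le> \<bar>x + 1\<bar>" and V: "u powr x \<le> V"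
  shows "norm (contour_integral (linepath (Complex x (-T)) (Complex x T)) (\<lambda>s. of_real u powr s / (s * (s + 1)))) \<le> V / (A * B) * (2 * T)"
proof -
  have seg: "Re z = x" if "z \<in> closed_segment (Complex x (-T)) (Complex x T)" for z
    using that by (auto simp: closed_segment_same_Re)
  have "norm (contour_integral (linepath (Complex x (-T)) (Complex x T)) (\<lambda>s. of_real u powr s / (s * (s + 1))))
    \<le> V / (A * B) * norm (Complex x T - Complex x (-T))"
  proof (rule contour_integral_bound_linepath[OF perron_integrand_integrable])
    fix z assume z: "z \<in> closed_segment (Complex x (-T)) (Complex x T)"
    show "z \<noteq> 0 \<and> z \<noteq> -1" using seg[OF z] AB by auto
    show "norm (of_real u powr z / (z * (z + 1))) \<le> V / (A * B)"
      using seg[OF z] u AB V abs_Re_le_cmod[of z] abs_Re_le_cmod[of "z + 1"] by (intro perron_integrand_norm_le) auto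
  qed (use AB order_trans[OF powr_ge_zero V] in auto)
  also have "norm (Complex x T - Complex x (-T)) = 2 * T" using T by (simp add: cmod_eq_Im)
  finally show ?thesis .
qed

text \<open>The two vertical integrals differ from the integral around the rectangle only by the
  horizontal sides, on which \<open>norm s\<close> and \<open>norm (s + 1)\<close> are at least
  \<open>T\<close>.\<close>

lemma perron_rectangle:
  fixes u T x0 x1 V :: real
  assumes u: "u > 0" and T: "T > 0" and x: "x0 < x1" "x0 \<notin> {0, -1}" "x1 \<notin> {0, -1}"
    and V: "\<And>x. x0 \<le> x \<Longrightarrow> x \<le> x1 \<Longrightarrow> u powr x \<le> V"
    and I: "((\<lambda>s. of_real u powr s / (s * (s + 1))) has_contour_integral I) (rectpath (Complex x0 (-T)) (Complex x1 T))"
  defines "J \<equiv> \<lambda>x. contour_integral (linepath (Complex x (-T)) (Complex x T)) (\<lambda>s. of_real u powr s / (s * (s + 1)))"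
  shows "norm (J x1 - J x0 - I) \<le> 2 * (V / (T * T) * (x1 - x0))"
proof -
  define g where "g s = complex_of_real u powr s / (s * (s + 1))" for s
  define a1 where "a1 = Complex x0 (-T)"
  define a2 where "a2 = Complex x1 (-T)"
  define a3 where "a3 = Complex x1 T"
  define a4 where "a4 = Complex x0 T"
  have V0: "V \<ge> 0" using V[of x0] x order_trans[OF powr_ge_zero] by auto
  have s12: "Im z = -T \<and> x0 \<le> Re z \<and> Re z \<le> x1" if "z \<in> closed_segment a1 a2" for z
    using that x by (auto simp: a1_def a2_def closed_segment_same_Im closed_segment_eq_real_ivl)
  have s23: "Re z = x1" if "z \<in> closed_segment a2 a3" for z
    using that by (auto simp: a3_def a2_def closed_segment_same_Re)
  have s34: "Im z = T \<and> x0 \<le> Re z \<and> Re z \<le> x1" if "z \<in> closed_segment a3 a4" for z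
    using that x by (auto simp: a3_def a4_def closed_segment_same_Im closed_segment_eq_real_ivl)
  have s41: "Re z = x0" if "z \<in> closed_segment a4 a1" for z
    using that by (auto simp: a1_def a4_def closed_segment_same_Re)
  have i12: "g contour_integrable_on (linepath a1 a2)" unfolding g_def
    by (rule perron_integrand_integrable) (use s12 T in fastforce)
  have i23: "g contour_integrable_on (linepath a2 a3)" unfolding g_def
    by (rule perron_integrand_integrable) (use s23 x in fastforce)
  have i34: "g contour_integrable_on (linepath a3 a4)" unfolding g_def
    by (rule perron_integrand_integrable) (use s34 T in fastforce)
  have i41: "g contour_integrable_on (linepath a4 a1)" unfolding g_def
    by (rule perron_integrand_integrable) (use s41 x in fastforce)
  have "rectpath a1 a3 = linepath a1 a2 +++ linepath a2 a3 +++ linepath a3 a4 +++ linepath a4 a1"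
    by (simp add: rectpath_def a1_def a2_def a3_def a4_def Let_def)
  then have split: "contour_integral (rectpath a1 a3) g = contour_integral (linepath a1 a2) g + (contour_integral (linepath a2 a3) g
    + (contour_integral (linepath a3 a4) g + contour_integral (linepath a4 a1) g))"
    using i12 i23 i34 i41 by (simp add: valid_path_join)
  have tot: "contour_integral (rectpath a1 a3) g = I"
    using I unfolding a1_def a3_def g_def by (rule contour_integral_unique)
  have b12: "norm (contour_integral (linepath a1 a2) g) \<le> (V / (T * T)) * norm (a2 - a1)"
  proof (rule contour_integral_bound_linepath[OF i12])
    fix z assume "z \<in> closed_segment a1 a2"
    from s12[OF this] show "norm (g z) \<le> V / (T * T)" unfolding g_def
      using u T V abs_Im_le_cmod[of z] abs_Im_le_cmod[of "z + 1"] by (intro perron_integrand_norm_le) auto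
  qed (use T V0 in auto)
  have b34: "norm (contour_integral (linepath a3 a4) g) \<le> (V / (T * T)) * norm (a4 - a3)"
  proof (rule contour_integral_bound_linepath[OF i34])
    fix z assume "z \<in> closed_segment a3 a4"
    from s34[OF this] show "norm (g z) \<le> V / (T * T)" unfolding g_def
      using u T V abs_Im_le_cmod[of z] abs_Im_le_cmod[of "z + 1"] by (intro perron_integrand_norm_le) auto
  qed (use T V0 in auto)
  have n: "norm (a2 - a1) = x1 - x0" "norm (a4 - a3) = x1 - x0"
    using x by (auto simp: a1_def a2_def a3_def a4_def cmod_eq_Re)
  have "contour_integral (linepath a1 a4) g = - contour_integral (linepath a4 a1) g"
    using contour_integral_reversepath[of "linepath a4 a1" g] by simp
  then have "J x1 - J x0 - I = - (contour_integral (linepath a1 a2) g + contour_integral (linepath a3 a4) g)"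
    unfolding J_def g_def[symmetric] a1_def[symmetric] a2_def[symmetric] a3_def[symmetric] a4_def[symmetric] tot[symmetric] split
    by simp
  then have "norm (J x1 - J x0 - I) = norm (contour_integral (linepath a1 a2) g + contour_integral (linepath a3 a4) g)"
    by (simp only: norm_minus_cancel)
  also have "\<dots> \<le> norm (contour_integral (linepath a1 a2) g) + norm (contour_integral (linepath a3 a4) g)"
    by (rule norm_triangle_ineq)
  finally show ?thesis using b12 b34 unfolding n by linarith
qed

text \<open>The partial fractions \<open>1 / s - 1 / (s + 1)\<close> reduce the claim to Cauchy's
  integral formula for the entire function \<open>u powr s\<close> at the points 0 and -1.\<close>

lemma perron_rectangle_residues:
  fixes u T c :: real
  assumes u: "u > 0" and c: "c > 0" and T: "T > 1"
  shows "((\<lambda>s. of_real u powr s / (s * (s + 1))) has_contour_integral (2*pi * \<i> * of_real (1 - 1/u)))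
    (rectpath (Complex (-T) (-T)) (Complex c T))"
proof -
  define a1 where "a1 = Complex (-T) (-T)"
  define a3 where "a3 = Complex c T"
  have box: "0 \<in> box a1 a3" "-1 \<in> box a1 a3" using c T by (auto simp: a1_def a3_def in_box_complex_iff)
  have le: "Re a1 \<le> Re a3" "Im a1 \<le> Im a3" using c T by (auto simp: a1_def a3_def)
  have notin: "0 \<notin> path_image (rectpath a1 a3)" "-1 \<notin> path_image (rectpath a1 a3)"
    using path_image_rectpath_inter_box[OF le] box by auto
  have ent: "(\<lambda>s. complex_of_real u powr s) holomorphic_on UNIV" by (intro holomorphic_intros)
  have cauchy: "((\<lambda>s. of_real u powr s / (s - z)) has_contour_integral (2*pi * \<i> * of_real u powr z)) (rectpath a1 a3)"
    if z: "z \<in> box a1 a3" "z \<notin> path_image (rectpath a1 a3)" for z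
    using Cauchy_integral_formula_convex_simple[OF convex_UNIV ent, of z "rectpath a1 a3"] z winding_number_rectpath[OF z(1)]
    by auto
  have "((\<lambda>s. of_real u powr s / (s - 0) - of_real u powr s / (s - (-1))) has_contour_integral
    (2*pi * \<i> * of_real u powr 0 - 2*pi * \<i> * of_real u powr (-1))) (rectpath a1 a3)"
    by (intro has_contour_integral_diff cauchy box notin)
  also have "2*pi * \<i> * of_real u powr 0 - 2*pi * \<i> * of_real u powr (-1) = 2*pi * \<i> * of_real (1 - 1/u)"
    using u by (simp add: powr_minus inverse_eq_divide algebra_simps)
  finally have "((\<lambda>s. of_real u powr s / (s * (s + 1))) has_contour_integral (2*pi * \<i> * of_real (1 - 1/u))) (rectpath a1 a3)"
  proof (rule has_contour_integral_eq)
    fix s assume "s \<in> path_image (rectpath a1 a3)"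
    then have "s \<noteq> 0" "s + 1 \<noteq> 0" using notin by (auto simp: add_eq_0_iff2)
    then show "of_real u powr s / (s - 0) - of_real u powr s / (s - (-1)) = of_real u powr s / (s * (s + 1))"
      by (simp add: field_simps)
  qed
  then show ?thesis by (simp only: a1_def a3_def)
qed

text \<open>For \<open>u \<ge> 1\<close> the line is moved to the left, across both poles, and for
  \<open>u < 1\<close> to the right, across none; in either direction \<open>u powr x\<close> stays
  below \<open>u powr c\<close>. The far side is put at \<open>- T\<close> or \<open>T + 2\<close>,
  where the integrand is O(V / T^2) on a length \<open>2 * T\<close>, so one parameter governs all
  the errors; they total at most 8 in units of \<open>V / T\<close>.\<close>

lemma perron_kernel:
  fixes u c T :: real
  assumes u: "u > 0" and c: "1 < c" "c \<le> 2" and T: "T \<ge> 2"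
  shows "norm (contour_integral (linepath (Complex c (-T)) (Complex c T)) (\<lambda>s. of_real u powr s / (s * (s + 1)))
    - 2 * pi * \<i> * of_real (max 0 (1 - 1/u))) \<le> 10 * u powr c / T"
proof -
  define J where "J x = contour_integral (linepath (Complex x (-T)) (Complex x T)) (\<lambda>s. of_real u powr s / (s * (s + 1)))" for x
  define V where "V = u powr c"
  have VT: "V / (T * T) * (k * T) = k * (V / T)" for k using T by simp
  have VT0: "V / T \<ge> 0" unfolding V_def using T by simp
  show ?thesis
  proof (cases "u \<ge> 1")
    case True
    define I where "I = 2*pi * \<i> * complex_of_real (1 - 1/u)"
    have uV: "u powr x \<le> V" if "x \<le> c" for x unfolding V_def using that True by (intro powr_mono) auto
    have "norm (J c - J (-T) - I) \<le> 2 * (V / (T * T) * (c - (-T)))"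
      unfolding J_def I_def using u c T uV by (intro perron_rectangle perron_rectangle_residues) auto
    also have "\<dots> \<le> 2 * (V / (T * T) * (2 * T))"
      unfolding V_def using c T by (intro mult_left_mono) auto
    finally have 1: "norm (J c - J (-T) - I) \<le> 4 * (V / T)" unfolding VT by simp
    have "norm (J (-T)) \<le> V / (T * (T / 2)) * (2 * T)"
      unfolding J_def using u c T uV by (intro perron_vertical_bound) auto
    also have "\<dots> = 4 * (V / T)" using T by simp
    finally have 2: "norm (J (-T)) \<le> 4 * (V / T)" .
    have "norm (J c - I) \<le> norm (J c - J (-T) - I) + norm (J (-T))"
      using norm_triangle_ineq[of "J c - J (-T) - I" "J (-T)"] by simp
    then have "norm (J c - I) \<le> 10 * (V / T)" using 1 2 VT0 by linarith
    moreover have "max 0 (1 - 1/u) = 1 - 1/u" using True by simp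
    ultimately show ?thesis by (simp add: J_def I_def V_def)
  next
    case False
    have uV: "u powr x \<le> V" if "c \<le> x" for x unfolding V_def using that False u by (intro powr_mono') auto
    have "(\<lambda>s. complex_of_real u powr s / (s * (s + 1))) holomorphic_on {s. Re s > 0}"
      by (intro holomorphic_intros) (auto simp: add_eq_0_iff2)
    moreover have "path_image (rectpath (Complex c (-T)) (Complex (T + 2) T)) \<subseteq> {s. Re s > 0}"
      using c T by (subst path_image_rectpath) auto
    ultimately have "((\<lambda>s. complex_of_real u powr s / (s * (s + 1))) has_contour_integral 0) (rectpath (Complex c (-T)) (Complex (T + 2) T))"
      by (intro Cauchy_theorem_convex_simple[OF _ convex_halfspace_Re_gt]) auto
    then have "norm (J (T + 2) - J c - 0) \<le> 2 * (V / (T * T) * (T + 2 - c))"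
      unfolding J_def using u c T uV by (intro perron_rectangle) auto
    also have "\<dots> \<le> 2 * (V / (T * T) * (2 * T))"
      unfolding V_def using c T by (intro mult_left_mono) auto
    finally have 1: "norm (J (T + 2) - J c) \<le> 4 * (V / T)" unfolding VT by simp
    have "norm (J (T + 2)) \<le> V / (T * T) * (2 * T)"
      unfolding J_def using u c T uV by (intro perron_vertical_bound) auto
    then have 2: "norm (J (T + 2)) \<le> 2 * (V / T)" unfolding VT .
    have "norm (J c) \<le> norm (J (T + 2)) + norm (J (T + 2) - J c)"
      using norm_triangle_ineq4[of "J (T + 2)" "J (T + 2) - J c"] by simp
    then have "norm (J c) \<le> 10 * (V / T)" using 1 2 VT0 by linarith
    moreover have "max 0 (1 - 1/u) = 0" using False u by (simp add: max_def)
    ultimately show ?thesis by (simp add: J_def V_def)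
  qed
qed

text \<open>On the segment the Dirichlet series converges uniformly, being dominated by its values
  at \<open>c\<close>, and the integral may be taken term by term.\<close>

lemma perron_series_sums:
  fixes c y T :: real
  assumes a: "tame a" "a 0 = 0" and c: "1 < c" and y: "y > 0" and T: "T > 0"
  defines "\<gamma> \<equiv> linepath (Complex c (-T)) (Complex c T)"
  shows "(\<lambda>n. of_real (a n) * contour_integral \<gamma> (\<lambda>s. of_real (y / real n) powr s / (s * (s + 1)))) sums
    contour_integral \<gamma> (\<lambda>s. dirichlet a s * (of_real y powr s / (s * (s + 1))))"
proof -
  define f where "f n s = (of_real (a n) * of_nat n powr (-s)) * (complex_of_real y powr s / (s * (s + 1)))" for n s
  have im: "Re s = c" if "s \<in> path_image \<gamma>" for s
    using that by (auto simp: \<gamma>_def closed_segment_same_Re)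
  have ints: "(\<lambda>s. of_real u powr s / (s * (s + 1))) contour_integrable_on \<gamma>" for u
    unfolding \<gamma>_def by (rule perron_integrand_integrable) (use im c in \<open>fastforce simp: \<gamma>_def\<close>)
  have feq: "f n s = of_real (a n) * (of_real (y / real n) powr s / (s * (s + 1)))" for n s
  proof (cases "n = 0")
    case False
    then have *: "Ln (of_nat n) = of_real (ln (real n))" by (metis Ln_of_nat of_nat_0_less_iff bot_nat_0.not_eq_extremum)
    have "of_nat n powr (-s) * of_real y powr s = complex_of_real (y / real n) powr s"
      using False y by (simp add: powr_def * Ln_of_real ln_div exp_add[symmetric] algebra_simps del: of_real_divide)
    then show ?thesis unfolding f_def by (simp add: mult.assoc)
  qed (simp add: f_def a)
  have fint: "f n contour_integrable_on \<gamma>" for n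
    unfolding feq by (intro contour_integrable_lmul ints)
  have fval: "contour_integral \<gamma> (f n) = of_real (a n) * contour_integral \<gamma> (\<lambda>s. of_real (y / real n) powr s / (s * (s + 1)))" for n
    unfolding feq by (intro contour_integral_lmul ints)
  have "uniform_limit (path_image \<gamma>) (\<lambda>N s. \<Sum>n<N. f n s) (\<lambda>s. \<Sum>n. f n s) sequentially"
  proof (rule Weierstrass_m_test)
    show "summable (\<lambda>n. \<bar>a n\<bar> * real n powr (-c) * y powr c)"
      using a c by (intro summable_mult2) (auto simp: tame_def)
    fix n s assume s: "s \<in> path_image \<gamma>"
    have "norm (of_real y powr s / (s * (s + 1))) \<le> y powr c / (1 * 1)"
      using im[OF s] c y abs_Re_le_cmod[of s] abs_Re_le_cmod[of "s + 1"]
      by (intro perron_integrand_norm_le) auto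
    then have "norm (of_real (a n) * complex_of_nat n powr (-s)) * norm (of_real y powr s / (s * (s + 1))) \<le> (\<bar>a n\<bar> * real n powr (-c)) * y powr c"
      unfolding norm_dirichlet_term im[OF s] by (intro mult_left_mono) auto
    then show "norm (f n s) \<le> \<bar>a n\<bar> * real n powr (-c) * y powr c"
      unfolding f_def by (subst norm_mult)
  qed
  moreover have "(\<Sum>n. f n s) = dirichlet a s * (of_real y powr s / (s * (s + 1)))" if "s \<in> path_image \<gamma>" for s
  proof -
    have "(\<lambda>n. f n s) sums (dirichlet a s * (of_real y powr s / (s * (s + 1))))"
      unfolding f_def by (intro sums_mult2 dirichlet_sums a) (use im[OF that] c in simp)
    then show ?thesis by (simp add: sums_iff)
  qed
  ultimately have ul: "uniform_limit (path_image \<gamma>) (\<lambda>N s. \<Sum>n<N. f n s) (\<lambda>s. dirichlet a s * (of_real y powr s / (s * (s + 1)))) sequentially"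
    by (metis (no_types, lifting) uniform_limit_cong')
  have "(\<lambda>N. contour_integral \<gamma> (\<lambda>s. \<Sum>n<N. f n s)) \<longlonglongrightarrow> contour_integral \<gamma> (\<lambda>s. dirichlet a s * (of_real y powr s / (s * (s + 1))))"
  proof (rule contour_integral_uniform_limit(2)[OF _ ul])
    show "\<forall>\<^sub>F N in sequentially. (\<lambda>s. \<Sum>n<N. f n s) contour_integrable_on \<gamma>"
      by (intro always_eventually allI contour_integrable_sum fint) auto
    show "norm (vector_derivative \<gamma> (at t)) \<le> norm (Complex c T - Complex c (-T))" if "t \<in> {0..1}" for t
      by (simp add: \<gamma>_def)
  qed (auto simp: \<gamma>_def)
  moreover have "contour_integral \<gamma> (\<lambda>s. \<Sum>n<N. f n s) = (\<Sum>n<N. of_real (a n) * contour_integral \<gamma> (\<lambda>s. of_real (y / real n) powr s / (s * (s + 1))))" for N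
    unfolding fval[symmetric] by (intro contour_integral_sum fint) auto
  ultimately show ?thesis unfolding sums_def by simp
qed

text \<open>An improper integral is avoided: for finite \<open>T\<close> the kernel errors add up to
  \<open>10 * y powr c * S / T\<close>, and since \<open>V\<close> is independent of
  \<open>T\<close>, letting \<open>T\<close> grow removes them. The factor \<open>2 * pi\<close> on
  the left is thrown away.\<close>

lemma perron_bound:
  fixes c y V :: real
  assumes a: "tame a" "a 0 = 0" and c: "1 < c" "c \<le> 2" and y: "y > 0" "y \<le> real N"
    and V: "\<And>T. T \<ge> 2 \<Longrightarrow> norm (contour_integral (linepath (Complex c (-T)) (Complex c T))
        (\<lambda>s. dirichlet a s * (of_real y powr s / (s * (s + 1))))) \<le> V"
  shows "\<bar>\<Sum>n\<le>N. a n * max 0 (1 - real n / y)\<bar> \<le> V"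
proof -
  define W where "W = (\<Sum>n\<le>N. a n * max 0 (1 - real n / y))"
  define S where "S = (\<Sum>n. \<bar>a n\<bar> * real n powr (-c))"
  have sS: "summable (\<lambda>n. \<bar>a n\<bar> * real n powr (-c))" using a c by (auto simp: tame_def)
  have S0: "S \<ge> 0" unfolding S_def by (intro suminf_nonneg sS) auto
  have Wsums: "(\<lambda>n. of_real (a n) * (2 * pi * \<i> * of_real (max 0 (1 - real n / y)))) sums (2 * pi * \<i> * of_real W)"
  proof -
    \<comment> \<open>The series is finite: beyond \<open>N \<ge> y\<close> the weight
      vanishes.\<close>
    have "(\<lambda>n. a n * max 0 (1 - real n / y)) sums W" unfolding W_def
      by (rule sums_finite) (use y in \<open>auto simp: max_def field_simps\<close>)
    then have "(\<lambda>n. complex_of_real (a n * max 0 (1 - real n / y))) sums of_real W" by (rule sums_of_real)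
    from sums_mult[OF this, of "2 * pi * \<i>"] show ?thesis by (simp add: mult_ac)
  qed
  have main: "2 * pi * \<bar>W\<bar> \<le> V + 10 * y powr c * S / T" if T: "T \<ge> 2" for T
  proof -
    define \<gamma> where "\<gamma> = linepath (Complex c (-T)) (Complex c T)"
    define J where "J = contour_integral \<gamma> (\<lambda>s. dirichlet a s * (of_real y powr s / (s * (s + 1))))"
    define I where "I n = contour_integral \<gamma> (\<lambda>s. of_real (y / real n) powr s / (s * (s + 1)))" for n :: nat
    have "(\<lambda>n. of_real (a n) * I n) sums J"
      unfolding I_def J_def \<gamma>_def by (rule perron_series_sums) (use a c y T in auto)
    from sums_diff[OF this Wsums]
    have d: "(\<lambda>n. of_real (a n) * (I n - 2 * pi * \<i> * of_real (max 0 (1 - real n / y)))) sums (J - 2 * pi * \<i> * of_real W)"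
      by (simp add: algebra_simps)
    have bound: "norm (of_real (a n) * (I n - 2 * pi * \<i> * of_real (max 0 (1 - real n / y)))) \<le> (10 * y powr c / T) * (\<bar>a n\<bar> * real n powr (-c))" for n
    proof (cases "n = 0")
      case False
      have "norm (I n - 2 * pi * \<i> * of_real (max 0 (1 - 1 / (y / real n)))) \<le> 10 * (y / real n) powr c / T"
        unfolding I_def \<gamma>_def using False y c T by (intro perron_kernel) auto
      also have "(y / real n) powr c = y powr c * real n powr (-c)"
        using y by (subst powr_divide) (auto simp: powr_minus_divide)
      finally have "norm (I n - 2 * pi * \<i> * of_real (max 0 (1 - real n / y))) \<le> (10 * y powr c / T) * real n powr (-c)"
        by simp
      from mult_left_mono[OF this, of "\<bar>a n\<bar>"] show ?thesis by (simp only: norm_mult norm_of_real mult_ac)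
    qed (simp add: a)
    have "norm (J - 2 * pi * \<i> * of_real W) \<le> (\<Sum>n. (10 * y powr c / T) * (\<bar>a n\<bar> * real n powr (-c)))"
      unfolding sums_unique[OF d] by (rule norm_suminf_le[OF bound summable_mult[OF sS]])
    also have "\<dots> = (10 * y powr c / T) * S" unfolding S_def by (rule suminf_mult[OF sS])
    finally have 1: "norm (J - 2 * pi * \<i> * of_real W) \<le> 10 * y powr c * S / T" by simp
    have "norm (2 * pi * \<i> * of_real W) \<le> norm J + norm (J - 2 * pi * \<i> * of_real W)"
      by (metis norm_minus_commute norm_triangle_sub)
    also have "norm (2 * pi * \<i> * of_real W) = 2 * pi * \<bar>W\<bar>" by (simp add: norm_mult)
    finally show ?thesis using V[OF T] 1 unfolding J_def \<gamma>_def by linarith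
  qed
  have "2 * pi * \<bar>W\<bar> \<le> V"
  proof (rule field_le_epsilon)
    fix e :: real assume e: "e > 0"
    define X where "X = 10 * y powr c * S"
    have X: "X \<ge> 0" using S0 by (simp add: X_def)
    define T where "T = max 2 (X / e)"
    have "X / T \<le> e" using e X by (simp add: T_def field_simps max_def)
    then show "2 * pi * \<bar>W\<bar> \<le> V + e" using main[of T] by (simp add: T_def X_def)
  qed
  moreover have "\<bar>W\<bar> \<le> 2 * pi * \<bar>W\<bar>" using pi_gt3 by (simp add: mult_le_cancel_right1)
  ultimately show ?thesis by (simp add: W_def)
qed

lemma integral_powr_three_halves:
  fixes T :: real
  assumes T: "T > 0"
  shows "(\<lambda>t. (1 + \<bar>t\<bar>) powr (-3/2)) integrable_on {-T..T}" "integral {-T..T} (\<lambda>t. (1 + \<bar>t\<bar>) powr (-3/2)) \<le> 4"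
proof -
  have "((\<lambda>t. (1 + t) powr (-3/2)) has_integral (- 2 * (1 + T) powr (-1/2) - (- 2 * (1 + 0) powr (-1/2)))) {0..T}"
    using T by (intro fundamental_theorem_of_calculus)
      (auto intro!: derivative_eq_intros simp: has_real_derivative_iff_has_vector_derivative[symmetric])
  then have "((\<lambda>t. (1 + t) powr (-3/2)) has_integral (2 - 2 * (1 + T) powr (-1/2))) {0..T}" by simp
  then have 1: "((\<lambda>t. (1 + \<bar>t\<bar>) powr (-3/2)) has_integral (2 - 2 * (1 + T) powr (-1/2))) {0..T}"
    by (rule has_integral_eq[rotated]) auto
  have "((\<lambda>t. (1 + \<bar>-t\<bar>) powr (-3/2)) has_integral (2 - 2 * (1 + T) powr (-1/2))) {-T..-0}"
    by (rule has_integral_reflect_real[THEN iffD2]) (use 1 in simp)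
  then have 2: "((\<lambda>t. (1 + \<bar>t\<bar>) powr (-3/2)) has_integral (2 - 2 * (1 + T) powr (-1/2))) {-T..0}" by simp
  have 3: "((\<lambda>t. (1 + \<bar>t\<bar>) powr (-3/2)) has_integral ((2 - 2 * (1 + T) powr (-1/2)) + (2 - 2 * (1 + T) powr (-1/2)))) {-T..T}"
    by (rule has_integral_combine[OF _ _ 2 1]) (use T in auto)
  then show "(\<lambda>t. (1 + \<bar>t\<bar>) powr (-3/2)) integrable_on {-T..T}" by (rule has_integral_integrable)
  have "integral {-T..T} (\<lambda>t. (1 + \<bar>t\<bar>) powr (-3/2)) = (2 - 2 * (1 + T) powr (-1/2)) + (2 - 2 * (1 + T) powr (-1/2))"
    using 3 by (rule integral_unique)
  then show "integral {-T..T} (\<lambda>t. (1 + \<bar>t\<bar>) powr (-3/2)) \<le> 4" by simp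
qed

text \<open>At \<open>c = 1 + 1 / ln y\<close> one has \<open>y powr c = exp 1 * y\<close>. The
  square root growth of the series against the quadratic decay of the kernel leaves
  \<open>(1 + \<bar>t\<bar>) powr (-3/2)\<close>, whose integral over any symmetric interval is at
  most 4.\<close>

lemma mangoldt_smoothed_bound:
  obtains C y0 where "C > 0" "y0 > 1" "\<And>y N. y \<ge> y0 \<Longrightarrow> y \<le> real N \<Longrightarrow>
    \<bar>\<Sum>n\<le>N. (mangoldt n - 1) * ln (real n) ^ 2 * max 0 (1 - real n / y)\<bar> \<le> C * y"
proof -
  obtain C r where C: "C > 0" and r: "r > 0" and Cb: "\<And>\<sigma> t. 1 < \<sigma> \<Longrightarrow> \<sigma> < 1 + r \<Longrightarrow>
    norm (dirichlet (\<lambda>n. (mangoldt n - 1) * ln (real n) ^ 2) (Complex \<sigma> t)) \<le> C * sqrt (1 + \<bar>t\<bar>)"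
    using mangoldt_series_bound by blast
  define a :: "nat \<Rightarrow> real" where "a n = (mangoldt n - 1) * ln (real n) ^ 2" for n
  have a: "tame a" "a 0 = 0"
    unfolding a_def using tame_ln_power[OF tame_diff[OF tame_mangoldt tame_1]] by auto
  \<comment> \<open>From \<open>ln y \<ge> 1\<close> follows \<open>c \<le> 2\<close>, and from
    \<open>ln y \<ge> 2 / r\<close> follows \<open>c < 1 + r\<close>.\<close>
  define y0 where "y0 = exp (max 1 (2 / r))"
  have y0: "y0 > 1" unfolding y0_def by simp
  show ?thesis
  proof (rule that[of "8 * exp 1 * C" y0])
    fix y :: real and N :: nat assume y: "y \<ge> y0" "y \<le> real N"
    have yp: "y > 1" using y y0 by simp
    have lny: "ln y \<ge> max 1 (2 / r)" using y yp unfolding y0_def by (subst ln_ge_iff) auto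
    define c where "c = 1 + 1 / ln y"
    have "1 / ln y < r"
    proof -
      have "2 / r \<le> ln y" "ln y \<ge> 1" using lny by auto
      then have "2 \<le> r * ln y" using r by (simp add: field_simps)
      then show ?thesis using \<open>ln y \<ge> 1\<close> by (simp add: field_simps)
    qed
    moreover have "1 / ln y \<le> 1" using lny by simp
    moreover have "1 / ln y > 0" using lny by simp
    ultimately have c: "1 < c" "c \<le> 2" "c < 1 + r" by (auto simp: c_def)
    have "y powr (1 / ln y) = exp 1" using yp lny by (simp add: powr_def)
    then have yc: "y powr c = exp 1 * y" using yp by (simp add: c_def powr_add)
    have "\<bar>\<Sum>n\<le>N. a n * max 0 (1 - real n / y)\<bar> \<le> 8 * exp 1 * C * y"
    proof (rule perron_bound[OF a c(1,2)])
      fix T :: real assume T: "T \<ge> 2"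
      define f where "f s = dirichlet a s * (of_real y powr s / (s * (s + 1)))" for s
      have "dirichlet a holomorphic_on {s. Re s > 1}"
        by (rule holomorphic_onI) (use dirichlet_has_field_derivative[OF a(1)] in \<open>auto simp: field_differentiable_def intro: has_field_derivative_at_within\<close>)
      then have "f holomorphic_on {s. Re s > 1}"
        unfolding f_def by (intro holomorphic_intros) (auto simp: add_eq_0_iff2)
      then have "continuous_on {s. Re s > 1} f" by (rule holomorphic_on_imp_continuous_on)
      then have cont: "continuous_on {-T..T} (\<lambda>t. f (Complex c t))"
        by (rule continuous_on_compose2) (use c in \<open>auto simp: Complex_eq intro!: continuous_intros\<close>)
      have fb: "norm (f (Complex c t)) \<le> (2 * exp 1 * C * y) * (1 + \<bar>t\<bar>) powr (-3/2)" for t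
      proof -
        define s where "s = Complex c t"
        have n1: "1 + t^2 \<le> norm s ^ 2" "1 + t^2 \<le> norm (s + 1) ^ 2"
          using c one_le_power[of c 2] one_le_power[of "c + 1" 2] by (auto simp: cmod_power2 s_def)
        then have sq: "sqrt (1 + t^2) \<le> norm s" "sqrt (1 + t^2) \<le> norm (s + 1)" by (simp_all add: real_le_lsqrt)
        have "norm (of_real y powr s / (s * (s + 1))) \<le> (exp 1 * y) / (sqrt (1 + t^2) * sqrt (1 + t^2))"
          using yp sq yc by (intro perron_integrand_norm_le) (auto simp: s_def add_pos_nonneg)
        also have "\<dots> = (exp 1 * y) / (1 + t^2)" by simp
        also have "\<dots> \<le> (exp 1 * y) / ((1 + \<bar>t\<bar>)^2 / 2)"
        proof (rule divide_left_mono)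
          have "(\<bar>t\<bar> - 1)^2 \<ge> 0" by simp
          then show "(1 + \<bar>t\<bar>)^2 / 2 \<le> 1 + t^2" by (simp add: power2_eq_square algebra_simps)
        qed (use yp in \<open>auto simp: add_pos_nonneg\<close>)
        finally have k: "norm (of_real y powr s / (s * (s + 1))) \<le> 2 * exp 1 * y / (1 + \<bar>t\<bar>)^2" by (simp add: mult_ac)
        have "norm (f s) = norm (dirichlet a s) * norm (of_real y powr s / (s * (s + 1)))"
          unfolding f_def by (rule norm_mult)
        also have "\<dots> \<le> (C * sqrt (1 + \<bar>t\<bar>)) * (2 * exp 1 * y / (1 + \<bar>t\<bar>)^2)"
          using Cb[OF c(1,3), of t] k C unfolding a_def[abs_def] by (intro mult_mono) (auto simp: s_def)
        also have "\<dots> = (2 * exp 1 * C * y) * ((1 + \<bar>t\<bar>) powr (1/2) / (1 + \<bar>t\<bar>) powr 2)"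
          by (simp add: powr_half_sqrt)
        also have "(1 + \<bar>t\<bar>) powr (1/2) / (1 + \<bar>t\<bar>) powr 2 = (1 + \<bar>t\<bar>) powr (-3/2)" by (subst powr_diff[symmetric]) simp
        finally show ?thesis by (simp add: s_def)
      qed
      have "norm (contour_integral (linepath (Complex c (-T)) (Complex c T)) f) = norm (integral {-T..T} (\<lambda>t. f (Complex c t)))"
        using T by (subst contour_integral_linepath_same_Re[of _ c _ "-T" T]) (auto simp: norm_mult)
      also have "\<dots> \<le> integral {-T..T} (\<lambda>t. (2 * exp 1 * C * y) * (1 + \<bar>t\<bar>) powr (-3/2))"
        using T fb by (intro Henstock_Kurzweil_Integration.integral_norm_bound_integral integrable_continuous_real cont
          integrable_on_mult_right integral_powr_three_halves) auto
      also have "\<dots> = (2 * exp 1 * C * y) * integral {-T..T} (\<lambda>t. (1 + \<bar>t\<bar>) powr (-3/2))" by simp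
      also have "\<dots> \<le> (2 * exp 1 * C * y) * 4"
        using T C yp by (intro mult_left_mono integral_powr_three_halves) auto
      finally show "norm (contour_integral (linepath (Complex c (-T)) (Complex c T))
        (\<lambda>s. dirichlet a s * (of_real y powr s / (s * (s + 1))))) \<le> 8 * exp 1 * C * y"
        unfolding f_def by simp
    qed (use yp y in auto)
    then show "\<bar>\<Sum>n\<le>N. (mangoldt n - 1) * ln (real n) ^ 2 * max 0 (1 - real n / y)\<bar> \<le> 8 * exp 1 * C * y"
      by (simp add: a_def)
  qed (use C y0 in auto)
qed

section \<open>The prime number theorem\<close>

text \<open>The smoothing is removed by a difference of two weights \<open>max 0 (z - n)\<close>
  whose parameters \<open>z\<close> are \<open>h\<close> apart: it equals \<open>h\<close> up to an
  edge of length \<open>h\<close>. On the edge the terms \<open>w n\<close> are nonnegative and may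
  be dropped on the favourable side; only the explicit terms \<open>v n\<close>, of size
  \<open>l^2\<close>, have to be estimated.\<close>

lemma mangoldt_partial_sums_bound:
  obtains C where "C > 0" "\<And>N. \<bar>\<Sum>n\<le>N. (mangoldt n - 1) * ln (real n) ^ 2\<bar> \<le> C * (real N * ln (real N) + 1)"
proof -
  obtain C y0 where C: "C > 0" and y0: "y0 > 1" and Cb: "\<And>y N. y \<ge> y0 \<Longrightarrow> y \<le> real N \<Longrightarrow>
    \<bar>\<Sum>n\<le>N. (mangoldt n - 1) * ln (real n) ^ 2 * max 0 (1 - real n / y)\<bar> \<le> C * y"
    using mangoldt_smoothed_bound by blast
  define w :: "nat \<Rightarrow> real" where "w n = mangoldt n * ln (real n) ^ 2" for n
  define v :: "nat \<Rightarrow> real" where "v n = ln (real n) ^ 2" for n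
  have wv: "w n \<ge> 0" "v n \<ge> 0" for n by (auto simp: w_def v_def mangoldt_nonneg)
  have sm: "\<bar>\<Sum>n\<le>N. (w n - v n) * max 0 (z - real n)\<bar> \<le> C * z\<^sup>2" if z: "z \<ge> y0" "z \<le> real N" for z N
  proof -
    have "z > 0" using z y0 by simp
    then have "max 0 (z - real n) = z * max 0 (1 - real n / z)" for n
      by (simp add: max_def field_simps)
    then have "(\<Sum>n\<le>N. (w n - v n) * max 0 (z - real n)) = z * (\<Sum>n\<le>N. (mangoldt n - 1) * ln (real n) ^ 2 * max 0 (1 - real n / z))"
      unfolding sum_distrib_left by (intro sum.cong) (auto simp: w_def v_def algebra_simps)
    then have "\<bar>\<Sum>n\<le>N. (w n - v n) * max 0 (z - real n)\<bar> = z * \<bar>\<Sum>n\<le>N. (mangoldt n - 1) * ln (real n) ^ 2 * max 0 (1 - real n / z)\<bar>"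
      using \<open>z > 0\<close> by (simp add: abs_mult)
    also have "\<dots> \<le> z * (C * z)" using Cb[OF z] \<open>z > 0\<close> by (intro mult_left_mono) auto
    finally show ?thesis by (simp add: power2_eq_square mult_ac)
  qed
  \<comment> \<open>\<open>y \<ge> exp 2\<close> gives \<open>l \<ge> 2\<close>, hence
    \<open>h \<le> y / 2\<close>, and then \<open>y \<ge> 2 * y0\<close> keeps \<open>y - h\<close>
    above \<open>y0\<close>.\<close>
  define N0 where "N0 = nat \<lceil>max (2 * y0) (exp 2)\<rceil>"
  have large: "\<bar>\<Sum>n\<le>N. w n - v n\<bar> \<le> (4 * C + 8) * (real N * ln (real N))" if N: "N \<ge> N0" for N
  proof -
    define y where "y = real N"
    define l where "l = ln y"
    \<comment> \<open>Balances the smoothing error \<open>y^2 / h\<close> against the edge error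
      \<open>h * l^2\<close>; both become \<open>y * l\<close>.\<close>
    define h where "h = y / l"
    define K where "K = nat \<lceil>h\<rceil>"
    have yb: "y \<ge> 2 * y0" "y \<ge> exp 2" using N unfolding N0_def y_def by linarith+
    have y1: "y > 1" using yb y0 by linarith
    have l2: "l \<ge> 2" unfolding l_def using yb y1 by (subst ln_ge_iff) auto
    have ly: "l \<le> y" unfolding l_def using y1 ln_le_minus_one[of y] by linarith
    have hl: "h * l = y" using l2 by (simp add: h_def)
    have h1: "h \<ge> 1" unfolding h_def using ly l2 by (simp add: field_simps)
    have h2: "h \<le> y / 2" unfolding h_def using l2 y1 by (intro divide_left_mono) auto
    have K: "h \<le> real K" "real K \<le> 2 * h" using h1 unfolding K_def by linarith+
    have KN: "K \<le> N" using K(2) h2 unfolding y_def by linarith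
    have hh: "h * (y * l) = y\<^sup>2" using hl by (simp add: power2_eq_square mult_ac)
    have hh2: "h\<^sup>2 * l\<^sup>2 = y\<^sup>2" using hl by (metis power_mult_distrib)
    \<comment> \<open>Parameters \<open>y + h\<close> and \<open>y\<close>: the edge lies beyond
      \<open>N\<close>, and dropping its terms \<open>w n\<close> only helps an upper bound.\<close>
    have upper: "h * (\<Sum>n\<le>N. w n - v n) \<le> (4 * C + 8) * y\<^sup>2"
    proof -
      define M where "M = N + K"
      define d where "d n = max 0 (y + h - real n) - max 0 (y - real n)" for n
      have d: "0 \<le> d n" "d n \<le> h" for n using h1 unfolding d_def by auto
      have dh: "d n = h" if "n \<le> N" for n using h1 that unfolding d_def y_def by auto
      have yM: "y + h \<le> real M" unfolding M_def y_def using K by simp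
      have un: "{..M} = {..N} \<union> {N<..M}" by (auto simp: M_def)
      have split: "(\<Sum>n\<le>M. f n) = (\<Sum>n\<le>N. f n) + (\<Sum>n\<in>{N<..M}. f n)" for f :: "nat \<Rightarrow> real"
        unfolding un by (rule sum.union_disjoint) auto
      have "(\<Sum>n\<le>M. (w n - v n) * d n) = (\<Sum>n\<le>M. (w n - v n) * max 0 (y + h - real n)) - (\<Sum>n\<le>M. (w n - v n) * max 0 (y - real n))"
        unfolding sum_subtractf[symmetric] by (intro sum.cong) (auto simp: d_def algebra_simps)
      also have "\<dots> \<le> C * (y + h)\<^sup>2 + C * y\<^sup>2"
        using sm[of "y + h" M] sm[of y M] yM yb y0 h1 by linarith
      also have "\<dots> \<le> C * (2 * y\<^sup>2 + y\<^sup>2 / 4 + y\<^sup>2)"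
      proof -
        have "(y + h)\<^sup>2 \<le> (y + y/2)\<^sup>2" using h2 h1 y1 by (intro power_mono) auto
        also have "\<dots> = 2 * y\<^sup>2 + y\<^sup>2 / 4" by (simp add: power2_eq_square algebra_simps)
        finally show ?thesis using C by (simp add: ring_distribs(1)[symmetric] mult_left_mono)
      qed
      also have "\<dots> \<le> 4 * C * y\<^sup>2" using C by (simp add: algebra_simps)
      finally have 1: "(\<Sum>n\<le>M. (w n - v n) * d n) \<le> 4 * C * y\<^sup>2" .
      have "(\<Sum>n\<in>{N<..M}. v n * d n) \<le> (\<Sum>n\<in>{N<..M}. (4 * l\<^sup>2) * h)"
      proof (rule sum_mono)
        fix n assume n: "n \<in> {N<..M}"
        then have "real n \<le> y * y" 
        proof -
          have "real n \<le> real M" using n by simp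
          also have "\<dots> \<le> y * 2" unfolding M_def y_def using KN by simp
          also have "\<dots> \<le> y * y" using y1 yb l2 ly by (intro mult_left_mono) auto
          finally show ?thesis .
        qed
        then have "ln (real n) \<le> 2 * l" using n y1 ln_mono[of "real n" "y * y"] by (simp add: l_def ln_mult)
        then have "v n \<le> (2 * l)\<^sup>2" unfolding v_def using n by (intro power_mono) auto
        then show "v n * d n \<le> (4 * l\<^sup>2) * h" using d[of n] wv[of n] by (intro mult_mono) auto
      qed
      also have "\<dots> = real K * ((4 * l\<^sup>2) * h)" by (simp add: M_def)
      also have "\<dots> \<le> (2 * h) * ((4 * l\<^sup>2) * h)" using K h1 by (intro mult_right_mono) auto
      also have "\<dots> = 8 * y\<^sup>2" using hh2 by (simp add: power2_eq_square mult_ac)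
      finally have 2: "(\<Sum>n\<in>{N<..M}. v n * d n) \<le> 8 * y\<^sup>2" .
      have 3: "(\<Sum>n\<in>{N<..M}. w n * d n) \<ge> 0" using wv d by (intro sum_nonneg) auto
      have "(\<Sum>n\<le>M. (w n - v n) * d n) = (\<Sum>n\<le>N. (w n - v n) * d n) + (\<Sum>n\<in>{N<..M}. w n * d n) - (\<Sum>n\<in>{N<..M}. v n * d n)"
        unfolding split by (simp add: left_diff_distrib sum_subtractf)
      moreover have "(\<Sum>n\<le>N. (w n - v n) * d n) = h * (\<Sum>n\<le>N. w n - v n)"
        unfolding sum_distrib_left by (intro sum.cong) (auto simp: dh)
      ultimately show ?thesis using 1 2 3 by (simp add: algebra_simps)
    qed
    \<comment> \<open>Parameters \<open>y\<close> and \<open>y - h\<close>: the edge lies below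
      \<open>N\<close>, and replacing \<open>d n\<close> by \<open>h\<close> there only adds
      nonnegative terms \<open>w n\<close>.\<close>
    have lower: "h * (\<Sum>n\<le>N. w n - v n) \<ge> - ((4 * C + 8) * y\<^sup>2)"
    proof -
      define d where "d n = max 0 (y - real n) - max 0 (y - h - real n)" for n
      have d: "0 \<le> d n" "d n \<le> h" for n using h1 unfolding d_def by auto
      have dh: "d n = h" if "n \<le> N - K" for n
        using h1 that K KN unfolding d_def y_def by (auto simp: max_def)
      have "(\<Sum>n\<le>N. (w n - v n) * d n) = (\<Sum>n\<le>N. (w n - v n) * max 0 (y - real n)) - (\<Sum>n\<le>N. (w n - v n) * max 0 (y - h - real n))"
        unfolding sum_subtractf[symmetric] by (intro sum.cong) (auto simp: d_def algebra_simps)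
      also have "\<dots> \<ge> - (C * y\<^sup>2) - C * (y - h)\<^sup>2"
        using sm[of "y - h" N] sm[of y N] yb y0 h1 h2 by (simp add: y_def)
      finally have "(\<Sum>n\<le>N. (w n - v n) * d n) \<ge> - (C * y\<^sup>2) - C * (y - h)\<^sup>2" .
      moreover have "C * (y - h)\<^sup>2 \<le> C * y\<^sup>2" using C h1 h2 y1 by (intro mult_left_mono power_mono) auto
      ultimately have 1: "(\<Sum>n\<le>N. (w n - v n) * d n) \<ge> - (2 * C * y\<^sup>2)" by linarith
      have un: "{..N} = {..N-K} \<union> {N-K<..N}" by auto
      have "(\<Sum>n\<le>N. v n * (h - d n)) = (\<Sum>n\<le>N-K. v n * (h - d n)) + (\<Sum>n\<in>{N-K<..N}. v n * (h - d n))"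
        unfolding un by (rule sum.union_disjoint) auto
      also have "(\<Sum>n\<le>N-K. v n * (h - d n)) = 0" by (intro sum.neutral) (auto simp: dh)
      also have "(\<Sum>n\<in>{N-K<..N}. v n * (h - d n)) \<le> (\<Sum>n\<in>{N-K<..N}. l\<^sup>2 * h)"
      proof (rule sum_mono)
        fix n assume n: "n \<in> {N-K<..N}"
        then have "ln (real n) \<le> l" unfolding l_def y_def by simp
        then have "v n \<le> l\<^sup>2" unfolding v_def using n by (intro power_mono) auto
        then show "v n * (h - d n) \<le> l\<^sup>2 * h" using d[of n] wv[of n] by (intro mult_mono) auto
      qed
      also have "\<dots> = real K * (l\<^sup>2 * h)" using KN by simp
      also have "\<dots> \<le> (2 * h) * (l\<^sup>2 * h)" using K h1 by (intro mult_right_mono) auto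
      also have "\<dots> = 2 * y\<^sup>2" using hh2 by (simp add: power2_eq_square mult_ac)
      finally have 2: "(\<Sum>n\<le>N. v n * (h - d n)) \<le> 2 * y\<^sup>2" by simp
      have 3: "(\<Sum>n\<le>N. w n * (h - d n)) \<ge> 0" using wv d by (intro sum_nonneg) auto
      have "h * (\<Sum>n\<le>N. w n - v n) = (\<Sum>n\<le>N. (w n - v n) * d n) + (\<Sum>n\<le>N. w n * (h - d n)) - (\<Sum>n\<le>N. v n * (h - d n))"
        unfolding sum_distrib_left sum.distrib[symmetric] sum_subtractf[symmetric]
        by (intro sum.cong) (auto simp: algebra_simps)
      moreover have "(4 * C + 8) * y\<^sup>2 \<ge> 2 * C * y\<^sup>2 + 2 * y\<^sup>2"
        using C by (simp add: algebra_simps)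
      ultimately show ?thesis using 1 2 3 by linarith
    qed
    have "h * \<bar>\<Sum>n\<le>N. w n - v n\<bar> \<le> h * ((4 * C + 8) * (y * l))"
    proof -
      have "h * \<bar>\<Sum>n\<le>N. w n - v n\<bar> = \<bar>h * (\<Sum>n\<le>N. w n - v n)\<bar>" using h1 by (simp add: abs_mult)
      also have "\<dots> \<le> (4 * C + 8) * y\<^sup>2" using upper lower by linarith
      also have "\<dots> = h * ((4 * C + 8) * (y * l))" using hh by (simp add: mult_ac)
      finally show ?thesis .
    qed
    then have "\<bar>\<Sum>n\<le>N. w n - v n\<bar> \<le> (4 * C + 8) * (y * l)" using h1 by (simp only: mult_le_cancel_left_pos)
    then show ?thesis by (simp add: y_def l_def)
  qed
  define B where "B = (\<Sum>n\<le>N0. \<bar>w n - v n\<bar>)"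
  have B0: "B \<ge> 0" unfolding B_def by (intro sum_nonneg) auto
  have wv_eq: "w n - v n = (mangoldt n - 1) * ln (real n) ^ 2" for n by (simp add: w_def v_def algebra_simps)
  show ?thesis
  proof (rule that[of "4 * C + 8 + B"])
    fix N
    have p: "real N * ln (real N) \<ge> 0" by (cases "N = 0") auto
    have "\<bar>\<Sum>n\<le>N. w n - v n\<bar> \<le> (4 * C + 8 + B) * (real N * ln (real N) + 1)"
    proof (cases "N \<ge> N0")
      case True
      have "\<bar>\<Sum>n\<le>N. w n - v n\<bar> \<le> (4 * C + 8) * (real N * ln (real N))" by (rule large[OF True])
      also have "\<dots> \<le> (4 * C + 8 + B) * (real N * ln (real N) + 1)" using C B0 p by (intro mult_mono) auto
      finally show ?thesis .
    next
      case False
      have "\<bar>\<Sum>n\<le>N. w n - v n\<bar> \<le> (\<Sum>n\<le>N. \<bar>w n - v n\<bar>)" by (rule sum_abs)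
      also have "\<dots> \<le> B" unfolding B_def using False by (intro sum_mono2) auto
      also have "B \<le> (4 * C + 8 + B) * 1" using C by simp
      also have "\<dots> \<le> (4 * C + 8 + B) * (real N * ln (real N) + 1)" using C B0 p by (intro mult_left_mono) auto
      finally show ?thesis .
    qed
    then show "\<bar>\<Sum>n\<le>N. (mangoldt n - 1) * ln (real n) ^ 2\<bar> \<le> (4 * C + 8 + B) * (real N * ln (real N) + 1)"
      unfolding wv_eq .
  qed (use C B0 in auto)
qed

text \<open>Partial summation. The induction carries the boundary term along, so that the decrements
  of \<open>h\<close> telescope to \<open>h 1 - h M\<close>.\<close>

lemma abel_bound:
  fixes b h :: "nat \<Rightarrow> real"
  assumes "N \<ge> 1" "\<And>m n. 1 \<le> m \<Longrightarrow> m \<le> n \<Longrightarrow> n \<le> N \<Longrightarrow> h n \<le> h m" "h N \<ge> 0"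
    and D: "\<And>n. 1 \<le> n \<Longrightarrow> n \<le> N \<Longrightarrow> \<bar>\<Sum>k=1..n. b k\<bar> \<le> B"
  shows "\<bar>\<Sum>n=1..N. b n * h n\<bar> \<le> B * h 1"
proof -
  have B: "B \<ge> 0" using order_trans[OF abs_ge_zero D[of 1]] assms(1) by simp
  have "\<bar>(\<Sum>n=1..M. b n * h n) - (\<Sum>k=1..M. b k) * h M\<bar> \<le> B * (h 1 - h M)" if "1 \<le> M" "M \<le> N" for M
    using that
  proof (induction M rule: dec_induct)
    case (step M)
    have "(\<Sum>n=1..Suc M. b n * h n) - (\<Sum>k=1..Suc M. b k) * h (Suc M)
      = ((\<Sum>n=1..M. b n * h n) - (\<Sum>k=1..M. b k) * h M) + (\<Sum>k=1..M. b k) * (h M - h (Suc M))"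
      by (simp add: algebra_simps)
    also have "\<bar>\<dots>\<bar> \<le> \<bar>(\<Sum>n=1..M. b n * h n) - (\<Sum>k=1..M. b k) * h M\<bar> + \<bar>(\<Sum>k=1..M. b k) * (h M - h (Suc M))\<bar>"
      by (rule abs_triangle_ineq)
    also have "\<bar>(\<Sum>k=1..M. b k) * (h M - h (Suc M))\<bar> \<le> B * (h M - h (Suc M))"
      unfolding abs_mult using D[of M] assms(2)[of M "Suc M"] step by (intro mult_mono) auto
    finally show ?case using step by (simp add: algebra_simps)
  qed simp
  from this[of N] have 1: "\<bar>(\<Sum>n=1..N. b n * h n) - (\<Sum>k=1..N. b k) * h N\<bar> \<le> B * (h 1 - h N)" using assms by simp
  have "\<bar>(\<Sum>k=1..N. b k) * h N\<bar> \<le> B * h N"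
    unfolding abs_mult using D[of N] assms B by (intro mult_mono) auto
  with 1 show ?thesis by (simp add: algebra_simps)
qed

lemma ln_Suc_diff_bounds:
  assumes "N \<ge> 1"
  shows "1 / real (Suc N) \<le> ln (real (Suc N)) - ln (real N)" "ln (real (Suc N)) - ln (real N) \<le> 1 / real N"
proof -
  have "ln (real (Suc N)) - ln (real N) = ln (real (Suc N) / real N)" using assms by (subst ln_div) auto
  also have "real (Suc N) / real N = 1 + 1 / real N" using assms by (simp add: field_simps)
  also have "ln (1 + 1 / real N) \<le> 1 / real N" by (rule ln_add_one_self_le_self) simp
  finally show "ln (real (Suc N)) - ln (real N) \<le> 1 / real N" .
  have "ln (real N / real (Suc N)) \<le> real N / real (Suc N) - 1" using assms by (intro ln_le_minus_one) auto
  also have "\<dots> = - 1 / real (Suc N)" using assms by (simp add: field_simps)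
  finally show "1 / real (Suc N) \<le> ln (real (Suc N)) - ln (real N)" using assms by (subst (asm) ln_div) auto
qed

lemma sum_ln_ge: "N \<ge> 1 \<Longrightarrow> real N * ln (real N) - (\<Sum>n=1..N. ln (real n)) \<le> real N"
proof (induction N rule: nat_induct_at_least)
  case (Suc N)
  have "real N * (ln (real (Suc N)) - ln (real N)) \<le> 1"
    using mult_left_mono[OF ln_Suc_diff_bounds(2)[OF Suc(1)], of "real N"] Suc(1) by simp
  then show ?case using Suc by (simp add: algebra_simps)
qed simp

text \<open>The exponent is at least 2, so the base is at most \<open>sqrt N\<close>; the exponent
  is at most the binary logarithm of \<open>N\<close>, and \<open>1 / ln 2 \<le> 2\<close>.\<close>

lemma card_primepow_not_prime_le:
  assumes N: "N \<ge> 2"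
  shows "real (card {n. n \<le> N \<and> primepow n \<and> \<not> prime n}) \<le> sqrt (real N) * (2 * ln (real N))"
proof -
  define s where "s = nat \<lfloor>sqrt (real N)\<rfloor>"
  define K where "K = nat \<lfloor>log 2 (real N)\<rfloor>"
  have sub: "{n. n \<le> N \<and> primepow n \<and> \<not> prime n} \<subseteq> (\<lambda>(p,k). p ^ k) ` ({1..s} \<times> {1..K})"
  proof
    fix n assume "n \<in> {n. n \<le> N \<and> primepow n \<and> \<not> prime n}"
    then obtain p k where pk: "prime p" "k > 0" "n = p ^ k" "p ^ k \<le> N" "\<not> prime n"
      by (auto simp: primepow_def)
    have k: "k \<ge> 2" using pk by (cases "k = 1") auto
    have p: "p \<ge> 2" using pk prime_ge_2_nat by blast
    have "p ^ 2 \<le> p ^ k" using k p by (intro power_increasing) auto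
    then have "real (p ^ 2) \<le> real N" using pk by linarith
    then have "real p \<le> sqrt (real N)" by (intro real_le_rsqrt) simp
    then have 1: "p \<le> s" unfolding s_def by linarith
    have "2 ^ k \<le> p ^ k" using p by (intro power_mono) auto
    then have "real (2 ^ k) \<le> real N" using pk by linarith
    then have "real k \<le> log 2 (real N)" using N by (intro le_log_of_power) auto
    then have 2: "k \<le> K" unfolding K_def by linarith
    show "n \<in> (\<lambda>(p,k). p ^ k) ` ({1..s} \<times> {1..K})" using 1 2 p k pk(3) by force
  qed
  have "card {n. n \<le> N \<and> primepow n \<and> \<not> prime n} \<le> card ((\<lambda>(p,k). p ^ k) ` ({1..s} \<times> {1..K}))"
    using sub by (intro card_mono) auto
  also have "\<dots> \<le> s * K" using card_image_le[of "{1..s} \<times> {1..K}" "\<lambda>(p,k). p ^ k"] by simp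
  finally have "real (card {n. n \<le> N \<and> primepow n \<and> \<not> prime n}) \<le> real s * real K" by (simp flip: of_nat_mult)
  also have "\<dots> \<le> sqrt (real N) * (2 * ln (real N))"
  proof (intro mult_mono)
    show "real s \<le> sqrt (real N)" unfolding s_def by simp
    have "real K \<le> log 2 (real N)" using N unfolding K_def by simp
    also have "\<dots> = ln (real N) / ln 2" by (simp add: log_def)
    also have "\<dots> \<le> ln (real N) / (1/2)" using N ln2_ge_two_thirds by (intro divide_left_mono) auto
    finally show "real K \<le> 2 * ln (real N)" by simp
  qed auto
  finally show ?thesis .
qed

text \<open>Measures the loss when \<open>ln p\<close> is replaced by \<open>ln N\<close> in sums
  over primes. The weighted estimate is applied to \<open>h n = ln (N / n)\<close>, whose sum over
  all \<open>n\<close> is only O(N). For \<open>p\<close> above \<open>sqrt N\<close> one has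
  \<open>1 \<le> 8 * ln p ^ 3 / l^3\<close>; there are at most \<open>sqrt N\<close> smaller primes,
  each contributing at most \<open>l\<close>.\<close>

lemma prime_sum_ln_quotient_bound:
  fixes K :: real
  assumes K: "K > 0" and N: "N \<ge> 2"
    and ab: "\<And>h. (\<And>m n. 1 \<le> m \<Longrightarrow> m \<le> n \<Longrightarrow> n \<le> N \<Longrightarrow> h n \<le> h m) \<Longrightarrow> h N \<ge> 0 \<Longrightarrow>
        \<bar>\<Sum>n=1..N. (mangoldt n - 1) * ln (real n) ^ 2 * h n\<bar> \<le> 2 * K * (real N * ln (real N)) * h 1"
  shows "(\<Sum>p | prime p \<and> p \<le> N. ln (real N) - ln (real p)) \<le> (24 + 16 * K) * real N / ln (real N)"
proof -
  define l where "l = ln (real N)"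
  have l: "l > 0" using N by (simp add: l_def)
  define h where "h n = l - ln (real n)" for n :: nat
  have hn: "h n \<ge> 0" "ln (real n) \<ge> 0" "ln (real n) \<le> l" if "n \<in> {1..N}" for n
    using that N by (auto simp: h_def l_def)
  define P where "P = {p. prime p \<and> p \<le> N}"
  have P: "finite P" "P \<subseteq> {1..N}" unfolding P_def using prime_ge_1_nat by auto
  have "\<bar>\<Sum>n=1..N. (mangoldt n - 1) * ln (real n) ^ 2 * h n\<bar> \<le> 2 * K * (real N * l) * h 1"
    unfolding l_def by (rule ab) (auto simp: h_def l_def)
  moreover have "(\<Sum>n=1..N. (mangoldt n - 1) * ln (real n) ^ 2 * h n) = (\<Sum>n=1..N. mangoldt n * ln (real n) ^ 2 * h n) - (\<Sum>n=1..N. ln (real n) ^ 2 * h n)"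
    unfolding sum_subtractf[symmetric] by (intro sum.cong) (auto simp: algebra_simps)
  moreover have "(\<Sum>n=1..N. ln (real n) ^ 2 * h n) \<le> l\<^sup>2 * real N"
  proof -
    have "(\<Sum>n=1..N. ln (real n) ^ 2 * h n) \<le> (\<Sum>n=1..N. l\<^sup>2 * h n)"
      using hn by (intro sum_mono mult_right_mono power_mono) auto
    also have "\<dots> = l\<^sup>2 * (real N * l - (\<Sum>n=1..N. ln (real n)))"
      by (simp add: h_def sum_distrib_left[symmetric] sum_subtractf)
    also have "\<dots> \<le> l\<^sup>2 * real N" using sum_ln_ge[of N] N by (intro mult_left_mono) (auto simp: l_def)
    finally show ?thesis .
  qed
  ultimately have 1: "(\<Sum>n=1..N. mangoldt n * ln (real n) ^ 2 * h n) \<le> (1 + 2 * K) * real N * l\<^sup>2"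
    by (simp add: h_def power2_eq_square algebra_simps)
  have "(\<Sum>p\<in>P. h p) \<le> (\<Sum>p\<in>P. (8 / l^3) * (mangoldt p * ln (real p) ^ 2 * h p) + (if real p \<le> sqrt (real N) then l else 0))"
  proof (rule sum_mono)
    fix p assume p: "p \<in> P"
    then have pr: "prime p" and pN: "p \<in> {1..N}" using P by (auto simp: P_def)
    note hp = hn[OF pN]
    have t: "mangoldt p * ln (real p) ^ 2 * h p \<ge> 0" using hp by (simp add: mangoldt_nonneg)
    show "h p \<le> (8 / l^3) * (mangoldt p * ln (real p) ^ 2 * h p) + (if real p \<le> sqrt (real N) then l else 0)"
    proof (cases "real p \<le> sqrt (real N)")
      case True
      have "h p \<le> l" using hp by (simp add: h_def)
      moreover have "(8 / l^3) * (mangoldt p * ln (real p) ^ 2 * h p) \<ge> 0" using t l by simp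
      ultimately show ?thesis using True by simp
    next
      case False
      then have "ln (sqrt (real N)) \<le> ln (real p)" using N pN by (intro ln_mono) auto
      then have lp: "l / 2 \<le> ln (real p)" using N by (simp add: l_def ln_sqrt)
      have "(l/2)^3 \<le> ln (real p) ^ 3" using lp l by (intro power_mono) auto
      then have "1 \<le> (8 / l^3) * (ln (real p) ^ 3)" using l by (simp add: field_simps)
      then have "h p * 1 \<le> h p * ((8 / l^3) * (ln (real p) ^ 3))" using hp by (intro mult_left_mono)
      also have "\<dots> = (8 / l^3) * (mangoldt p * ln (real p) ^ 2 * h p)" using pr by (simp add: power3_eq_cube power2_eq_square)
      finally show ?thesis using False by simp
    qed
  qed
  also have "\<dots> = (8 / l^3) * (\<Sum>p\<in>P. mangoldt p * ln (real p) ^ 2 * h p) + (\<Sum>p\<in>P. if real p \<le> sqrt (real N) then l else 0)"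
    by (simp add: sum.distrib sum_distrib_left)
  also have "(\<Sum>p\<in>P. mangoldt p * ln (real p) ^ 2 * h p) \<le> (\<Sum>n=1..N. mangoldt n * ln (real n) ^ 2 * h n)"
    using P hn by (intro sum_mono2) (auto simp: mangoldt_nonneg)
  also have "(\<Sum>n=1..N. mangoldt n * ln (real n) ^ 2 * h n) \<le> (1 + 2 * K) * real N * l\<^sup>2" by (rule 1)
  also have "(8 / l^3) * ((1 + 2 * K) * real N * l\<^sup>2) = (8 + 16 * K) * real N / l"
    using l by (simp add: field_simps power2_eq_square power3_eq_cube)
  also have "(\<Sum>p\<in>P. if real p \<le> sqrt (real N) then l else 0) \<le> 16 * real N / l"
  proof -
    have "(\<Sum>p\<in>P. if real p \<le> sqrt (real N) then l else 0) = (\<Sum>p\<in>{p\<in>P. real p \<le> sqrt (real N)}. l)"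
      using P by (intro sum.inter_filter[symmetric])
    also have "\<dots> = real (card {p\<in>P. real p \<le> sqrt (real N)}) * l" by simp
    also have "real (card {p\<in>P. real p \<le> sqrt (real N)}) \<le> sqrt (real N)"
    proof -
      have "card {p\<in>P. real p \<le> sqrt (real N)} \<le> card {1..nat \<lfloor>sqrt (real N)\<rfloor>}"
        using P by (intro card_mono) (auto simp: le_nat_floor)
      then have "real (card {p\<in>P. real p \<le> sqrt (real N)}) \<le> real (nat \<lfloor>sqrt (real N)\<rfloor>)" by (simp only: of_nat_le_iff card_atLeastAtMost diff_Suc_1)
      also have "\<dots> \<le> sqrt (real N)" by (rule of_nat_floor) simp
      finally show ?thesis .
    qed
    also have "sqrt (real N) * l \<le> 16 * real N / l"
    proof -
      have "l \<le> real N powr (1/4) / (1/4)" unfolding l_def using N by (intro ln_powr_bound) auto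
      then have "l\<^sup>2 \<le> (4 * real N powr (1/4))\<^sup>2" using l by (intro power_mono) auto
      also have "\<dots> = 16 * sqrt (real N)" using N by (simp add: power_mult_distrib powr_power powr_half_sqrt)
      finally have "sqrt (real N) * l\<^sup>2 \<le> sqrt (real N) * (16 * sqrt (real N))" by (intro mult_left_mono) auto
      also have "sqrt (real N) * (16 * sqrt (real N)) = 16 * real N" by simp
      finally show ?thesis using l by (simp add: field_simps power2_eq_square)
    qed
    finally show ?thesis using l by (simp add: mult_right_mono)
  qed
  finally show ?thesis using l K unfolding h_def P_def l_def[symmetric]
    by (simp add: mult_left_mono field_simps)
qed

text \<open>Starting from \<open>l^3\<close> times the prime sum, one replaces \<open>l^3\<close> by
  \<open>ln p ^ 3\<close>, adds the proper prime powers, replaces the von Mangoldt function by 1,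
  and replaces \<open>ln n ^ 2\<close> by \<open>l^2\<close>. Each step costs O(H x l); division by
  \<open>l^2\<close> gives the claim.\<close>

lemma prime_sum_asymp:
  obtains C where "C > 0" "\<And>N h. N \<ge> 2 \<Longrightarrow> (\<And>m n. 1 \<le> m \<Longrightarrow> m \<le> n \<Longrightarrow> n \<le> N \<Longrightarrow> h n \<le> h m) \<Longrightarrow> h N \<ge> 0 \<Longrightarrow>
    \<bar>ln (real N) * (\<Sum>p | prime p \<and> p \<le> N. h p) - (\<Sum>n=1..N. h n)\<bar> \<le> C * h 1 * (real N / ln (real N))"
proof -
  obtain K where K: "K > 0" and Kb: "\<And>N. \<bar>\<Sum>n\<le>N. (mangoldt n - 1) * ln (real n) ^ 2\<bar> \<le> K * (real N * ln (real N) + 1)"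
    using mangoldt_partial_sums_bound by blast
  show ?thesis
  \<comment> \<open>The summands belong, in order, to the weights at primes (\<open>c\<close>), the
    prime powers (\<open>q\<close>), the von Mangoldt function (\<open>a\<close>) and the weight
    ln^2 (\<open>b\<close>).\<close>
  proof (rule that[of "3 * (24 + 16 * K) + 432 + 2 * K + 2"])
    fix N :: nat and h :: "nat \<Rightarrow> real"
    assume N: "N \<ge> 2" and dec: "\<And>m n. 1 \<le> m \<Longrightarrow> m \<le> n \<Longrightarrow> n \<le> N \<Longrightarrow> h n \<le> h m" and hN: "h N \<ge> 0"
    define l where "l = ln (real N)"
    define x where "x = real N"
    have "ln 2 \<le> ln (real N)" using N by (subst ln_le_cancel_iff) auto
    then have l23: "l \<ge> 2/3" unfolding l_def using ln2_ge_two_thirds by linarith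
    have x2: "x \<ge> 2" using N by (simp add: x_def)
    have xl: "x * l \<ge> 1" using mult_mono[of 2 x "2/3" l] l23 x2 by simp
    have ab: "\<bar>\<Sum>n=1..N. (mangoldt n - 1) * ln (real n) ^ 2 * g n\<bar> \<le> 2 * K * (real N * ln (real N)) * g 1"
      if g: "\<And>m n. 1 \<le> m \<Longrightarrow> m \<le> n \<Longrightarrow> n \<le> N \<Longrightarrow> g n \<le> g m" "g N \<ge> 0" for g
    proof (rule abel_bound)
      fix n assume n: "1 \<le> n" "n \<le> N"
      have "{..n} = insert 0 {1..n}" by auto
      then have "(\<Sum>k=1..n. (mangoldt k - 1) * ln (real k) ^ 2) = (\<Sum>k\<le>n. (mangoldt k - 1) * ln (real k) ^ 2)"
        by simp
      also have "\<bar>\<dots>\<bar> \<le> K * (real n * ln (real n) + 1)" by (rule Kb)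
      also have "\<dots> \<le> K * (x * l + x * l)"
        using K n xl unfolding x_def l_def by (intro mult_left_mono add_mono mult_mono) auto
      finally show "\<bar>\<Sum>k=1..n. (mangoldt k - 1) * ln (real k) ^ 2\<bar> \<le> 2 * K * (real N * ln (real N))"
        by (simp add: x_def l_def algebra_simps)
    qed (use g N in auto)
    define H where "H = h 1"
    have hn: "0 \<le> h n" "h n \<le> H" "0 \<le> ln (real n)" "ln (real n) \<le> l" if "n \<in> {1..N}" for n
      using that dec[of n N] dec[of 1 n] hN N by (auto simp: H_def l_def)
    have H: "H \<ge> 0" using hn[of 1] N by (simp add: H_def)
    define P where "P = {p. prime p \<and> p \<le> N}"
    define Q where "Q = {n. n \<le> N \<and> primepow n \<and> \<not> prime n}"
    have P: "finite P" "P \<subseteq> {1..N}" unfolding P_def using prime_ge_1_nat by auto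
    have Q: "finite Q" "Q \<subseteq> {1..N}" unfolding Q_def using primepow_gt_0_nat by (auto simp: Suc_le_eq)
    have PQ: "P \<inter> Q = {}" by (auto simp: P_def Q_def)
    define t where "t n = mangoldt n * ln (real n) ^ 2 * h n" for n
    have t: "t n \<ge> 0" if "n \<in> {1..N}" for n using hn[OF that] by (simp add: t_def mangoldt_nonneg)
    have sumt: "(\<Sum>n=1..N. t n) = (\<Sum>n\<in>P. t n) + (\<Sum>n\<in>Q. t n)"
    proof -
      have "(\<Sum>n=1..N. t n) = (\<Sum>n\<in>P\<union>Q. t n)"
      proof (rule sum.mono_neutral_right)
        show "\<forall>i\<in>{1..N} - (P \<union> Q). t i = 0"
          by (auto simp: P_def Q_def t_def mangoldt_def)
      qed (use P Q in auto)
      also have "\<dots> = (\<Sum>n\<in>P. t n) + (\<Sum>n\<in>Q. t n)" using P Q PQ by (intro sum.union_disjoint) auto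
      finally show ?thesis .
    qed
    have q: "0 \<le> (\<Sum>n\<in>Q. t n)" "(\<Sum>n\<in>Q. t n) \<le> 432 * (H * x * l)"
    proof -
      show "0 \<le> (\<Sum>n\<in>Q. t n)" using Q t by (intro sum_nonneg) auto
      have "(\<Sum>n\<in>Q. t n) \<le> (\<Sum>n\<in>Q. l * l\<^sup>2 * H)"
      proof (rule sum_mono)
        fix n assume "n \<in> Q"
        then have n: "n \<in> {1..N}" using Q by auto
        have "mangoldt n \<le> l" using mangoldt_le[of n] hn[OF n] n by simp
        then show "t n \<le> l * l\<^sup>2 * H" unfolding t_def using hn[OF n] l23
          by (intro mult_mono power_mono) (auto simp: mangoldt_nonneg)
      qed
      also have "\<dots> = real (card Q) * (l^3 * H)" by (simp add: power3_eq_cube power2_eq_square)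
      \<comment> \<open>From \<open>l \<le> 6 * x powr (1/6)\<close> one gets
        \<open>l^3 \<le> 216 * sqrt x\<close>; the two square roots make up
        \<open>x\<close>.\<close>
      also have "\<dots> \<le> (sqrt x * (2 * l)) * ((216 * sqrt x) * H)"
      proof (intro mult_mono)
        show "real (card Q) \<le> sqrt x * (2 * l)" unfolding Q_def x_def l_def by (rule card_primepow_not_prime_le[OF N])
        have "l \<le> x powr (1/6) / (1/6)" unfolding l_def x_def using N by (intro ln_powr_bound) auto
        then have "l^3 \<le> (6 * x powr (1/6))^3" using l23 by (intro power_mono) auto
        also have "\<dots> = 216 * sqrt x" using x2 by (simp add: power_mult_distrib powr_power powr_half_sqrt)
        finally show "l^3 \<le> 216 * sqrt x" .
      qed (use H l23 x2 in auto)
      also have "\<dots> = 432 * (H * (sqrt x * sqrt x) * l)" by simp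
      also have "\<dots> = 432 * (H * x * l)" using x2 by simp
      finally show "(\<Sum>n\<in>Q. t n) \<le> 432 * (H * x * l)" .
    qed
    have a: "\<bar>(\<Sum>n=1..N. t n) - (\<Sum>n=1..N. ln (real n) ^ 2 * h n)\<bar> \<le> 2 * K * (H * x * l)"
    proof -
      have "(\<Sum>n=1..N. t n) - (\<Sum>n=1..N. ln (real n) ^ 2 * h n) = (\<Sum>n=1..N. (mangoldt n - 1) * ln (real n) ^ 2 * h n)"
        unfolding sum_subtractf[symmetric] by (intro sum.cong) (auto simp: t_def algebra_simps)
      then show ?thesis using ab[of h] dec hN by (simp add: H_def x_def l_def mult_ac)
    qed
    have b: "(\<Sum>n=1..N. ln (real n) ^ 2 * h n) \<le> l\<^sup>2 * (\<Sum>n=1..N. h n)"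
      "l\<^sup>2 * (\<Sum>n=1..N. h n) - (\<Sum>n=1..N. ln (real n) ^ 2 * h n) \<le> 2 * (H * x * l)"
    proof -
      show "(\<Sum>n=1..N. ln (real n) ^ 2 * h n) \<le> l\<^sup>2 * (\<Sum>n=1..N. h n)"
        unfolding sum_distrib_left using hn by (intro sum_mono mult_right_mono power_mono) auto
      have "l\<^sup>2 * (\<Sum>n=1..N. h n) - (\<Sum>n=1..N. ln (real n) ^ 2 * h n) = (\<Sum>n=1..N. (l\<^sup>2 - ln (real n) ^ 2) * h n)"
        by (simp add: sum_distrib_left sum_subtractf left_diff_distrib)
      also have "\<dots> \<le> (\<Sum>n=1..N. (2 * l * (l - ln (real n))) * H)"
      proof (intro sum_mono mult_mono)
        fix n assume n: "n \<in> {1..N}"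
        have "l\<^sup>2 - ln (real n) ^ 2 = (l + ln (real n)) * (l - ln (real n))" by (simp add: power2_eq_square algebra_simps)
        also have "\<dots> \<le> (2 * l) * (l - ln (real n))" using hn[OF n] by (intro mult_right_mono) auto
        finally show "l\<^sup>2 - ln (real n) ^ 2 \<le> 2 * l * (l - ln (real n))" .
      qed (use hn l23 in auto)
      also have "\<dots> = 2 * l * H * (x * l - (\<Sum>n=1..N. ln (real n)))"
        by (simp add: sum_distrib_left[symmetric] sum_distrib_right[symmetric] sum_subtractf x_def mult_ac)
      also have "\<dots> \<le> 2 * l * H * x"
        using sum_ln_ge[of N] N l23 H unfolding x_def l_def by (intro mult_left_mono) auto
      finally show "l\<^sup>2 * (\<Sum>n=1..N. h n) - (\<Sum>n=1..N. ln (real n) ^ 2 * h n) \<le> 2 * (H * x * l)" by (simp add: mult_ac)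
    qed
    have c: "0 \<le> l^3 * (\<Sum>p\<in>P. h p) - (\<Sum>p\<in>P. t p)"
      "l^3 * (\<Sum>p\<in>P. h p) - (\<Sum>p\<in>P. t p) \<le> 3 * (24 + 16 * K) * (H * x * l)"
    proof -
      have tp: "t p = ln (real p) ^ 3 * h p" if "p \<in> P" for p
        using that by (simp add: P_def t_def power3_eq_cube power2_eq_square)
      have e: "l^3 * (\<Sum>p\<in>P. h p) - (\<Sum>p\<in>P. t p) = (\<Sum>p\<in>P. (l^3 - ln (real p) ^ 3) * h p)"
        unfolding sum_distrib_left sum_subtractf[symmetric] by (intro sum.cong) (auto simp: tp left_diff_distrib)
      have d: "0 \<le> l^3 - ln (real p) ^ 3" "l^3 - ln (real p) ^ 3 \<le> 3 * l\<^sup>2 * (l - ln (real p))" if p: "p \<in> P" for p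
      proof -
        define k where "k = ln (real p)"
        have k: "0 \<le> k" "k \<le> l" using hn[of p] p P by (auto simp: k_def)
        show "0 \<le> l^3 - ln (real p) ^ 3" using k power_mono[of k l 3] by (simp add: k_def)
        have "l^3 - k^3 = (l\<^sup>2 + l * k + k\<^sup>2) * (l - k)" by (simp add: power3_eq_cube power2_eq_square algebra_simps)
        also have "\<dots> \<le> (3 * l\<^sup>2) * (l - k)"
        proof (rule mult_right_mono)
          have "l * k \<le> l\<^sup>2" "k\<^sup>2 \<le> l\<^sup>2" using k l23 by (auto simp: power2_eq_square intro!: mult_mono)
          then show "l\<^sup>2 + l * k + k\<^sup>2 \<le> 3 * l\<^sup>2" by simp
        qed (use k in simp)
        finally show "l^3 - ln (real p) ^ 3 \<le> 3 * l\<^sup>2 * (l - ln (real p))" by (simp add: k_def)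
      qed
      show "0 \<le> l^3 * (\<Sum>p\<in>P. h p) - (\<Sum>p\<in>P. t p)"
        unfolding e using d hn P by (intro sum_nonneg mult_nonneg_nonneg) auto
      have "(\<Sum>p\<in>P. (l^3 - ln (real p) ^ 3) * h p) \<le> (\<Sum>p\<in>P. (3 * l\<^sup>2 * (l - ln (real p))) * H)"
        using d hn P l23 by (intro sum_mono mult_mono) auto
      also have "\<dots> = 3 * l\<^sup>2 * H * (\<Sum>p\<in>P. l - ln (real p))"
        unfolding sum_distrib_left by (intro sum.cong) (auto simp: mult_ac)
      also have "\<dots> \<le> 3 * l\<^sup>2 * H * ((24 + 16 * K) * x / l)"
        using prime_sum_ln_quotient_bound[OF K N ab] H by (intro mult_left_mono) (auto simp: P_def l_def x_def)
      also have "\<dots> = 3 * (24 + 16 * K) * (H * x * l)" using l23 by (simp add: field_simps power2_eq_square)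
      finally show "l^3 * (\<Sum>p\<in>P. h p) - (\<Sum>p\<in>P. t p) \<le> 3 * (24 + 16 * K) * (H * x * l)" unfolding e .
    qed
    define C where "C = 3 * (24 + 16 * K) + 432 + 2 * K + 2"
    have "\<bar>l^3 * (\<Sum>p\<in>P. h p) - l\<^sup>2 * (\<Sum>n=1..N. h n)\<bar> \<le> C * (H * x * l)"
    proof -
      have "H * x * l \<ge> 0" using H x2 l23 by simp
      moreover have "K * (H * x * l) \<ge> 0" using H x2 l23 K by simp
      ultimately show ?thesis using a b c q sumt unfolding C_def ring_distribs abs_le_iff by linarith
    qed
    also have "l^3 * (\<Sum>p\<in>P. h p) - l\<^sup>2 * (\<Sum>n=1..N. h n) = l\<^sup>2 * (l * (\<Sum>p\<in>P. h p) - (\<Sum>n=1..N. h n))"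
      by (simp add: power3_eq_cube power2_eq_square algebra_simps)
    finally have "l\<^sup>2 * \<bar>l * (\<Sum>p\<in>P. h p) - (\<Sum>n=1..N. h n)\<bar> \<le> l\<^sup>2 * (C * H * (x / l))"
      using l23 by (simp add: abs_mult power2_eq_square)
    then have "\<bar>l * (\<Sum>p\<in>P. h p) - (\<Sum>n=1..N. h n)\<bar> \<le> C * H * (x / l)"
      using l23 by (subst (asm) mult_le_cancel_left_pos) auto
    then show "\<bar>ln (real N) * (\<Sum>p | prime p \<and> p \<le> N. h p) - (\<Sum>n=1..N. h n)\<bar> \<le> (3 * (24 + 16 * K) + 432 + 2 * K + 2) * h 1 * (real N / ln (real N))"
      by (simp only: P_def l_def x_def C_def H_def)
  qed (use K in auto)
qed

section \<open>Sums over primitive lattice vectors\<close>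

definition lattice_box :: "nat \<Rightarrow> (int \<times> int) set" where
  "lattice_box R = {- int R..int R} \<times> {- int R..int R}"

text \<open>At the origin the value is \<open>1 / 0 = 0\<close>, so the origin need not be removed from lattice sums.\<close>

definition inv_norm :: "int \<times> int \<Rightarrow> real" where
  "inv_norm w = 1 / (of_int (fst w) ^ 2 + of_int (snd w) ^ 2)"

definition primitive :: "int \<times> int \<Rightarrow> bool" where
  "primitive w \<longleftrightarrow> coprime (fst w) (snd w)"

lemma inv_norm_nonneg: "inv_norm w \<ge> 0"
  by (simp add: inv_norm_def)

lemma finite_lattice_box [simp]: "finite (lattice_box R)"
  by (simp add: lattice_box_def)

lemma card_lattice_box: "card (lattice_box R) = (2 * R + 1)\<^sup>2"
proof -
  have "card {- int R..int R} = 2 * R + 1" by simp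
  then show ?thesis by (simp only: lattice_box_def card_cartesian_product power2_eq_square)
qed

lemma sum_abs_symmetric:
  fixes f :: "nat \<Rightarrow> real"
  shows "(\<Sum>i\<in>{- int R..int R}. f (nat \<bar>i\<bar>)) = f 0 + 2 * (\<Sum>i=1..R. f i)"
proof (induction R)
  case (Suc R)
  have "{- int (Suc R)..int (Suc R)} = insert (- int (Suc R)) (insert (int (Suc R)) {- int R..int R})"
    by auto
  then show ?case using Suc by (simp add: nat_add_distrib)
qed simp

lemma sum_inverse_squares_le: "(\<Sum>i=1..R. 1 / (real i)\<^sup>2) \<le> 2"
proof -
  have "(\<Sum>i=1..R. 1 / (real i)\<^sup>2) \<le> 2 - 1 / real R" if "R \<ge> 1" using that
  proof (induction R rule: nat_induct_at_least)
    case (Suc R)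
    have "1 / (real (Suc R))\<^sup>2 \<le> 1 / (real R * real (Suc R))"
      using Suc by (intro divide_left_mono) (auto simp: power2_eq_square)
    also have "\<dots> = 1 / real R - 1 / real (Suc R)" using Suc by (simp add: field_simps)
    finally show ?case using Suc by simp
  qed simp
  then show ?thesis by (cases "R \<ge> 1") (auto intro: order_trans)
qed

lemma sum_inverse_bounds:
  assumes "R \<ge> 1"
  shows "ln (real R) \<le> (\<Sum>i=1..R. 1 / real i)" "(\<Sum>i=1..R. 1 / real i) \<le> 1 + ln (real R)"
proof -
  have "ln (real (Suc R)) \<le> (\<Sum>i=1..R. 1 / real i)" using assms
  proof (induction R rule: nat_induct_at_least)
    case base
    show ?case using ln_add_one_self_le_self[of 1] by simp
  next
    case (Suc R)
    then show ?case using ln_Suc_diff_bounds(2)[of "Suc R"] by simp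
  qed
  moreover have "ln (real R) \<le> ln (real (Suc R))" using assms by simp
  ultimately show "ln (real R) \<le> (\<Sum>i=1..R. 1 / real i)" by linarith
  show "(\<Sum>i=1..R. 1 / real i) \<le> 1 + ln (real R)" using assms
  proof (induction R rule: nat_induct_at_least)
    case (Suc R)
    then show ?case using ln_Suc_diff_bounds(1)[OF Suc(1)] by simp
  qed simp
qed

text \<open>Comparison with the integral of \<open>1 / (a^2 + t^2)\<close>, whose antiderivative is
  \<open>arctan (t / a) / a\<close>.\<close>

lemma row_sum_bounds:
  fixes a :: real
  assumes a: "a > 0"
  shows "(\<Sum>b=1..R. 1 / (a\<^sup>2 + (real b)\<^sup>2)) \<le> arctan (real R / a) / a"
    "arctan (real R / a) / a - 1 / a\<^sup>2 \<le> (\<Sum>b=1..R. 1 / (a\<^sup>2 + (real b)\<^sup>2))"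
proof -
  define \<phi> where "\<phi> t = arctan (t / a) / a" for t
  have \<phi>': "(\<phi> has_real_derivative 1 / (a\<^sup>2 + t\<^sup>2)) (at t)" for t
  proof -
    have "(\<phi> has_real_derivative (inverse (1 + (t / a)\<^sup>2) * (1 / a)) / a) (at t)"
      unfolding \<phi>_def using a by (auto intro!: derivative_eq_intros)
    also have "(inverse (1 + (t / a)\<^sup>2) * (1 / a)) / a = 1 / (a\<^sup>2 * (1 + (t / a)\<^sup>2))"
      by (simp add: inverse_eq_divide power2_eq_square)
    also have "a\<^sup>2 * (1 + (t / a)\<^sup>2) = a\<^sup>2 + t\<^sup>2" using a by (simp add: distrib_left power_divide)
    finally show ?thesis .
  qed
  have step: "1 / (a\<^sup>2 + (real (Suc b))\<^sup>2) \<le> \<phi> (real (Suc b)) - \<phi> (real b)"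
    "\<phi> (real (Suc b)) - \<phi> (real b) \<le> 1 / (a\<^sup>2 + (real b)\<^sup>2)" for b
  proof -
    obtain t where t: "real b < t" "t < real (Suc b)" "\<phi> (real (Suc b)) - \<phi> (real b) = (real (Suc b) - real b) * (1 / (a\<^sup>2 + t\<^sup>2))"
      using MVT2[of "real b" "real (Suc b)" \<phi> "\<lambda>t. 1 / (a\<^sup>2 + t\<^sup>2)"] \<phi>' by auto
    have "(real b)\<^sup>2 \<le> t\<^sup>2" "t\<^sup>2 \<le> (real (Suc b))\<^sup>2" using t by (auto intro!: power_mono)
    then show "1 / (a\<^sup>2 + (real (Suc b))\<^sup>2) \<le> \<phi> (real (Suc b)) - \<phi> (real b)"
      "\<phi> (real (Suc b)) - \<phi> (real b) \<le> 1 / (a\<^sup>2 + (real b)\<^sup>2)"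
      using t a by (auto intro!: divide_left_mono mult_pos_pos add_pos_nonneg)
  qed
  have \<phi>0: "\<phi> 0 = 0" by (simp add: \<phi>_def)
  have "(\<Sum>b=1..R. 1 / (a\<^sup>2 + (real b)\<^sup>2)) \<le> \<phi> (real R)"
  proof (induction R)
    case (Suc R) then show ?case using step(1)[of R] by simp
  qed (simp add: \<phi>0)
  then show "(\<Sum>b=1..R. 1 / (a\<^sup>2 + (real b)\<^sup>2)) \<le> arctan (real R / a) / a" by (simp add: \<phi>_def)
  have "\<phi> (real R) \<le> (\<Sum>b=1..R. 1 / (a\<^sup>2 + (real b)\<^sup>2)) + 1 / a\<^sup>2 - 1 / (a\<^sup>2 + (real R)\<^sup>2)"
  proof (induction R)
    case (Suc R) then show ?case using step(2)[of R] by simp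
  qed (simp add: \<phi>0)
  moreover have "1 / (a\<^sup>2 + (real R)\<^sup>2) \<ge> 0" by simp
  ultimately show "arctan (real R / a) / a - 1 / a\<^sup>2 \<le> (\<Sum>b=1..R. 1 / (a\<^sup>2 + (real b)\<^sup>2))"
    unfolding \<phi>_def by linarith
qed

text \<open>Apart from the axes, which contribute a bounded amount, there are four equal quadrants.
  A row at height \<open>a\<close> sums to \<open>pi / 2 / a\<close> up to
  \<open>1 / R + 1 / a^2\<close>, errors with a bounded sum over \<open>a \<le> R\<close>, and the
  harmonic sum produces the logarithm.\<close>

lemma lattice_sum_asymp:
  assumes R: "R \<ge> 1"
  shows "\<bar>(\<Sum>w\<in>lattice_box R. inv_norm w) - 2 * pi * ln (real R)\<bar> \<le> 40"
proof -
  define g where "g a b = 1 / ((real a)\<^sup>2 + (real b)\<^sup>2)" for a b :: nat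
  have "(\<Sum>w\<in>lattice_box R. inv_norm w) = (\<Sum>a\<in>{- int R..int R}. \<Sum>b\<in>{- int R..int R}. g (nat \<bar>a\<bar>) (nat \<bar>b\<bar>))"
    unfolding lattice_box_def sum.cartesian_product by (intro sum.cong) (auto simp: inv_norm_def g_def)
  also have "\<dots> = (\<Sum>a\<in>{- int R..int R}. g (nat \<bar>a\<bar>) 0 + 2 * (\<Sum>b=1..R. g (nat \<bar>a\<bar>) b))"
    by (intro sum.cong refl sum_abs_symmetric)
  also have "\<dots> = (g 0 0 + 2 * (\<Sum>b=1..R. g 0 b)) + 2 * (\<Sum>a=1..R. g a 0 + 2 * (\<Sum>b=1..R. g a b))"
    by (rule sum_abs_symmetric)
  also have "\<dots> = 4 * (\<Sum>b=1..R. 1 / (real b)\<^sup>2) + 4 * (\<Sum>a=1..R. \<Sum>b=1..R. g a b)"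
    by (simp add: g_def sum.distrib sum_distrib_left[symmetric])
  finally have eq: "(\<Sum>w\<in>lattice_box R. inv_norm w) = 4 * (\<Sum>b=1..R. 1 / (real b)\<^sup>2) + 4 * (\<Sum>a=1..R. \<Sum>b=1..R. g a b)" .
  have row: "(\<Sum>b=1..R. g a b) \<le> pi / 2 * (1 / real a)" "pi / 2 * (1 / real a) - 1 / real R - 1 / (real a)\<^sup>2 \<le> (\<Sum>b=1..R. g a b)"
    if a: "a \<in> {1..R}" for a
  proof -
    have a0: "real a > 0" using a by simp
    have "arctan (real R / real a) \<le> pi / 2" using arctan_ubound[of "real R / real a"] by simp
    then have "arctan (real R / real a) / real a \<le> (pi / 2) / real a" using a0 by (intro divide_right_mono) auto
    also have "\<dots> = pi / 2 * (1 / real a)" by simp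
    finally have "arctan (real R / real a) / real a \<le> pi / 2 * (1 / real a)" .
    with row_sum_bounds(1)[OF a0, of R] show "(\<Sum>b=1..R. g a b) \<le> pi / 2 * (1 / real a)" by (simp add: g_def)
    have "arctan (real R / real a) = pi / 2 - arctan (real a / real R)"
      using arctan_inverse[of "real a / real R"] a by (simp add: sgn_if)
    moreover have "arctan (real a / real R) \<le> real a / real R" by (rule arctan_le_self) simp
    ultimately have "pi / 2 - real a / real R \<le> arctan (real R / real a)" by simp
    then have "(pi / 2 - real a / real R) / real a \<le> arctan (real R / real a) / real a" using a0 by (intro divide_right_mono) auto
    then have "pi / 2 * (1 / real a) - 1 / real R \<le> arctan (real R / real a) / real a" using a0 by (simp add: diff_divide_distrib)
    with row_sum_bounds(2)[OF a0, of R] show "pi / 2 * (1 / real a) - 1 / real R - 1 / (real a)\<^sup>2 \<le> (\<Sum>b=1..R. g a b)" by (simp add: g_def)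
  qed
  define S where "S = (\<Sum>a=1..R. \<Sum>b=1..R. g a b)"
  define Hn where "Hn = (\<Sum>i=1..R. 1 / real i)"
  have up: "S \<le> pi / 2 * Hn" unfolding S_def Hn_def sum_distrib_left by (intro sum_mono row)
  have "(\<Sum>a=1..R. pi / 2 * (1 / real a) - 1 / real R - 1 / (real a)\<^sup>2) \<le> S" unfolding S_def by (intro sum_mono row)
  also have "(\<Sum>a=1..R. pi / 2 * (1 / real a) - 1 / real R - 1 / (real a)\<^sup>2) = pi / 2 * Hn - 1 - (\<Sum>a=1..R. 1 / (real a)\<^sup>2)"
    using R by (simp add: sum_subtractf Hn_def sum_distrib_left)
  finally have lo: "pi / 2 * Hn - 1 - (\<Sum>a=1..R. 1 / (real a)\<^sup>2) \<le> S" .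
  have q: "0 \<le> (\<Sum>a=1..R. 1 / (real a)\<^sup>2)" "(\<Sum>a=1..R. 1 / (real a)\<^sup>2) \<le> 2"
    using sum_inverse_squares_le[of R] by (auto intro!: sum_nonneg)
  have "pi / 2 * ln (real R) \<le> pi / 2 * Hn" "pi / 2 * Hn \<le> pi / 2 * (1 + ln (real R))"
    using sum_inverse_bounds[OF R] by (auto simp: Hn_def intro!: mult_left_mono)
  then have "pi / 2 * ln (real R) \<le> pi / 2 * Hn" "pi / 2 * Hn \<le> pi / 2 * ln (real R) + 2"
    using pi_less_4 by (auto simp: algebra_simps)
  moreover have "2 * pi * ln (real R) = 4 * (pi / 2 * ln (real R))" by simp
  ultimately show ?thesis unfolding eq S_def[symmetric] abs_le_iff using up lo q by linarith
qed

section \<open>Passage from all lattice vectors to the primitive ones\<close>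

definition prim_sum :: "nat \<Rightarrow> real" where
  "prim_sum R = (\<Sum>w | w \<in> lattice_box R \<and> primitive w. inv_norm w)"

lemma prim_sum_nonneg: "prim_sum R \<ge> 0"
  unfolding prim_sum_def by (intro sum_nonneg inv_norm_nonneg)

text \<open>The shell between consecutive squares has \<open>8 * (R + 1)\<close> points, each of
  squared norm at least \<open>(R + 1)^2\<close>.\<close>

lemma prim_sum_Suc_le: "prim_sum (Suc R) - prim_sum R \<le> 8 / real (Suc R)" "prim_sum R \<le> prim_sum (Suc R)"
proof -
  define A where "A = {w \<in> lattice_box R. primitive w}"
  define B where "B = {w \<in> lattice_box (Suc R). primitive w}"
  have sub: "lattice_box R \<subseteq> lattice_box (Suc R)" by (auto simp: lattice_box_def)
  have AB: "A \<subseteq> B" "finite B" using sub by (auto simp: A_def B_def)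
  have "prim_sum (Suc R) = sum inv_norm A + sum inv_norm (B - A)"
    unfolding prim_sum_def B_def[symmetric] using AB by (metis add.commute sum.subset_diff)
  then have d: "prim_sum (Suc R) - prim_sum R = sum inv_norm (B - A)" by (simp add: prim_sum_def A_def)
  show "prim_sum R \<le> prim_sum (Suc R)" using d sum_nonneg[of "B - A" inv_norm] inv_norm_nonneg by simp
  have "sum inv_norm (B - A) \<le> sum inv_norm (lattice_box (Suc R) - lattice_box R)"
    by (rule sum_mono2) (auto simp: A_def B_def inv_norm_nonneg)
  also have "\<dots> \<le> (\<Sum>w\<in>lattice_box (Suc R) - lattice_box R. 1 / (real (Suc R))\<^sup>2)"
  proof (rule sum_mono)
    fix w assume w: "w \<in> lattice_box (Suc R) - lattice_box R"
    obtain a b where ab: "w = (a, b)" by fastforce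
    have "int (Suc R) \<le> \<bar>a\<bar> \<or> int (Suc R) \<le> \<bar>b\<bar>" using w unfolding ab lattice_box_def by auto
    then have "real (Suc R) \<le> \<bar>of_int a\<bar> \<or> real (Suc R) \<le> \<bar>of_int b\<bar>" by linarith
    then have "(real (Suc R))\<^sup>2 \<le> (of_int a)\<^sup>2 \<or> (real (Suc R))\<^sup>2 \<le> (of_int b)\<^sup>2"
      by (metis abs_of_nat abs_le_square_iff)
    then have "(real (Suc R))\<^sup>2 \<le> (of_int a)\<^sup>2 + (of_int b)\<^sup>2"
      by (smt (verit) zero_le_power2)
    then show "inv_norm w \<le> 1 / (real (Suc R))\<^sup>2" unfolding inv_norm_def ab
      by (intro divide_left_mono) (auto intro!: mult_pos_pos intro: less_le_trans[of 0 "(real (Suc R))\<^sup>2"])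
  qed
  also have "\<dots> = real (card (lattice_box (Suc R) - lattice_box R)) * (1 / (real (Suc R))\<^sup>2)" by simp
  also have "card (lattice_box (Suc R) - lattice_box R) = 8 * Suc R"
    using sub by (subst card_Diff_subset) (auto simp: card_lattice_box power2_eq_square)
  also have "real (8 * Suc R) * (1 / (real (Suc R))\<^sup>2) = 8 / real (Suc R)"
  proof -
    have "(8 * r) * (1 / r\<^sup>2) = 8 / r" if "r > 0" for r :: real using that by (simp add: power2_eq_square)
    from this[of "real (Suc R)"] show ?thesis by (simp only: of_nat_mult of_nat_numeral of_nat_0_less_iff zero_less_Suc)
  qed
  finally show "prim_sum (Suc R) - prim_sum R \<le> 8 / real (Suc R)" using d by simp
qed

lemma prim_sum_mono: "k \<le> R \<Longrightarrow> prim_sum k \<le> prim_sum R"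
  by (rule lift_Suc_mono_le[of prim_sum]) (auto intro: prim_sum_Suc_le)

lemma prim_sum_diff_le:
  assumes k: "1 \<le> k" "k \<le> R"
  shows "prim_sum R - prim_sum k \<le> 8 * (ln (real R) - ln (real k))"
  using k(2)
proof (induction R rule: dec_induct)
  case (step M)
  have "1 / real (Suc M) \<le> ln (real (Suc M)) - ln (real M)" using step k by (intro ln_Suc_diff_bounds) auto
  then show ?case using step prim_sum_Suc_le(1)[of M] by simp
qed simp

lemma prim_sum_le: 
  assumes R: "R \<ge> 1"
  shows "prim_sum R \<le> 8 + 8 * ln (real R)"
proof -
  have "prim_sum 0 = 0" by (simp add: prim_sum_def lattice_box_def inv_norm_def)
  then have "prim_sum 1 \<le> 8" using prim_sum_Suc_le(1)[of 0] by simp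
  then show ?thesis using prim_sum_diff_le[of 1 R] R by simp
qed

text \<open>Nonzero vectors are sorted by the gcd \<open>g\<close> of their coordinates. Squares
  suit this better than discs: \<open>g * w\<close> lies in the box \<open>R\<close> exactly when
  \<open>w\<close> lies in the box \<open>R div g\<close>.\<close>

lemma lattice_sum_gcd: "(\<Sum>w\<in>lattice_box R. inv_norm w) = (\<Sum>g=1..R. prim_sum (R div g) / (real g)\<^sup>2)"
proof -
  have "(\<Sum>w\<in>lattice_box R. inv_norm w) = (\<Sum>w\<in>lattice_box R - {(0,0)}. inv_norm w)"
    by (rule sum.mono_neutral_right) (auto simp: inv_norm_def)
  also have "\<dots> = (\<Sum>(g,w)\<in>(SIGMA g:{1..R}. {w \<in> lattice_box (R div g). primitive w}). inv_norm w / (real g)\<^sup>2)"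
  proof (rule sum.reindex_bij_witness[where
      i = "\<lambda>(g,(a,b)). (int g * a, int g * b)" and
      j = "\<lambda>(a,b). (nat (gcd a b), (a div gcd a b, b div gcd a b))"])
    fix w assume w: "w \<in> lattice_box R - {(0,0)}"
    obtain a b where ab: "w = (a, b)" by fastforce
    define g where "g = gcd a b"
    have g: "g > 0" using w by (auto simp: g_def ab)
    define a' b' where "a' = a div g" and "b' = b div g"
    have a: "a = g * a'" "b = g * b'" by (auto simp: a'_def b'_def g_def)
    have cop: "coprime a' b'" unfolding a'_def b'_def g_def using w ab by (intro div_gcd_coprime) auto
    show "(case (case w of (a,b) \<Rightarrow> (nat (gcd a b), (a div gcd a b, b div gcd a b))) of (g,(a,b)) \<Rightarrow> (int g * a, int g * b)) = w"
      using g by (simp add: ab)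
    have bd: "\<bar>a\<bar> \<le> int R" "\<bar>b\<bar> \<le> int R" using w by (auto simp: lattice_box_def ab)
    have "\<bar>c\<bar> \<le> int R div g" if "g * \<bar>c\<bar> \<le> int R" for c
      using zdiv_mono1[OF that g] g by simp
    then have ab': "\<bar>a'\<bar> \<le> int R div g" "\<bar>b'\<bar> \<le> int R div g"
      using bd g unfolding a by (auto simp: abs_mult)
    have "a' \<noteq> 0 \<or> b' \<noteq> 0" using w a by (auto simp: ab)
    then have "g \<le> int R"
    proof
      assume "a' \<noteq> 0"
      then have "g * 1 \<le> g * \<bar>a'\<bar>" using g by (intro mult_left_mono) auto
      moreover have "\<bar>g * a'\<bar> = g * \<bar>a'\<bar>" using g by (simp add: abs_mult)
      ultimately show ?thesis using bd(1) unfolding a by linarith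
    next
      assume "b' \<noteq> 0"
      then have "g * 1 \<le> g * \<bar>b'\<bar>" using g by (intro mult_left_mono) auto
      moreover have "\<bar>g * b'\<bar> = g * \<bar>b'\<bar>" using g by (simp add: abs_mult)
      ultimately show ?thesis using bd(2) unfolding a by linarith
    qed
    then show "(case w of (a,b) \<Rightarrow> (nat (gcd a b), (a div gcd a b, b div gcd a b))) \<in> (SIGMA g:{1..R}. {w \<in> lattice_box (R div g). primitive w})"
      using g ab' cop by (auto simp: ab g_def[symmetric] a'_def[symmetric] b'_def[symmetric] lattice_box_def primitive_def zdiv_int abs_le_iff nat_le_iff)
    have "inv_norm (a', b') / (real (nat g))\<^sup>2 = inv_norm (a, b)"
      using g unfolding inv_norm_def a by (simp add: power_mult_distrib distrib_left[symmetric])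
    then show "(case (case w of (a,b) \<Rightarrow> (nat (gcd a b), (a div gcd a b, b div gcd a b))) of (g,w) \<Rightarrow> inv_norm w / (real g)\<^sup>2) = inv_norm w"
      by (simp add: ab g_def[symmetric] a'_def b'_def)
  next
    fix x assume x: "x \<in> (SIGMA g:{1..R}. {w \<in> lattice_box (R div g). primitive w})"
    obtain g a b where gab: "x = (g, (a, b))" by (metis prod.exhaust)
    have g: "g \<ge> 1" "g \<le> R" and cop: "coprime a b" and bd: "\<bar>a\<bar> \<le> int (R div g)" "\<bar>b\<bar> \<le> int (R div g)"
      using x by (auto simp: gab lattice_box_def primitive_def abs_le_iff)
    have gg: "gcd (int g * a) (int g * b) = int g" using cop gcd_mult_distrib_int[of "int g" a b] by simp
    show "(case (case x of (g,(a,b)) \<Rightarrow> (int g * a, int g * b)) of (a,b) \<Rightarrow> (nat (gcd a b), (a div gcd a b, b div gcd a b))) = x"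
      using g gg by (simp add: gab)
    have le: "int g * \<bar>c\<bar> \<le> int R" if "\<bar>c\<bar> \<le> int (R div g)" for c
    proof -
      have "int g * \<bar>c\<bar> \<le> int g * int (R div g)" using that by (intro mult_left_mono) auto
      also have "\<dots> \<le> int R" by (simp flip: of_nat_mult)
      finally show ?thesis .
    qed
    have "\<bar>int g * a\<bar> \<le> int R" "\<bar>int g * b\<bar> \<le> int R" using le bd by (auto simp: abs_mult)
    moreover have "(int g * a, int g * b) \<noteq> (0, 0)" using cop g by auto
    ultimately show "(case x of (g,(a,b)) \<Rightarrow> (int g * a, int g * b)) \<in> lattice_box R - {(0,0)}"
      by (auto simp: gab lattice_box_def abs_le_iff)
  qed
  also have "\<dots> = (\<Sum>g=1..R. \<Sum>w | w \<in> lattice_box (R div g) \<and> primitive w. inv_norm w / (real g)\<^sup>2)"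
    by (subst sum.Sigma) auto
  also have "\<dots> = (\<Sum>g=1..R. prim_sum (R div g) / (real g)\<^sup>2)"
    by (simp add: prim_sum_def sum_divide_distrib)
  finally show ?thesis .
qed

text \<open>The partial sums \<open>A n\<close> increase and \<open>A n + 1 / n\<close> decreases to
  the same limit.\<close>

lemma inverse_squares_tail:
  assumes R: "R \<ge> 1"
  shows "(\<Sum>g=1..R. 1 / (real g)\<^sup>2) \<le> pi\<^sup>2 / 6" "pi\<^sup>2 / 6 \<le> (\<Sum>g=1..R. 1 / (real g)\<^sup>2) + 1 / real R"
proof -
  define A where "A n = (\<Sum>g=1..n. 1 / (real g)\<^sup>2)" for n
  have A_eq: "A n = (\<Sum>k<n. 1 / (real (k + 1))\<^sup>2)" for n
    unfolding A_def by (rule sum.reindex_bij_witness[where i = "\<lambda>k. k + 1" and j = "\<lambda>g. g - 1"]) auto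
  have "A \<longlonglongrightarrow> pi\<^sup>2 / 6"
    using inverse_squares_sums unfolding sums_def A_eq by (simp add: add.commute)
  moreover have "incseq A" unfolding A_def by (rule incseq_SucI) simp
  ultimately show "(\<Sum>g=1..R. 1 / (real g)\<^sup>2) \<le> pi\<^sup>2 / 6" using incseq_le unfolding A_def by blast
  have dec: "decseq (\<lambda>n. A (Suc n) + 1 / real (Suc n))"
  proof (rule decseq_SucI)
    fix n
    have "1 / (real (Suc (Suc n)))\<^sup>2 \<le> 1 / (real (Suc n) * real (Suc (Suc n)))"
      by (intro divide_left_mono) (auto simp: power2_eq_square)
    also have "\<dots> = 1 / real (Suc n) - 1 / real (Suc (Suc n))" by (simp add: field_simps)
    finally show "A (Suc (Suc n)) + 1 / real (Suc (Suc n)) \<le> A (Suc n) + 1 / real (Suc n)"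
      by (simp add: A_def)
  qed
  have "(\<lambda>n. A (Suc n) + 1 / real (Suc n)) \<longlonglongrightarrow> pi\<^sup>2 / 6 + 0"
    by (intro tendsto_add LIMSEQ_Suc[OF \<open>A \<longlonglongrightarrow> pi\<^sup>2 / 6\<close>] LIMSEQ_Suc[OF lim_1_over_n])
  then have "(\<lambda>n. A (Suc n) + 1 / real (Suc n)) \<longlonglongrightarrow> pi\<^sup>2 / 6" by simp
  from decseq_ge[OF dec this, of "R - 1"]
  have "pi\<^sup>2 / 6 \<le> A (Suc (R - 1)) + 1 / real (Suc (R - 1))" .
  then show "pi\<^sup>2 / 6 \<le> (\<Sum>g=1..R. 1 / (real g)\<^sup>2) + 1 / real R" using R by (simp add: A_def)
qed

text \<open>Replaces Moebius inversion: \<open>prim_sum\<close> grows so slowly that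
  \<open>prim_sum (R div g)\<close> differs from \<open>prim_sum R\<close> by O(ln (2 g)), which is
  summable against \<open>1 / g^2\<close>. Hence the full lattice sum \<open>2 * pi * ln R\<close>
  is \<open>pi^2 / 6\<close> times \<open>prim_sum R\<close> up to O(1), and the quotient of the
  constants is \<open>12 / pi\<close>.\<close>

lemma prim_sum_asymp:
  obtains C where "\<And>R. R \<ge> 1 \<Longrightarrow> \<bar>prim_sum R - 12 / pi * ln (real R)\<bar> \<le> C"
proof -
  define K where "K = (\<Sum>n. real n powr (-3/2))"
  have sK: "summable (\<lambda>n. real n powr (-3/2))" by (simp add: summable_real_powr_iff)
  have "\<bar>prim_sum R - 12 / pi * ln (real R)\<bar> \<le> 40 + 32 * K + 16" if R: "R \<ge> 1" for R
  proof -
    define T where "T = prim_sum R"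
    define A where "A = (\<Sum>g=1..R. 1 / (real g)\<^sup>2)"
    define G where "G = (\<Sum>w\<in>lattice_box R. inv_norm w)"
    have T0: "T \<ge> 0" unfolding T_def by (rule prim_sum_nonneg)
    have d: "T * A - G = (\<Sum>g=1..R. (T - prim_sum (R div g)) * (1 / (real g)\<^sup>2))"
      unfolding G_def lattice_sum_gcd A_def sum_distrib_left sum_subtractf[symmetric]
      by (intro sum.cong) (auto simp: diff_divide_distrib)
    have d0: "T * A - G \<ge> 0" unfolding d by (intro sum_nonneg mult_nonneg_nonneg) (auto simp: T_def intro: prim_sum_mono)
    have "T * A - G \<le> (\<Sum>g=1..R. 32 * real g powr (-3/2))" unfolding d
    proof (rule sum_mono)
      fix g assume g: "g \<in> {1..R}"
      define k where "k = R div g"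
      have k1: "k \<ge> 1" using g by (simp add: k_def div_greater_zero_iff Suc_le_eq)
      have "R < g * (k + 1)" using g unfolding k_def by (simp add: dividend_less_times_div)
      also have "\<dots> \<le> g * (2 * k)" using k1 by (intro mult_left_mono) auto
      finally have "real R < real (g * (2 * k))" by (simp only: of_nat_less_iff)
      then have "real R \<le> (2 * real g) * real k" by (simp add: mult_ac)
      then have "ln (real R) \<le> ln ((2 * real g) * real k)" using R by (intro ln_mono) auto
      also have "\<dots> = ln (2 * real g) + ln (real k)" using g k1 by (subst ln_mult) auto
      finally have l: "ln (real R) - ln (real k) \<le> ln (2 * real g)" by simp
      have "ln (2 * real g) \<le> (2 * real g) powr (1/2) / (1/2)" using g by (intro ln_powr_bound) auto
      also have "\<dots> = 2 * (2 powr (1/2) * real g powr (1/2))" by (simp add: powr_mult)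
      also have "2 powr (1/2) \<le> (2::real) powr 1" by (intro powr_mono) auto
      finally have l2: "ln (2 * real g) \<le> 4 * real g powr (1/2)" by (simp add: mult_right_mono)
      have "T - prim_sum k \<le> 8 * (ln (real R) - ln (real k))"
        unfolding T_def using k1 by (intro prim_sum_diff_le) (auto simp: k_def)
      also have "\<dots> \<le> 32 * real g powr (1/2)" using l l2 by simp
      finally have "(T - prim_sum k) * (1 / (real g)\<^sup>2) \<le> (32 * real g powr (1/2)) * (1 / (real g)\<^sup>2)"
        by (intro mult_right_mono) auto
      also have "\<dots> = 32 * (real g powr (1/2) / real g powr 2)" using g by simp
      also have "real g powr (1/2) / real g powr 2 = real g powr (-3/2)" by (subst powr_diff[symmetric]) simp
      finally show "(T - prim_sum (R div g)) * (1 / (real g)\<^sup>2) \<le> 32 * real g powr (-3/2)" by (simp add: k_def)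
    qed
    also have "\<dots> = 32 * (\<Sum>g=1..R. real g powr (-3/2))" by (simp add: sum_distrib_left)
    also have "(\<Sum>g=1..R. real g powr (-3/2)) \<le> K"
      unfolding K_def by (intro sum_le_suminf sK) auto
    finally have d1: "T * A - G \<le> 32 * K" by simp
    have A: "A \<le> pi\<^sup>2 / 6" "pi\<^sup>2 / 6 \<le> A + 1 / real R"
      using inverse_squares_tail[OF R] by (auto simp: A_def)
    have "T * (pi\<^sup>2 / 6 - A) \<le> T * (1 / real R)" using A T0 by (intro mult_left_mono) auto
    also have "\<dots> \<le> (8 + 8 * ln (real R)) * (1 / real R)"
      unfolding T_def by (intro mult_right_mono prim_sum_le R) auto
    also have "\<dots> \<le> 16"
    proof -
      have "ln (real R) \<le> real R - 1" using R by (intro ln_le_minus_one) auto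
      then show ?thesis using R by (simp add: field_simps)
    qed
    finally have t: "T * (pi\<^sup>2 / 6 - A) \<le> 16" .
    have t0: "T * (pi\<^sup>2 / 6 - A) \<ge> 0" using T0 A by simp
    have G: "\<bar>G - 2 * pi * ln (real R)\<bar> \<le> 40" unfolding G_def by (rule lattice_sum_asymp[OF R])
    have K0: "K \<ge> 0" unfolding K_def by (intro suminf_nonneg sK) auto
    have "T * (pi\<^sup>2 / 6) = G + (T * A - G) + T * (pi\<^sup>2 / 6 - A)" by (simp add: algebra_simps)
    then have tot: "\<bar>T * (pi\<^sup>2 / 6) - 2 * pi * ln (real R)\<bar> \<le> 40 + 32 * K + 16"
      using G d0 d1 t t0 K0 by linarith
    have "T * (pi\<^sup>2 / 6) - 2 * pi * ln (real R) = (pi\<^sup>2 / 6) * (T - 12 / pi * ln (real R))"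
      by (simp add: field_simps power2_eq_square)
    then have "(pi\<^sup>2 / 6) * \<bar>T - 12 / pi * ln (real R)\<bar> \<le> 40 + 32 * K + 16" using tot by (simp add: abs_mult)
    moreover have "1 * \<bar>T - 12 / pi * ln (real R)\<bar> \<le> (pi\<^sup>2 / 6) * \<bar>T - 12 / pi * ln (real R)\<bar>"
    proof (rule mult_right_mono)
      have "3 * 3 \<le> pi * pi" using pi_gt3 by (intro mult_mono) auto
      then show "1 \<le> pi\<^sup>2 / 6" by (simp add: power2_eq_square)
    qed simp
    ultimately show ?thesis by (simp add: T_def)
  qed
  then show ?thesis using that by blast
qed

section \<open>From squares to discs, and to vectors of odd norm\<close>

definition prim_disc :: "nat \<Rightarrow> (int \<times> int) set" where
  "prim_disc Y = {w. primitive w \<and> (fst w)\<^sup>2 + (snd w)\<^sup>2 \<le> int Y}"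

definition odd_norm :: "int \<times> int \<Rightarrow> bool" where
  "odd_norm w \<longleftrightarrow> odd ((fst w)\<^sup>2 + (snd w)\<^sup>2)"

definition disc_sum :: "nat \<Rightarrow> real" where
  "disc_sum Y = (\<Sum>w\<in>prim_disc Y. inv_norm w)"

definition odd_disc_sum :: "nat \<Rightarrow> real" where
  "odd_disc_sum Y = (\<Sum>w | w \<in> prim_disc Y \<and> odd_norm w. inv_norm w)"

lemma abs_le_floor_sqrt:
  fixes a :: int
  assumes "a\<^sup>2 \<le> int Y"
  shows "\<bar>a\<bar> \<le> int (nat \<lfloor>sqrt (real Y)\<rfloor>)"
proof -
  have "(real_of_int \<bar>a\<bar>)\<^sup>2 \<le> real Y" using assms by (simp flip: of_int_power)
  then have "real_of_int \<bar>a\<bar> \<le> sqrt (real Y)" by (rule real_le_rsqrt)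
  then show ?thesis by (simp add: le_floor_iff)
qed

lemma prim_disc_subset: "prim_disc Y \<subseteq> {w \<in> lattice_box (nat \<lfloor>sqrt (real Y)\<rfloor>). primitive w}"
proof
  fix w assume w: "w \<in> prim_disc Y"
  obtain a b where ab: "w = (a, b)" by fastforce
  have "a\<^sup>2 + b\<^sup>2 \<le> int Y" using w by (simp add: prim_disc_def ab)
  then have "a\<^sup>2 \<le> int Y" "b\<^sup>2 \<le> int Y" using zero_le_power2[of a] zero_le_power2[of b] by linarith+
  then show "w \<in> {w \<in> lattice_box (nat \<lfloor>sqrt (real Y)\<rfloor>). primitive w}"
    using abs_le_floor_sqrt w by (simp add: lattice_box_def ab prim_disc_def abs_le_iff) force
qed

lemma finite_prim_disc [simp]: "finite (prim_disc Y)"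
  by (rule finite_subset[OF prim_disc_subset]) auto

lemma floor_sqrt_bounds:
  assumes "Y \<ge> 1"
  defines "R \<equiv> nat \<lfloor>sqrt (real Y)\<rfloor>"
  shows "R \<ge> 1" "real R \<le> sqrt (real Y)" "sqrt (real Y) \<le> 2 * real R" "real (card (lattice_box R)) \<le> 9 * real Y"
proof -
  have s: "sqrt (real Y) \<ge> 1" using assms by simp
  have e: "real R = of_int \<lfloor>sqrt (real Y)\<rfloor>" unfolding R_def by simp
  have "of_int \<lfloor>sqrt (real Y)\<rfloor> \<ge> (1::real)" using s by simp
  with e have "real R \<ge> 1" by simp
  then show R: "R \<ge> 1" "real R \<le> sqrt (real Y)" "sqrt (real Y) \<le> 2 * real R" using e by linarith+
  have "real (card (lattice_box R)) = (2 * real R + 1)\<^sup>2" by (simp add: card_lattice_box)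
  also have "\<dots> \<le> (3 * sqrt (real Y))\<^sup>2" using R s by (intro power_mono) linarith+
  also have "\<dots> = 9 * real Y" by (simp add: power_mult_distrib)
  finally show "real (card (lattice_box R)) \<le> 9 * real Y" .
qed

lemma card_prim_disc_le: "real (card (prim_disc Y)) \<le> 9 * real Y"
proof (cases "Y \<ge> 1")
  case True
  have "card (prim_disc Y) \<le> card (lattice_box (nat \<lfloor>sqrt (real Y)\<rfloor>))"
    using prim_disc_subset by (intro card_mono) auto
  then show ?thesis using floor_sqrt_bounds(4)[OF True] by linarith
next
  case False
  then have "Y = 0" by simp
  then have "prim_disc Y = {}" by (auto simp: prim_disc_def primitive_def sum_power2_le_zero_iff)
  then show ?thesis using False by simp
qed

text \<open>The points of the square outside the disc number at most \<open>9 * Y\<close>, and each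
  contributes at most \<open>1 / Y\<close>.\<close>

lemma disc_sum_bounds:
  assumes Y: "Y \<ge> 1"
  defines "R \<equiv> nat \<lfloor>sqrt (real Y)\<rfloor>"
  shows "disc_sum Y \<le> prim_sum R" "prim_sum R - 9 \<le> disc_sum Y"
proof -
  define B where "B = {w \<in> lattice_box R. primitive w}"
  have sub: "prim_disc Y \<subseteq> B" unfolding B_def R_def by (rule prim_disc_subset)
  have fB: "finite B" by (simp add: B_def)
  have "prim_sum R = disc_sum Y + sum inv_norm (B - prim_disc Y)"
    unfolding prim_sum_def B_def[symmetric] disc_sum_def using sub fB by (metis add.commute sum.subset_diff)
  moreover have "sum inv_norm (B - prim_disc Y) \<ge> 0" by (intro sum_nonneg inv_norm_nonneg)
  moreover have "sum inv_norm (B - prim_disc Y) \<le> 9"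
  proof -
    have "sum inv_norm (B - prim_disc Y) \<le> (\<Sum>w\<in>B - prim_disc Y. 1 / real Y)"
    proof (rule sum_mono)
      fix w assume w: "w \<in> B - prim_disc Y"
      then have "int Y < (fst w)\<^sup>2 + (snd w)\<^sup>2" by (auto simp: B_def prim_disc_def)
      then have "real_of_int (int Y) \<le> real_of_int ((fst w)\<^sup>2 + (snd w)\<^sup>2)" by (simp only: of_int_le_iff less_imp_le)
      then have "real Y \<le> of_int ((fst w)\<^sup>2 + (snd w)\<^sup>2)" by simp
      then show "inv_norm w \<le> 1 / real Y" unfolding inv_norm_def using Y
        by (intro divide_left_mono) (auto intro!: mult_pos_pos intro: less_le_trans[of 0 "real Y"])
    qed
    also have "\<dots> = real (card (B - prim_disc Y)) / real Y" by simp
    also have "\<dots> \<le> 9"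
    proof -
      have "card (B - prim_disc Y) \<le> card (lattice_box R)" by (intro card_mono) (auto simp: B_def)
      then show ?thesis using floor_sqrt_bounds(4)[OF Y] Y unfolding R_def by (simp add: field_simps)
    qed
    finally show ?thesis .
  qed
  ultimately show "disc_sum Y \<le> prim_sum R" "prim_sum R - 9 \<le> disc_sum Y" by linarith+
qed

lemma disc_sum_le:
  assumes "Y \<ge> 1"
  shows "disc_sum Y \<le> 8 + 8 * ln (real Y)"
proof -
  note b = floor_sqrt_bounds[OF assms]
  have "real (nat \<lfloor>sqrt (real Y)\<rfloor>) \<le> real Y"
  proof -
    have "sqrt (real Y) * 1 \<le> sqrt (real Y) * sqrt (real Y)" using assms by (intro mult_left_mono) auto
    then have "sqrt (real Y) \<le> real Y" by simp
    then show ?thesis using b(2) by linarith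
  qed
  then have "ln (real (nat \<lfloor>sqrt (real Y)\<rfloor>)) \<le> ln (real Y)" using b(1) by (intro ln_mono) auto
  then show ?thesis using disc_sum_bounds(1)[OF assms] prim_sum_le[OF b(1)] by linarith
qed

lemma disc_sum_asymp:
  obtains C where "\<And>Y. Y \<ge> 1 \<Longrightarrow> \<bar>disc_sum Y - 6 / pi * ln (real Y)\<bar> \<le> C"
proof -
  obtain C where C: "\<And>R. R \<ge> 1 \<Longrightarrow> \<bar>prim_sum R - 12 / pi * ln (real R)\<bar> \<le> C" using prim_sum_asymp by blast
  have "\<bar>disc_sum Y - 6 / pi * ln (real Y)\<bar> \<le> C + 13" if Y: "Y \<ge> 1" for Y
  proof -
    define R where "R = nat \<lfloor>sqrt (real Y)\<rfloor>"
    note b = floor_sqrt_bounds[OF Y, folded R_def]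
    have "ln (real R) \<le> ln (sqrt (real Y))" using b by (intro ln_mono) auto
    moreover have "ln (sqrt (real Y)) \<le> ln (2 * real R)" using b Y by (intro ln_mono) auto
    moreover have "ln (2 * real R) = ln 2 + ln (real R)" using b by (simp add: ln_mult)
    moreover have "ln (2::real) \<le> 1" using ln_le_minus_one[of 2] by simp
    ultimately have l: "ln (real R) \<le> ln (real Y) / 2" "ln (real Y) / 2 \<le> 1 + ln (real R)" using Y by (auto simp: ln_sqrt)
    define u v where "u = 12 / pi * ln (real R)" and "v = 6 / pi * ln (real Y)"
    have v: "v = 12 / pi * (ln (real Y) / 2)" by (simp add: v_def)
    have "u \<le> v" unfolding u_def v using l by (intro mult_left_mono) auto
    moreover have "v \<le> 12 / pi * (1 + ln (real R))" unfolding v using l by (intro mult_left_mono) auto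
    moreover have "12 / pi * (1 + ln (real R)) = 12 / pi + u" by (simp only: u_def distrib_left mult_1_right)
    moreover have "12 / pi \<le> 4" using pi_gt3 by (simp add: field_simps)
    ultimately have "\<bar>u - v\<bar> \<le> 4" by linarith
    then show ?thesis using C[OF b(1)] disc_sum_bounds[OF Y, folded R_def] unfolding u_def[symmetric] v_def[symmetric] by linarith
  qed
  then show ?thesis using that by blast
qed

text \<open>The annulus between the two discs has at most \<open>9 * Y\<close> points, each
  contributing at most \<open>2 / Y\<close>.\<close>

lemma odd_disc_sum_half:
  assumes Y: "Y \<ge> 1"
  shows "odd_disc_sum (Y div 2) \<le> odd_disc_sum Y" "odd_disc_sum Y - 18 \<le> odd_disc_sum (Y div 2)"
proof -
  define A where "A = {w \<in> prim_disc (Y div 2). odd_norm w}"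
  define B where "B = {w \<in> prim_disc Y. odd_norm w}"
  have sub: "A \<subseteq> B" by (auto simp: A_def B_def prim_disc_def zdiv_int intro: order_trans)
  have fB: "finite B" by (simp add: B_def)
  have "odd_disc_sum Y = odd_disc_sum (Y div 2) + sum inv_norm (B - A)"
    unfolding odd_disc_sum_def A_def[symmetric] B_def[symmetric] using sub fB by (metis add.commute sum.subset_diff)
  moreover have "sum inv_norm (B - A) \<ge> 0" by (intro sum_nonneg inv_norm_nonneg)
  moreover have "sum inv_norm (B - A) \<le> 18"
  proof -
    have "sum inv_norm (B - A) \<le> (\<Sum>w\<in>B - A. 1 / (real Y / 2))"
    proof (rule sum_mono)
      fix w assume w: "w \<in> B - A"
      then have "int (Y div 2) < (fst w)\<^sup>2 + (snd w)\<^sup>2" by (auto simp: A_def B_def prim_disc_def)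
      then have "int Y \<le> 2 * ((fst w)\<^sup>2 + (snd w)\<^sup>2)" by (simp add: zdiv_int)
      then have "real_of_int (int Y) \<le> real_of_int (2 * ((fst w)\<^sup>2 + (snd w)\<^sup>2))" by (simp only: of_int_le_iff)
      then have "real Y / 2 \<le> of_int ((fst w)\<^sup>2 + (snd w)\<^sup>2)" by simp
      then show "inv_norm w \<le> 1 / (real Y / 2)" unfolding inv_norm_def using Y
        by (intro divide_left_mono) (auto intro!: mult_pos_pos intro: less_le_trans[of 0 "real Y / 2"])
    qed
    also have "\<dots> = 2 * real (card (B - A)) / real Y" by simp
    also have "\<dots> \<le> 18"
    proof -
      have "card (B - A) \<le> card (prim_disc Y)" by (intro card_mono) (auto simp: B_def)
      then have "real (card (B - A)) \<le> 9 * real Y" using card_prim_disc_le[of Y] by linarith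
      then show ?thesis using Y by (simp add: field_simps)
    qed
    finally show ?thesis .
  qed
  ultimately show "odd_disc_sum (Y div 2) \<le> odd_disc_sum Y" "odd_disc_sum Y - 18 \<le> odd_disc_sum (Y div 2)" by linarith+
qed

text \<open>In Gaussian integers the map \<open>(a, b)\<close> to \<open>(a - b, a + b)\<close> is
  multiplication by 1 + i. It takes primitive vectors of odd norm to primitive vectors of even norm
  and doubles the norm; it is onto because a primitive vector of even norm has both coordinates
  odd.\<close>

lemma even_disc_sum:
  "(\<Sum>w | w \<in> prim_disc Y \<and> \<not> odd_norm w. inv_norm w) = odd_disc_sum (Y div 2) / 2"
proof -
  have "(\<Sum>w | w \<in> prim_disc Y \<and> \<not> odd_norm w. inv_norm w) = (\<Sum>w | w \<in> prim_disc (Y div 2) \<and> odd_norm w. inv_norm w / 2)"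
  proof (rule sum.reindex_bij_witness[where
      i = "\<lambda>(a,b). (a - b, a + b)" and j = "\<lambda>(x,y). ((x + y) div 2, (y - x) div 2)"])
    fix w assume w: "w \<in> {w \<in> prim_disc Y. \<not> odd_norm w}"
    obtain x y where xy: "w = (x, y)" by fastforce
    have cop: "coprime x y" and n: "x\<^sup>2 + y\<^sup>2 \<le> int Y" and e: "even (x + y)"
      using w by (auto simp: xy prim_disc_def primitive_def odd_norm_def)
    have "odd x"
    proof
      assume "even x"
      moreover from this have "even y" using e by simp
      ultimately have "is_unit (2::int)" using cop coprime_common_divisor by blast
      then show False by simp
    qed
    then have o: "odd x" "odd y" using e by auto
    define a b where "a = (x + y) div 2" and "b = (y - x) div 2"
    have ab: "x = a - b" "y = a + b" using e unfolding a_def b_def by presburger+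
    have n2: "x\<^sup>2 + y\<^sup>2 = 2 * (a\<^sup>2 + b\<^sup>2)" by (simp add: ab power2_eq_square algebra_simps)
    have "coprime a b"
    proof (rule coprimeI)
      fix d assume "d dvd a" "d dvd b"
      then have "d dvd x" "d dvd y" unfolding ab by auto
      then show "is_unit d" using cop coprime_common_divisor by blast
    qed
    moreover have "odd (a\<^sup>2 + b\<^sup>2)" using o by (simp add: ab)
    moreover have "a\<^sup>2 + b\<^sup>2 \<le> int (Y div 2)" using n n2 by (simp add: zdiv_int)
    ultimately show "(case w of (x,y) \<Rightarrow> ((x + y) div 2, (y - x) div 2)) \<in> {w \<in> prim_disc (Y div 2). odd_norm w}"
      by (simp add: xy a_def[symmetric] b_def[symmetric] prim_disc_def primitive_def odd_norm_def)
    show "(case (case w of (x,y) \<Rightarrow> ((x + y) div 2, (y - x) div 2)) of (a,b) \<Rightarrow> (a - b, a + b)) = w"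
      by (simp add: xy a_def[symmetric] b_def[symmetric] ab[symmetric])
    have "real_of_int (x\<^sup>2 + y\<^sup>2) = 2 * real_of_int (a\<^sup>2 + b\<^sup>2)" unfolding n2 by simp
    then have "inv_norm (a, b) / 2 = inv_norm (x, y)" unfolding inv_norm_def by (simp add: field_simps)
    then show "inv_norm (case w of (x,y) \<Rightarrow> ((x + y) div 2, (y - x) div 2)) / 2 = inv_norm w"
      by (simp add: xy a_def b_def)
  next
    fix w assume w: "w \<in> {w \<in> prim_disc (Y div 2). odd_norm w}"
    obtain a b where ab: "w = (a, b)" by fastforce
    have cop: "coprime a b" and n: "a\<^sup>2 + b\<^sup>2 \<le> int (Y div 2)" and o: "odd (a + b)"
      using w by (auto simp: ab prim_disc_def primitive_def odd_norm_def)
    show "(case (case w of (a,b) \<Rightarrow> (a - b, a + b)) of (x,y) \<Rightarrow> ((x + y) div 2, (y - x) div 2)) = w"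
      by (simp add: ab)
    have "coprime (a - b) (a + b)"
    proof (rule coprimeI)
      fix d assume d: "d dvd a - b" "d dvd a + b"
      have "odd d" using d o by (meson dvd_trans)
      then have c2: "coprime d 2" by simp
      have "(a + b) + (a - b) = 2 * a" "(a + b) - (a - b) = 2 * b" by simp_all
      then have "d dvd 2 * a" "d dvd 2 * b" using dvd_add[OF d(2,1)] dvd_diff[OF d(2,1)] by metis+
      then have "d dvd a" "d dvd b" using c2 by (simp_all add: coprime_dvd_mult_right_iff)
      then show "is_unit d" using cop coprime_common_divisor by blast
    qed
    moreover have "(a - b)\<^sup>2 + (a + b)\<^sup>2 = 2 * (a\<^sup>2 + b\<^sup>2)" by (simp add: power2_eq_square algebra_simps)
    ultimately show "(case w of (a,b) \<Rightarrow> (a - b, a + b)) \<in> {w \<in> prim_disc Y. \<not> odd_norm w}"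
      using n by (simp add: ab prim_disc_def primitive_def odd_norm_def zdiv_int)
  qed
  then show ?thesis by (simp add: odd_disc_sum_def sum_divide_distrib)
qed

text \<open>The even part is half of the odd part of the half-size disc, so the full sum is 3/2 of
  the odd sum up to 9, and 6 is two thirds of 9.\<close>

lemma odd_disc_sum_approx:
  assumes Y: "Y \<ge> 1"
  shows "\<bar>odd_disc_sum Y - 2 / 3 * disc_sum Y\<bar> \<le> 6"
proof -
  have "prim_disc Y = {w \<in> prim_disc Y. odd_norm w} \<union> {w \<in> prim_disc Y. \<not> odd_norm w}" by auto
  then have "disc_sum Y = (\<Sum>w\<in>{w \<in> prim_disc Y. odd_norm w} \<union> {w \<in> prim_disc Y. \<not> odd_norm w}. inv_norm w)"
    unfolding disc_sum_def by simp
  also have "\<dots> = odd_disc_sum Y + (\<Sum>w | w \<in> prim_disc Y \<and> \<not> odd_norm w. inv_norm w)"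
    unfolding odd_disc_sum_def by (intro sum.union_disjoint) auto
  finally have "disc_sum Y = odd_disc_sum Y + odd_disc_sum (Y div 2) / 2" unfolding even_disc_sum .
  then show ?thesis using odd_disc_sum_half[OF Y] unfolding abs_le_iff by linarith
qed

section \<open>Pairs of vectors with given determinant\<close>

definition det2 :: "int \<times> int \<Rightarrow> int \<times> int \<Rightarrow> int" where
  "det2 z w = fst z * snd w - snd z * fst w"

definition dot2 :: "int \<times> int \<Rightarrow> int \<times> int \<Rightarrow> int" where
  "dot2 z w = fst z * fst w + snd z * snd w"

definition nrm2 :: "int \<times> int \<Rightarrow> int" where
  "nrm2 w = (fst w)\<^sup>2 + (snd w)\<^sup>2"

lemma lagrange_identity: "nrm2 z * nrm2 w = (dot2 z w)\<^sup>2 + (det2 z w)\<^sup>2"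
  by (simp add: nrm2_def dot2_def det2_def power2_eq_square algebra_simps)

lemma nrm2_pos: "primitive w \<Longrightarrow> nrm2 w > 0"
  by (auto simp: nrm2_def primitive_def sum_power2_gt_zero_iff)

lemma inv_norm_nrm2: "inv_norm w = 1 / of_int (nrm2 w)"
  by (simp add: inv_norm_def nrm2_def)

lemma card_residue_class:
  fixes n c0 :: int and L :: real
  assumes n: "n > 0" and L: "L \<ge> 0"
  shows "finite {c. \<bar>of_int c\<bar> \<le> L \<and> n dvd (c - c0)}"
    "\<bar>real (card {c. \<bar>of_int c\<bar> \<le> L \<and> n dvd (c - c0)}) - 2 * L / of_int n\<bar> \<le> 1"
proof -
  define a b where "a = (- L - of_int c0) / of_int n" and "b = (L - of_int c0) / of_int n"
  have n': "real_of_int n > 0" using n by simp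
  have bij: "bij_betw (\<lambda>k. c0 + k * n) {\<lceil>a\<rceil>..\<lfloor>b\<rfloor>} {c. \<bar>of_int c\<bar> \<le> L \<and> n dvd (c - c0)}"
  proof (rule bij_betwI')
    fix k l show "(c0 + k * n = c0 + l * n) = (k = l)" using n by simp
  next
    fix k assume k: "k \<in> {\<lceil>a\<rceil>..\<lfloor>b\<rfloor>}"
    then have "a \<le> of_int k" "of_int k \<le> b" by (auto simp: ceiling_le_iff le_floor_iff)
    then have "- L - of_int c0 \<le> of_int k * of_int n" "of_int k * of_int n \<le> L - of_int c0"
      unfolding a_def b_def using n' by (simp_all add: field_simps)
    then show "c0 + k * n \<in> {c. \<bar>of_int c\<bar> \<le> L \<and> n dvd (c - c0)}" by (auto simp: abs_le_iff)
  next
    fix c assume c: "c \<in> {c. \<bar>of_int c\<bar> \<le> L \<and> n dvd (c - c0)}"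
    then obtain k where k: "c - c0 = n * k" by (auto elim: dvdE)
    then have ck: "c = c0 + k * n" by (simp add: mult.commute)
    have "- L - of_int c0 \<le> of_int k * of_int n" "of_int k * of_int n \<le> L - of_int c0"
      using c unfolding ck by (auto simp: abs_le_iff)
    then have "a \<le> of_int k" "of_int k \<le> b" unfolding a_def b_def using n' by (simp_all add: field_simps)
    then show "\<exists>k\<in>{\<lceil>a\<rceil>..\<lfloor>b\<rfloor>}. c = c0 + k * n" using ck by (auto simp: ceiling_le_iff le_floor_iff)
  qed
  show "finite {c. \<bar>of_int c\<bar> \<le> L \<and> n dvd (c - c0)}" using bij_betw_finite[OF bij] by simp
  have "card {c. \<bar>of_int c\<bar> \<le> L \<and> n dvd (c - c0)} = nat (\<lfloor>b\<rfloor> - \<lceil>a\<rceil> + 1)"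
    using bij_betw_same_card[OF bij] by simp
  moreover have ab: "b - a = 2 * L / of_int n" unfolding a_def b_def by (simp add: diff_divide_distrib[symmetric])
  moreover have "b - a \<ge> 0" unfolding ab using L n' by simp
  moreover have "\<lfloor>b\<rfloor> - \<lceil>a\<rceil> + 1 \<ge> 0" using \<open>b - a \<ge> 0\<close> by linarith
  ultimately show "\<bar>real (card {c. \<bar>of_int c\<bar> \<le> L \<and> n dvd (c - c0)}) - 2 * L / of_int n\<bar> \<le> 1"
    unfolding abs_le_iff ab[symmetric] by (simp, linarith)
qed

text \<open>By the Lagrange identity the middle condition says \<open>|z| |w| \<le> sqrt N\<close>.
  The predicate \<open>E\<close> will be either trivial or \<open>even\<close>; it sits on the dot
  product because this is the number \<open>c\<close> of the original equation.\<close>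

definition zfiber :: "nat \<Rightarrow> int \<Rightarrow> (int \<Rightarrow> bool) \<Rightarrow> int \<times> int \<Rightarrow> (int \<times> int) set" where
  "zfiber N m E w = {z. det2 z w = m \<and> (dot2 z w)\<^sup>2 + m\<^sup>2 \<le> int N \<and> E (dot2 z w)}"

text \<open>A vector is determined by its determinant and its dot product with \<open>w\<close>. On
  the line \<open>det2 z w = m\<close> the lattice points differ by multiples of \<open>w\<close>,
  since \<open>w\<close> is primitive, and a step by \<open>w\<close> changes the dot product by
  \<open>nrm2 w\<close>; so the dot products fill one residue class. A Bezout relation supplies the
  base point \<open>z0\<close>.\<close>

lemma zfiber_dot_bij:
  assumes w: "primitive w"
  obtains c0 where "\<And>N E. bij_betw (\<lambda>z. dot2 z w) (zfiber N m E w) {c. c\<^sup>2 + m\<^sup>2 \<le> int N \<and> nrm2 w dvd (c - c0) \<and> E c}"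
proof -
  obtain w1 w2 where ww: "w = (w1, w2)" by fastforce
  have cop: "coprime w1 w2" using w by (simp add: ww primitive_def)
  have n: "nrm2 w > 0" using nrm2_pos[OF w] .
  obtain x y where xy: "x * w1 + y * w2 = 1" using bezout_int[of w1 w2] cop by (auto simp: coprime_iff_gcd_eq_1)
  define z0 where "z0 = (m * y, - m * x)"
  define c0 where "c0 = dot2 z0 w"
  have z0: "det2 z0 w = m"
  proof -
    have "det2 z0 w = m * (x * w1 + y * w2)" by (simp add: det2_def z0_def ww algebra_simps)
    then show ?thesis by (simp add: xy)
  qed
  have cong: "nrm2 w dvd (dot2 z w - c0)" if z: "det2 z w = m" for z
  proof -
    define d1 d2 where "d1 = fst z - fst z0" and "d2 = snd z - snd z0"
    have par: "d1 * w2 = d2 * w1" using z z0 by (simp add: det2_def d1_def d2_def ww algebra_simps)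
    \<comment> \<open>Both \<open>w1 * D\<close> and \<open>w2 * D\<close> are multiples of
      \<open>nrm2 w\<close>, hence so is \<open>D\<close> by the Bezout relation.\<close>
    define D where "D = dot2 z w - c0"
    have D: "D = d1 * w1 + d2 * w2" by (simp add: D_def c0_def dot2_def d1_def d2_def ww algebra_simps)
    have "w1 * D = d1 * nrm2 w"
    proof -
      have "w1 * D = d1 * w1 * w1 + (d2 * w1) * w2" by (simp add: D algebra_simps)
      then show ?thesis unfolding par[symmetric] by (simp add: nrm2_def ww power2_eq_square algebra_simps)
    qed
    moreover have "w2 * D = d2 * nrm2 w"
    proof -
      have "w2 * D = (d1 * w2) * w1 + d2 * w2 * w2" by (simp add: D algebra_simps)
      then show ?thesis unfolding par by (simp add: nrm2_def ww power2_eq_square algebra_simps)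
    qed
    moreover have "D = x * (w1 * D) + y * (w2 * D)" using xy by (metis distrib_right mult.assoc mult_1)
    ultimately have "D = nrm2 w * (x * d1 + y * d2)" by (simp add: algebra_simps)
    then show ?thesis unfolding D_def by simp
  qed
  have inj: "z = z'" if "det2 z w = det2 z' w" "dot2 z w = dot2 z' w" for z z'
  proof -
    have "fst z * nrm2 w = dot2 z w * w1 + det2 z w * w2" "snd z * nrm2 w = dot2 z w * w2 - det2 z w * w1" for z
      by (simp_all add: nrm2_def dot2_def det2_def ww power2_eq_square algebra_simps)
    then have "fst z * nrm2 w = fst z' * nrm2 w" "snd z * nrm2 w = snd z' * nrm2 w" using that by simp_all
    then show ?thesis using n by (simp add: prod_eq_iff)
  qed
  have "bij_betw (\<lambda>z. dot2 z w) (zfiber N m E w) {c. c\<^sup>2 + m\<^sup>2 \<le> int N \<and> nrm2 w dvd (c - c0) \<and> E c}" for N E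
  proof (rule bij_betwI')
    fix z z' assume "z \<in> zfiber N m E w" "z' \<in> zfiber N m E w"
    then have "det2 z w = det2 z' w" by (simp add: zfiber_def)
    then show "(dot2 z w = dot2 z' w) = (z = z')" using inj[of z z'] by blast
  next
    fix z assume "z \<in> zfiber N m E w"
    then show "dot2 z w \<in> {c. c\<^sup>2 + m\<^sup>2 \<le> int N \<and> nrm2 w dvd (c - c0) \<and> E c}"
      using cong by (auto simp: zfiber_def)
  next
    fix c assume c: "c \<in> {c. c\<^sup>2 + m\<^sup>2 \<le> int N \<and> nrm2 w dvd (c - c0) \<and> E c}"
    then obtain k where k: "c - c0 = nrm2 w * k" by (auto elim: dvdE)
    define z where "z = (fst z0 + k * w1, snd z0 + k * w2)"
    have "det2 z w = m" using z0 by (simp add: z_def det2_def ww algebra_simps)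
    moreover have "dot2 z w = c0 + k * nrm2 w" by (simp add: z_def dot2_def c0_def ww nrm2_def power2_eq_square algebra_simps)
    then have "dot2 z w = c" using k by (simp add: algebra_simps)
    ultimately show "\<exists>z\<in>zfiber N m E w. c = dot2 z w" using c by (intro bexI[of _ z]) (auto simp: zfiber_def)
  qed
  then show ?thesis using that by blast
qed

lemma sq_add_le_iff:
  fixes c m :: int
  assumes m: "m\<^sup>2 \<le> int N"
  shows "c\<^sup>2 + m\<^sup>2 \<le> int N \<longleftrightarrow> \<bar>of_int c\<bar> \<le> sqrt (real N - (of_int m)\<^sup>2)"
proof -
  have "c\<^sup>2 + m\<^sup>2 \<le> int N \<longleftrightarrow> real_of_int (c\<^sup>2 + m\<^sup>2) \<le> real_of_int (int N)" by (simp only: of_int_le_iff)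
  also have "\<dots> \<longleftrightarrow> \<bar>real_of_int c\<bar>\<^sup>2 \<le> real N - (of_int m)\<^sup>2" by auto
  also have "\<dots> \<longleftrightarrow> \<bar>real_of_int c\<bar> \<le> sqrt (real N - (of_int m)\<^sup>2)"
  proof
    assume "\<bar>real_of_int c\<bar> \<le> sqrt (real N - (of_int m)\<^sup>2)"
    then have "\<bar>real_of_int c\<bar>\<^sup>2 \<le> (sqrt (real N - (of_int m)\<^sup>2))\<^sup>2" by (intro power_mono) auto
    also have "(real_of_int m)\<^sup>2 \<le> real N" using m by (metis of_int_le_iff of_int_of_nat_eq of_int_power)
    then have "(sqrt (real N - (of_int m)\<^sup>2))\<^sup>2 = real N - (of_int m)\<^sup>2" by simp
    finally show "\<bar>real_of_int c\<bar>\<^sup>2 \<le> real N - (of_int m)\<^sup>2" .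
  qed (rule real_le_rsqrt)
  finally show ?thesis .
qed

text \<open>All claims count a residue class modulo \<open>nrm2 w\<close> in an interval. With an
  even dot product required: if \<open>nrm2 w\<close> is odd, the class splits by parity into
  classes modulo \<open>2 * nrm2 w\<close>, which halves the count; if it is even, both coordinates
  of \<open>w\<close> are odd, the dot product has the parity of the odd number \<open>m\<close>,
  and nothing is left. In the last claim \<open>|z| \<le> |w|\<close> forces the dot product into an
  interval of length \<open>2 * nrm2 w\<close>.\<close>

lemma zfiber_card:
  assumes w: "primitive w" and m: "m\<^sup>2 \<le> int N"
  shows "finite (zfiber N m E w)"
    "\<bar>real (card (zfiber N m (\<lambda>_. True) w)) - 2 * sqrt (real N - (of_int m)\<^sup>2) * inv_norm w\<bar> \<le> 1"
    "odd m \<Longrightarrow> \<bar>real (card (zfiber N m even w)) - (if odd_norm w then sqrt (real N - (of_int m)\<^sup>2) * inv_norm w else 0)\<bar> \<le> 1"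
    "card {z \<in> zfiber N m E w. nrm2 z \<le> nrm2 w} \<le> 3"
proof -
  define L where "L = sqrt (real N - (of_int m)\<^sup>2)"
  have "(real_of_int m)\<^sup>2 \<le> real N" using m by (metis of_int_le_iff of_int_of_nat_eq of_int_power)
  then have L: "L \<ge> 0" by (simp add: L_def)
  have n: "nrm2 w > 0" using nrm2_pos[OF w] .
  obtain c0 where bij: "\<And>N E. bij_betw (\<lambda>z. dot2 z w) (zfiber N m E w) {c. c\<^sup>2 + m\<^sup>2 \<le> int N \<and> nrm2 w dvd (c - c0) \<and> E c}"
    using zfiber_dot_bij[OF w] by blast
  have iff: "c\<^sup>2 + m\<^sup>2 \<le> int N \<longleftrightarrow> \<bar>of_int c\<bar> \<le> L" for c unfolding L_def by (rule sq_add_le_iff[OF m])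
  have cardE: "card (zfiber N m E w) = card {c. \<bar>of_int c\<bar> \<le> L \<and> nrm2 w dvd (c - c0) \<and> E c}" for E
    using bij_betw_same_card[OF bij[of N E]] by (simp only: iff)
  have "finite {c. \<bar>of_int c\<bar> \<le> L \<and> nrm2 w dvd (c - c0) \<and> E c}"
    by (rule finite_subset[OF _ card_residue_class(1)[OF n L, of c0]]) auto
  then show "finite (zfiber N m E w)" using bij_betw_finite[OF bij[of N E]] by (simp only: iff)
  show "\<bar>real (card (zfiber N m (\<lambda>_. True) w)) - 2 * sqrt (real N - (of_int m)\<^sup>2) * inv_norm w\<bar> \<le> 1"
    using card_residue_class(2)[OF n L, of c0] unfolding cardE by (simp add: L_def inv_norm_nrm2)
  show "\<bar>real (card (zfiber N m even w)) - (if odd_norm w then sqrt (real N - (of_int m)\<^sup>2) * inv_norm w else 0)\<bar> \<le> 1" if om: "odd m"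
  proof (cases "odd_norm w")
    case True
    then have o: "odd (nrm2 w)" by (simp add: odd_norm_def nrm2_def)
    define c1 where "c1 = (if even c0 then c0 else c0 + nrm2 w)"
    have e1: "even c1" using o by (simp add: c1_def)
    have d1: "nrm2 w dvd (c - c0) \<longleftrightarrow> nrm2 w dvd (c - c1)" for c
    proof -
      have "c - c0 = (c - c1) + nrm2 w * (if even c0 then 0 else 1)" by (simp add: c1_def)
      then show ?thesis by (metis dvd_add_left_iff dvd_triv_left)
    qed
    have "nrm2 w dvd (c - c0) \<and> even c \<longleftrightarrow> (2 * nrm2 w) dvd (c - c1)" for c
    proof -
      have "coprime 2 (nrm2 w)" using o by simp
      then have "(2 * nrm2 w) dvd (c - c1) \<longleftrightarrow> 2 dvd (c - c1) \<and> nrm2 w dvd (c - c1)"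
        using divides_mult dvd_mult_left dvd_mult_right by metis
      then show ?thesis using e1 d1 by auto
    qed
    then have "card (zfiber N m even w) = card {c. \<bar>of_int c\<bar> \<le> L \<and> (2 * nrm2 w) dvd (c - c1)}"
      unfolding cardE by simp
    then show ?thesis using card_residue_class(2)[of "2 * nrm2 w" L c1] n L True by (simp add: L_def inv_norm_nrm2)
  next
    case False
    obtain w1 w2 where ww: "w = (w1, w2)" by fastforce
    have cop: "coprime w1 w2" and e: "even (w1 + w2)" using w False by (auto simp: primitive_def odd_norm_def ww)
    have "odd w1"
    proof
      assume "even w1"
      moreover from this have "even w2" using e by simp
      ultimately have "is_unit (2::int)" using cop coprime_common_divisor by blast
      then show False by simp
    qed
    then have o: "odd w1" "odd w2" using e by auto
    have "odd (dot2 z w)" if "det2 z w = m" for z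
      using that om o by (auto simp: dot2_def det2_def ww)
    then have "zfiber N m even w = {}" by (auto simp: zfiber_def)
    then show ?thesis using False by simp
  qed
  define S where "S = {z \<in> zfiber N m E w. nrm2 z \<le> nrm2 w}"
  have "(\<lambda>z. dot2 z w) ` S \<subseteq> {c. \<bar>of_int c\<bar> \<le> real_of_int (nrm2 w) \<and> nrm2 w dvd (c - c0)}"
  proof
    fix c assume "c \<in> (\<lambda>z. dot2 z w) ` S"
    then obtain z where z: "z \<in> zfiber N m E w" "nrm2 z \<le> nrm2 w" "c = dot2 z w" by (auto simp: S_def)
    have "c\<^sup>2 \<le> nrm2 z * nrm2 w" unfolding lagrange_identity z(3) by simp
    also have "\<dots> \<le> nrm2 w * nrm2 w" using z(2) n by (intro mult_right_mono) auto
    finally have "c\<^sup>2 \<le> (nrm2 w)\<^sup>2" by (simp add: power2_eq_square)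
    then have "\<bar>c\<bar> \<le> nrm2 w" using n abs_le_square_iff[of c "nrm2 w"] by simp
    moreover have "nrm2 w dvd (c - c0)" using bij_betwE[OF bij[of N E]] z by blast
    ultimately show "c \<in> {c. \<bar>of_int c\<bar> \<le> real_of_int (nrm2 w) \<and> nrm2 w dvd (c - c0)}" by simp
  qed
  then have "card ((\<lambda>z. dot2 z w) ` S) \<le> card {c. \<bar>of_int c\<bar> \<le> real_of_int (nrm2 w) \<and> nrm2 w dvd (c - c0)}"
    using n by (intro card_mono card_residue_class(1)) auto
  moreover have "card ((\<lambda>z. dot2 z w) ` S) = card S"
    using bij[of N E] by (intro card_image) (auto simp: bij_betw_def S_def intro: inj_on_subset)
  moreover have "real (card {c. \<bar>of_int c\<bar> \<le> real_of_int (nrm2 w) \<and> nrm2 w dvd (c - c0)}) \<le> 3"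
    using card_residue_class(2)[OF n, of "of_int (nrm2 w)" c0] n by simp
  ultimately show "card {z \<in> zfiber N m E w. nrm2 z \<le> nrm2 w} \<le> 3" unfolding S_def[symmetric] by linarith
qed

definition pairs :: "nat \<Rightarrow> int \<Rightarrow> (int \<Rightarrow> bool) \<Rightarrow> ((int \<times> int) \<times> (int \<times> int)) set" where
  "pairs N m E = {(z,w). det2 z w = m \<and> (dot2 z w)\<^sup>2 + m\<^sup>2 \<le> int N \<and> E (dot2 z w)}"

text \<open>A nonzero determinant makes both vectors nonzero, so each squared norm is at most the
  product of the two, which is at most \<open>N\<close>.\<close>

lemma finite_pairs:
  assumes "m \<noteq> 0"
  shows "finite (pairs N m E)"
proof (rule finite_subset)
  define B where "B = {- int N..int N} \<times> {- int N..int N}"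
  show "finite (B \<times> B)" by (simp add: B_def)
  have nb: "z \<in> B" if "nrm2 z \<le> int N" for z
  proof -
    have "\<bar>a\<bar> \<le> a\<^sup>2" for a :: int by (metis abs_ge_zero abs_le_self_iff power2_abs self_le_power int_one_le_iff_zero_less linorder_not_le zero_less_abs_iff abs_zero zero_power2 zero_less_numeral order_refl)
    then have "\<bar>fst z\<bar> \<le> int N" "\<bar>snd z\<bar> \<le> int N"
      using that zero_le_power2[of "fst z"] zero_le_power2[of "snd z"] unfolding nrm2_def by (smt (verit))+
    then show ?thesis unfolding B_def by (cases z) (auto simp: abs_le_iff)
  qed
  show "pairs N m E \<subseteq> B \<times> B"
  proof
    fix x assume "x \<in> pairs N m E"
    then obtain z w where x: "x = (z, w)" "det2 z w = m" "(dot2 z w)\<^sup>2 + m\<^sup>2 \<le> int N" by (auto simp: pairs_def)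
    have p: "nrm2 z * nrm2 w \<le> int N" using x by (simp add: lagrange_identity)
    have "nrm2 z \<noteq> 0" "nrm2 w \<noteq> 0" using x assms by (auto simp: nrm2_def det2_def sum_power2_eq_zero_iff)
    moreover have "nrm2 z \<ge> 0" "nrm2 w \<ge> 0" by (auto simp: nrm2_def)
    ultimately have pos: "nrm2 z \<ge> 1" "nrm2 w \<ge> 1" by linarith+
    have "nrm2 z * 1 \<le> nrm2 z * nrm2 w" "1 * nrm2 w \<le> nrm2 z * nrm2 w"
      using pos by (auto intro!: mult_left_mono mult_right_mono)
    then have "nrm2 z \<le> int N" "nrm2 w \<le> int N" using p by linarith+
    then show "x \<in> B \<times> B" using nb x by auto
  qed
qed

text \<open>For a pair with \<open>|w| \<le> |z|\<close> the vector \<open>w\<close> lies in the disc of radius \<open>N powr (1/4)\<close>, whose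
  area is of the order of the admissible error.\<close>

lemma card_long_pairs:
  assumes m: "m\<^sup>2 \<le> int N"
  defines "Y \<equiv> nat \<lfloor>sqrt (real N)\<rfloor>"
  shows "\<bar>real (card {(z,w) \<in> pairs N m E. primitive w \<and> nrm2 w \<le> nrm2 z}) - (\<Sum>w\<in>prim_disc Y. real (card (zfiber N m E w)))\<bar>
      \<le> 3 * real (card (prim_disc Y))"
    "card {(z,w) \<in> pairs N m E. primitive w \<and> nrm2 w = nrm2 z} \<le> 3 * card (prim_disc Y)"
proof -
  define A where "A w = {z \<in> zfiber N m E w. nrm2 w \<le> nrm2 z}" for w
  define A' where "A' w = {z \<in> zfiber N m E w. nrm2 w = nrm2 z}" for w
  \<comment> \<open>\<open>|w|^4 \<le> |z|^2 |w|^2 \<le> N\<close>, which puts \<open>|w|^2\<close>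
    below \<open>Y\<close>.\<close>
  have disc: "w \<in> prim_disc Y" if "(z,w) \<in> pairs N m E" "primitive w" "nrm2 w \<le> nrm2 z" for z w
  proof -
    have n: "nrm2 w > 0" using nrm2_pos that by blast
    have "nrm2 w * nrm2 w \<le> nrm2 z * nrm2 w" using that n by (intro mult_right_mono) auto
    also have "\<dots> \<le> int N" using that by (auto simp: lagrange_identity pairs_def)
    finally have "(nrm2 w)\<^sup>2 \<le> int N" by (simp add: power2_eq_square)
    from abs_le_floor_sqrt[OF this] have "nrm2 w \<le> int Y" using n by (simp add: Y_def)
    then show ?thesis using that by (simp add: prim_disc_def nrm2_def)
  qed
  have pd: "primitive w" if "w \<in> prim_disc Y" for w using that by (simp add: prim_disc_def)
  have fin: "finite (zfiber N m E w)" if "w \<in> prim_disc Y" for w using zfiber_card(1)[OF pd[OF that] m] .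
  have "{(z,w) \<in> pairs N m E. primitive w \<and> nrm2 w \<le> nrm2 z} = (\<lambda>(w,z). (z,w)) ` (SIGMA w:prim_disc Y. A w)"
    using disc pd by (force simp: A_def zfiber_def pairs_def image_iff)
  then have "card {(z,w) \<in> pairs N m E. primitive w \<and> nrm2 w \<le> nrm2 z} = card (SIGMA w:prim_disc Y. A w)"
    by (simp only:) (intro card_image, auto simp: inj_on_def)
  also have "\<dots> = (\<Sum>w\<in>prim_disc Y. card (A w))" using fin by (intro card_SigmaI) (auto simp: A_def)
  finally have c: "card {(z,w) \<in> pairs N m E. primitive w \<and> nrm2 w \<le> nrm2 z} = (\<Sum>w\<in>prim_disc Y. card (A w))" .
  have aw: "card (A w) \<le> card (zfiber N m E w)" "card (zfiber N m E w) \<le> card (A w) + 3" if "w \<in> prim_disc Y" for w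
  proof -
    show "card (A w) \<le> card (zfiber N m E w)" using fin[OF that] by (intro card_mono) (auto simp: A_def)
    \<comment> \<open>Ignoring the condition \<open>|w| \<le> |z|\<close> adds at most three points
      for each \<open>w\<close>.\<close>
    have "zfiber N m E w \<subseteq> A w \<union> {z \<in> zfiber N m E w. nrm2 z \<le> nrm2 w}" by (auto simp: A_def)
    then have "card (zfiber N m E w) \<le> card (A w \<union> {z \<in> zfiber N m E w. nrm2 z \<le> nrm2 w})"
      using fin[OF that] by (intro card_mono) (auto simp: A_def)
    also have "\<dots> \<le> card (A w) + card {z \<in> zfiber N m E w. nrm2 z \<le> nrm2 w}" by (rule card_Un_le)
    finally show "card (zfiber N m E w) \<le> card (A w) + 3" using zfiber_card(4)[OF pd[OF that] m, of E] by linarith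
  qed
  have "(\<Sum>w\<in>prim_disc Y. card (A w)) \<le> (\<Sum>w\<in>prim_disc Y. card (zfiber N m E w))" by (intro sum_mono aw)
  moreover have "(\<Sum>w\<in>prim_disc Y. card (zfiber N m E w)) \<le> (\<Sum>w\<in>prim_disc Y. card (A w) + 3)" by (intro sum_mono aw)
  moreover have "(\<Sum>w\<in>prim_disc Y. card (A w) + 3) = (\<Sum>w\<in>prim_disc Y. card (A w)) + 3 * card (prim_disc Y)"
    by (simp add: sum.distrib)
  ultimately show "\<bar>real (card {(z,w) \<in> pairs N m E. primitive w \<and> nrm2 w \<le> nrm2 z}) - (\<Sum>w\<in>prim_disc Y. real (card (zfiber N m E w)))\<bar>
      \<le> 3 * real (card (prim_disc Y))"
    unfolding c of_nat_sum[symmetric] by linarith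
  have "{(z,w) \<in> pairs N m E. primitive w \<and> nrm2 w = nrm2 z} = (\<lambda>(w,z). (z,w)) ` (SIGMA w:prim_disc Y. A' w)"
    using disc pd by (force simp: A'_def zfiber_def pairs_def image_iff)
  then have "card {(z,w) \<in> pairs N m E. primitive w \<and> nrm2 w = nrm2 z} = card (SIGMA w:prim_disc Y. A' w)"
    by (simp only:) (intro card_image, auto simp: inj_on_def)
  also have "\<dots> = (\<Sum>w\<in>prim_disc Y. card (A' w))" using fin by (intro card_SigmaI) (auto simp: A'_def)
  also have "\<dots> \<le> (\<Sum>w\<in>prim_disc Y. 3)"
  proof (rule sum_mono)
    fix w assume w: "w \<in> prim_disc Y"
    have "card (A' w) \<le> card {z \<in> zfiber N m E w. nrm2 z \<le> nrm2 w}"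
      using fin[OF w] by (intro card_mono) (auto simp: A'_def)
    then show "card (A' w) \<le> 3" using zfiber_card(4)[OF pd[OF w] m, of E] by linarith
  qed
  finally show "card {(z,w) \<in> pairs N m E. primitive w \<and> nrm2 w = nrm2 z} \<le> 3 * card (prim_disc Y)" by (simp add: mult.commute)
qed

section \<open>The symmetry between the two vectors, and the pairs that escape it\<close>

definition prim_pairs :: "nat \<Rightarrow> int \<Rightarrow> (int \<Rightarrow> bool) \<Rightarrow> ((int \<times> int) \<times> (int \<times> int)) set" where
  "prim_pairs N m E = {(z,w) \<in> pairs N m E. primitive z \<and> primitive w}"

definition bad_pairs :: "nat \<Rightarrow> int \<Rightarrow> (int \<Rightarrow> bool) \<Rightarrow> ((int \<times> int) \<times> (int \<times> int)) set" where
  "bad_pairs N m E = {(z,w) \<in> pairs N m E. \<not> primitive z \<and> primitive w}"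

text \<open>The sign keeps the determinant; the dot product changes its sign instead, which is why
  \<open>E\<close> is later assumed to be symmetric.\<close>

definition swap_pair :: "(int \<times> int) \<times> (int \<times> int) \<Rightarrow> (int \<times> int) \<times> (int \<times> int)" where
  "swap_pair x = (snd x, (- fst (fst x), - snd (fst x)))"

lemma swap_pair_props:
  "det2 w (- fst z, - snd z) = det2 z w" "dot2 w (- fst z, - snd z) = - dot2 z w"
  "nrm2 (- fst z, - snd z) = nrm2 z" "primitive (- fst z, - snd z) = primitive z"
  by (simp_all add: det2_def dot2_def nrm2_def primitive_def algebra_simps)

lemma inj_swap_pair: "inj swap_pair"
  by (auto simp: inj_def swap_pair_def prod_eq_iff)

lemma neg_pair_props:
  "det2 (- fst z, - snd z) (- fst w, - snd w) = det2 z w" "dot2 (- fst z, - snd z) (- fst w, - snd w) = dot2 z w"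
  by (simp_all add: det2_def dot2_def)

text \<open>\<open>swap_pair\<close> exchanges the halves \<open>X0\<close> and \<open>X1\<close>,
  so the number of pairs is twice that of \<open>X0\<close> less the overlap
  \<open>|z| = |w|\<close>. Writing \<open>D\<close> for the size of the disc, the sum over fibers
  is off by \<open>D\<close>, passing to it from \<open>YY\<close> costs \<open>3 D\<close>, both
  are doubled, and the overlap costs \<open>3 D\<close> more: 2 (1 + 3) + 3 = 11.\<close>

lemma card_prim_pairs:
  assumes m: "m\<^sup>2 \<le> int N" "m \<noteq> 0" and E: "\<And>c. E (- c) = E c"
  defines "Y \<equiv> nat \<lfloor>sqrt (real N)\<rfloor>"
  assumes M: "\<bar>(\<Sum>w\<in>prim_disc Y. real (card (zfiber N m E w))) - M\<bar> \<le> real (card (prim_disc Y))"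
  shows "\<bar>real (card (prim_pairs N m E)) - 2 * M\<bar> \<le> 11 * real (card (prim_disc Y)) + 2 * real (card (bad_pairs N m E))"
proof -
  define X0 where "X0 = {(z,w) \<in> prim_pairs N m E. nrm2 w \<le> nrm2 z}"
  define X1 where "X1 = {(z,w) \<in> prim_pairs N m E. nrm2 z \<le> nrm2 w}"
  define YY where "YY = {(z,w) \<in> pairs N m E. primitive w \<and> nrm2 w \<le> nrm2 z}"
  define Z where "Z = {(z,w) \<in> pairs N m E. primitive w \<and> nrm2 w = nrm2 z}"
  have fp: "finite (pairs N m E)" using finite_pairs m by blast
  have "X0 \<subseteq> pairs N m E" "X1 \<subseteq> pairs N m E" "YY \<subseteq> pairs N m E" "bad_pairs N m E \<subseteq> pairs N m E" "Z \<subseteq> pairs N m E"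
    by (auto simp: X0_def X1_def YY_def bad_pairs_def prim_pairs_def Z_def)
  then have fin: "finite X0" "finite X1" "finite YY" "finite (bad_pairs N m E)" "finite Z"
    using fp finite_subset by blast+
  have sw: "swap_pair (z, w) \<in> prim_pairs N m E" if "(z, w) \<in> prim_pairs N m E" for z w
    using that E by (simp add: prim_pairs_def pairs_def swap_pair_def swap_pair_props)
  have i01: "swap_pair ` X0 \<subseteq> X1" "swap_pair ` X1 \<subseteq> X0"
    unfolding X0_def X1_def using sw by (auto simp: swap_pair_def nrm2_def)
  have "card X0 \<le> card X1"
    by (rule card_inj_on_le[OF inj_on_subset[OF inj_swap_pair subset_UNIV] i01(1) fin(2)])
  moreover have "card X1 \<le> card X0"
    by (rule card_inj_on_le[OF inj_on_subset[OF inj_swap_pair subset_UNIV] i01(2) fin(1)])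
  ultimately have c01: "card X0 = card X1" by simp
  have un: "prim_pairs N m E = X0 \<union> X1" by (auto simp: X0_def X1_def)
  have "card (prim_pairs N m E) + card (X0 \<inter> X1) = 2 * card X0"
    unfolding un using card_Un_Int[OF fin(1,2)] c01 by simp
  moreover have "card (X0 \<inter> X1) \<le> card Z"
    using fin by (intro card_mono) (auto simp: X0_def X1_def Z_def prim_pairs_def)
  moreover have "card Z \<le> 3 * card (prim_disc Y)"
    unfolding Z_def Y_def by (rule card_long_pairs(2)[OF m(1)])
  moreover have "card X0 \<le> card YY" using fin by (intro card_mono) (auto simp: X0_def YY_def prim_pairs_def)
  moreover have "card YY \<le> card X0 + card (bad_pairs N m E)"
  proof -
    have "YY \<subseteq> X0 \<union> bad_pairs N m E" by (auto simp: X0_def YY_def prim_pairs_def bad_pairs_def)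
    then have "card YY \<le> card (X0 \<union> bad_pairs N m E)" using fin by (intro card_mono) auto
    then show ?thesis using card_Un_le[of X0 "bad_pairs N m E"] by linarith
  qed
  moreover have "\<bar>real (card YY) - (\<Sum>w\<in>prim_disc Y. real (card (zfiber N m E w)))\<bar> \<le> 3 * real (card (prim_disc Y))"
    unfolding YY_def Y_def by (rule card_long_pairs(1)[OF m(1)])
  ultimately show ?thesis using M by linarith
qed

lemma zfiber_sum:
  assumes m: "m\<^sup>2 \<le> int N"
  shows "\<bar>(\<Sum>w\<in>prim_disc Y. real (card (zfiber N m (\<lambda>_. True) w))) - 2 * sqrt (real N - (of_int m)\<^sup>2) * disc_sum Y\<bar> \<le> real (card (prim_disc Y))"
    "odd m \<Longrightarrow> \<bar>(\<Sum>w\<in>prim_disc Y. real (card (zfiber N m even w))) - sqrt (real N - (of_int m)\<^sup>2) * odd_disc_sum Y\<bar> \<le> real (card (prim_disc Y))"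
proof -
  define L where "L = sqrt (real N - (of_int m)\<^sup>2)"
  have pd: "primitive w" if "w \<in> prim_disc Y" for w using that by (simp add: prim_disc_def)
  have gen: "\<bar>(\<Sum>w\<in>prim_disc Y. f w) - (\<Sum>w\<in>prim_disc Y. g w)\<bar> \<le> real (card (prim_disc Y))"
    if "\<And>w. w \<in> prim_disc Y \<Longrightarrow> \<bar>f w - g w\<bar> \<le> 1" for f g :: "int \<times> int \<Rightarrow> real"
  proof -
    have "\<bar>(\<Sum>w\<in>prim_disc Y. f w) - (\<Sum>w\<in>prim_disc Y. g w)\<bar> \<le> (\<Sum>w\<in>prim_disc Y. \<bar>f w - g w\<bar>)"
      unfolding sum_subtractf[symmetric] by (rule sum_abs)
    also have "\<dots> \<le> (\<Sum>w\<in>prim_disc Y. 1)" using that by (intro sum_mono) auto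
    finally show ?thesis by simp
  qed
  have "\<bar>(\<Sum>w\<in>prim_disc Y. real (card (zfiber N m (\<lambda>_. True) w))) - (\<Sum>w\<in>prim_disc Y. 2 * L * inv_norm w)\<bar> \<le> real (card (prim_disc Y))"
    by (rule gen) (use zfiber_card(2)[OF pd m] in \<open>simp add: L_def\<close>)
  then show "\<bar>(\<Sum>w\<in>prim_disc Y. real (card (zfiber N m (\<lambda>_. True) w))) - 2 * sqrt (real N - (of_int m)\<^sup>2) * disc_sum Y\<bar> \<le> real (card (prim_disc Y))"
    by (simp add: L_def disc_sum_def sum_distrib_left)
  assume o: "odd m"
  have "\<bar>(\<Sum>w\<in>prim_disc Y. real (card (zfiber N m even w))) - (\<Sum>w\<in>prim_disc Y. if odd_norm w then L * inv_norm w else 0)\<bar> \<le> real (card (prim_disc Y))"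
    unfolding L_def by (rule gen) (rule zfiber_card(3)[OF pd m o])
  also have "(\<Sum>w\<in>prim_disc Y. if odd_norm w then L * inv_norm w else 0) = L * odd_disc_sum Y"
    unfolding odd_disc_sum_def sum_distrib_left by (intro sum.inter_filter[symmetric]) simp
  finally show "\<bar>(\<Sum>w\<in>prim_disc Y. real (card (zfiber N m even w))) - sqrt (real N - (of_int m)\<^sup>2) * odd_disc_sum Y\<bar> \<le> real (card (prim_disc Y))"
    by (simp add: L_def)
qed

lemma floor_sqrt_le: "real (nat \<lfloor>sqrt (real N)\<rfloor>) \<le> sqrt (real N)"
  by (rule of_nat_floor) simp

text \<open>With determinant 1 both vectors are automatically primitive, so every pair or a swap of
  it has its second vector in the small disc, and an upper bound follows without any exceptional
  pairs. It serves to bound the exceptional pairs of determinant \<open>p\<close>.\<close>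

lemma card_det_one_pairs:
  assumes M: "M \<ge> 1"
  shows "real (card (pairs M 1 (\<lambda>_. True))) \<le> sqrt (real M) * (104 + 32 * ln (real M))"
proof -
  define E where "E = (\<lambda>_::int. True)"
  define Y where "Y = nat \<lfloor>sqrt (real M)\<rfloor>"
  define s where "s = sqrt (real M)"
  have s1: "s \<ge> 1" using M by (simp add: s_def)
  have Ys: "real Y \<le> s" unfolding Y_def s_def by (rule floor_sqrt_le)
  have Y1: "Y \<ge> 1" unfolding Y_def using floor_sqrt_bounds(1)[OF M] .
  define YY where "YY = {(z,w) \<in> pairs M 1 E. primitive w \<and> nrm2 w \<le> nrm2 z}"
  have fp: "finite (pairs M 1 E)" by (rule finite_pairs) simp
  have fYY: "finite YY" by (rule finite_subset[OF _ fp]) (auto simp: YY_def)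
  have prim: "primitive z \<and> primitive w" if "det2 z w = 1" for z w
  proof -
    have "is_unit d" if d: "d dvd fst z \<and> d dvd snd z \<or> d dvd fst w \<and> d dvd snd w" for d
    proof -
      have "d dvd fst z * snd w" "d dvd snd z * fst w" using d by auto
      then have "d dvd fst z * snd w - snd z * fst w" by (rule dvd_diff)
      then show ?thesis using \<open>det2 z w = 1\<close> by (simp add: det2_def)
    qed
    then show ?thesis unfolding primitive_def by (auto intro: coprimeI)
  qed
  have sub: "pairs M 1 E \<subseteq> YY \<union> swap_pair ` YY"
  proof
    fix x assume x: "x \<in> pairs M 1 E"
    obtain z w where zw: "x = (z, w)" by (cases x)
    have d: "det2 z w = 1" using x by (simp add: zw pairs_def)
    show "x \<in> YY \<union> swap_pair ` YY"
    proof (cases "nrm2 w \<le> nrm2 z")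
      case True
      then show ?thesis using x prim[OF d] by (auto simp: YY_def zw)
    next
      case False
      \<comment> \<open>The preimage of \<open>x\<close> under \<open>swap_pair\<close>.\<close>
      define u where "u = ((- fst w, - snd w), z)"
      have "swap_pair u = x" by (simp add: swap_pair_def u_def zw)
      moreover have "u \<in> YY"
      proof -
        have "det2 (- fst w, - snd w) z = det2 z w" "dot2 (- fst w, - snd w) z = - dot2 z w"
          by (simp_all add: det2_def dot2_def algebra_simps)
        then show ?thesis using x False prim[OF d] swap_pair_props(3)[of w]
          by (simp add: YY_def u_def zw pairs_def E_def)
      qed
      ultimately show ?thesis by blast
    qed
  qed
  have "card (pairs M 1 E) \<le> card (YY \<union> swap_pair ` YY)" using sub fYY by (intro card_mono) auto
  also have "\<dots> \<le> card YY + card (swap_pair ` YY)" by (rule card_Un_le)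
  also have "\<dots> \<le> 2 * card YY" using card_image_le[OF fYY, of swap_pair] by simp
  finally have 1: "card (pairs M 1 E) \<le> 2 * card YY" .
  have m1: "(1::int)\<^sup>2 \<le> int M" using M by simp
  have "real (card YY) \<le> (\<Sum>w\<in>prim_disc Y. real (card (zfiber M 1 E w))) + 3 * real (card (prim_disc Y))"
    using card_long_pairs(1)[OF m1, of E] unfolding YY_def Y_def by linarith
  also have "(\<Sum>w\<in>prim_disc Y. real (card (zfiber M 1 E w))) \<le> 2 * sqrt (real M - 1) * disc_sum Y + real (card (prim_disc Y))"
    using zfiber_sum(1)[OF m1, of Y] unfolding E_def by simp
  also have "2 * sqrt (real M - 1) * disc_sum Y \<le> 2 * s * (8 + 8 * ln (real M))"
  proof (intro mult_mono)
    show "sqrt (real M - 1) \<le> s" by (simp add: s_def)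
    have "real Y \<le> real M"
    proof -
      have "s * 1 \<le> s * s" using s1 by (intro mult_left_mono) auto
      then show ?thesis using Ys by (simp add: s_def)
    qed
    then have "ln (real Y) \<le> ln (real M)" using Y1 by (intro ln_mono) auto
    then show "disc_sum Y \<le> 8 + 8 * ln (real M)" using disc_sum_le[OF Y1] by linarith
    show "0 \<le> disc_sum Y" unfolding disc_sum_def by (intro sum_nonneg inv_norm_nonneg)
  qed (use s1 M in auto)
  finally have "real (card YY) \<le> 2 * s * (8 + 8 * ln (real M)) + 4 * real (card (prim_disc Y))" by linarith
  also have "real (card (prim_disc Y)) \<le> 9 * s" using card_prim_disc_le[of Y] Ys by linarith
  finally have "real (card YY) \<le> s * (52 + 16 * ln (real M))" by (simp add: algebra_simps)
  then show ?thesis using 1 unfolding E_def s_def[symmetric] by (simp add: algebra_simps)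
qed

text \<open>The gcd of the coordinates of \<open>z\<close> divides the determinant \<open>p\<close>
  and is not 1, so it equals \<open>p\<close>. Dividing \<open>z\<close> by \<open>p\<close> gives a
  pair of determinant 1 at level \<open>N div p^2\<close>; the factor \<open>1 / p\<close> gained by
  this makes the sum over \<open>p\<close> harmless.\<close>

lemma card_bad_pairs:
  assumes p: "prime p" and N: "p\<^sup>2 \<le> N"
  shows "real (card (bad_pairs N (int p) E)) \<le> sqrt (real N) / real p * (104 + 32 * ln (real N))"
proof -
  define M where "M = N div p\<^sup>2"
  have p0: "p > 0" using p prime_gt_0_nat by blast
  have M1: "M \<ge> 1" unfolding M_def using N p0 by (simp add: div_greater_zero_iff Suc_le_eq)
  define f where "f = (\<lambda>(z::int\<times>int,w::int\<times>int). ((fst z div int p, snd z div int p), w))"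
  have key: "int p dvd fst z \<and> int p dvd snd z \<and> f (z, w) \<in> pairs M 1 (\<lambda>_. True)" if x: "(z, w) \<in> bad_pairs N (int p) E" for z w
  proof -
    have d: "det2 z w = int p" and c: "(dot2 z w)\<^sup>2 + (int p)\<^sup>2 \<le> int N" and np: "\<not> primitive z"
      using x by (auto simp: bad_pairs_def pairs_def)
    define g where "g = gcd (fst z) (snd z)"
    have "g dvd det2 z w" unfolding det2_def g_def by (intro dvd_diff dvd_mult2) auto
    then have "g dvd int p" using d by simp
    moreover have "g \<noteq> 1" using np by (auto simp: primitive_def g_def coprime_iff_gcd_eq_1)
    moreover have "g \<ge> 0" by (simp add: g_def)
    moreover have "prime (int p)" using p by simp
    ultimately have "g = int p" using prime_int_iff by auto
    then have dv: "int p dvd fst z" "int p dvd snd z" unfolding g_def by (metis gcd_dvd1, metis gcd_dvd2)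
    then obtain a b where ab: "fst z = int p * a" "snd z = int p * b" by (meson dvdE)
    have fz: "f (z, w) = ((a, b), w)" using p0 by (simp add: f_def ab)
    have "det2 z w = int p * det2 (a, b) w" by (simp add: det2_def ab algebra_simps)
    then have 1: "det2 (a, b) w = 1" using d p0 by simp
    have "dot2 z w = int p * dot2 (a, b) w" by (simp add: dot2_def ab algebra_simps)
    then have "(int p)\<^sup>2 * ((dot2 (a, b) w)\<^sup>2 + 1) \<le> int N" using c by (simp add: power_mult_distrib algebra_simps)
    then have "((int p)\<^sup>2 * ((dot2 (a, b) w)\<^sup>2 + 1)) div (int p)\<^sup>2 \<le> int N div (int p)\<^sup>2"
      using p0 by (intro zdiv_mono1) auto
    then have "(dot2 (a, b) w)\<^sup>2 + 1 \<le> int M" using p0 by (simp add: M_def zdiv_int)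
    then show ?thesis using dv fz 1 by (simp add: pairs_def)
  qed
  have "inj_on f (bad_pairs N (int p) E)"
  proof (rule inj_onI)
    fix x y assume x: "x \<in> bad_pairs N (int p) E" and y: "y \<in> bad_pairs N (int p) E" and e: "f x = f y"
    obtain z w z' w' where zw: "x = (z, w)" "y = (z', w')" by (metis prod.exhaust)
    have k: "int p dvd fst z" "int p dvd snd z" "int p dvd fst z'" "int p dvd snd z'" using key x y zw by auto
    have "fst z div int p = fst z' div int p" "snd z div int p = snd z' div int p" "w = w'"
      using e by (auto simp: zw f_def)
    then show "x = y" using k by (metis zw dvd_mult_div_cancel prod_eqI)
  qed
  moreover have "f ` bad_pairs N (int p) E \<subseteq> pairs M 1 (\<lambda>_. True)" using key by auto
  ultimately have "card (bad_pairs N (int p) E) \<le> card (pairs M 1 (\<lambda>_. True))"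
    using finite_pairs[of 1 M "\<lambda>_. True"] by (intro card_inj_on_le) auto
  then have "real (card (bad_pairs N (int p) E)) \<le> sqrt (real M) * (104 + 32 * ln (real M))"
    using card_det_one_pairs[OF M1] by linarith
  also have "\<dots> \<le> (sqrt (real N) / real p) * (104 + 32 * ln (real N))"
  proof (intro mult_mono add_mono mult_left_mono)
    have "real M \<le> real N / real (p\<^sup>2)" unfolding M_def by (rule of_nat_div_le_of_nat)
    then have "sqrt (real M) \<le> sqrt (real N / (real p)\<^sup>2)" by simp
    then show "sqrt (real M) \<le> sqrt (real N) / real p" by (simp add: real_sqrt_divide)
    have "M \<le> N" unfolding M_def by simp
    then show "ln (real M) \<le> ln (real N)" using M1 by simp
  qed (use M1 in auto)
  finally show ?thesis .
qed

section \<open>Representations by pairs of vectors\<close>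

lemma card_two_to_one:
  assumes "finite P" "\<And>x. x \<in> P \<Longrightarrow> card {x' \<in> P. f x' = f x} = 2"
  shows "card P = 2 * card (f ` P)"
proof -
  have "card P = (\<Sum>y\<in>f ` P. \<Sum>x\<in>{x \<in> P. f x = y}. 1)"
    using sum.image_gen[OF assms(1), of "\<lambda>_. 1::nat" f] by simp
  also have "\<dots> = (\<Sum>y\<in>f ` P. 2)" using assms(2) by (intro sum.cong) auto
  finally show ?thesis by simp
qed

lemma parallel_multiple:
  fixes a b c d :: int
  assumes "coprime a b" "a * d = b * c"
  obtains k where "c = k * a" "d = k * b"
proof -
  obtain x y where xy: "x * a + y * b = 1" using bezout_int[of a b] assms(1) by (auto simp: coprime_iff_gcd_eq_1)
  have "(x * c + y * d) * a = x * (c * a) + y * (a * d)" by (simp add: algebra_simps)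
  also have "\<dots> = (x * a + y * b) * c" unfolding assms(2) by (simp add: algebra_simps)
  finally have 1: "c = (x * c + y * d) * a" by (simp add: xy)
  have "(x * c + y * d) * b = x * (b * c) + y * (d * b)" by (simp add: algebra_simps)
  also have "\<dots> = (x * a + y * b) * d" unfolding assms(2)[symmetric] by (simp add: algebra_simps)
  finally have "d = (x * c + y * d) * b" by (simp add: xy)
  with 1 that show ?thesis by blast
qed

lemma parallel_primitive:
  fixes a b c d :: int
  assumes "coprime a b" "coprime c d" "a * d = b * c"
  shows "(c = a \<and> d = b) \<or> (c = - a \<and> d = - b)"
proof -
  obtain k where k: "c = k * a" "d = k * b" using parallel_multiple[OF assms(1,3)] .
  then have "k dvd c" "k dvd d" by auto
  then have "is_unit k" using assms(2) coprime_common_divisor by blast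
  then have "k = 1 \<or> k = -1" by auto
  then show ?thesis using k by auto
qed

text \<open>A singular nonzero integer matrix is a product of a column and a primitive row: the row
  is the primitive part of a nonzero row of the matrix, and the other row, being parallel to a
  primitive vector, is an integer multiple of it.\<close>

lemma rank_one:
  fixes a b c d :: int
  assumes "a * d = b * c" "a \<noteq> 0 \<or> b \<noteq> 0 \<or> c \<noteq> 0 \<or> d \<noteq> 0"
  obtains z1 z2 w1 w2 where "coprime w1 w2" "a = z1 * w1" "b = z1 * w2" "c = z2 * w1" "d = z2 * w2"
proof -
  have main: "\<exists>g w1 w2 k. coprime w1 w2 \<and> a = g * w1 \<and> b = g * w2 \<and> c = k * w1 \<and> d = k * w2"
    if "a * d = b * c" "a \<noteq> 0 \<or> b \<noteq> 0" for a b c d :: int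
  proof -
    define g where "g = gcd a b"
    have g: "g \<noteq> 0" using that by (simp add: g_def)
    define w1 w2 where "w1 = a div g" and "w2 = b div g"
    have ab: "a = g * w1" "b = g * w2" by (auto simp: w1_def w2_def g_def)
    have cop: "coprime w1 w2" unfolding w1_def w2_def g_def using that(2) by (rule div_gcd_coprime)
    have "g * (w1 * d) = g * (w2 * c)" using that(1) by (simp add: ab mult_ac)
    then have "w1 * d = w2 * c" using g by simp
    from parallel_multiple[OF cop this] show ?thesis using ab cop by metis
  qed
  show ?thesis
  proof (cases "a \<noteq> 0 \<or> b \<noteq> 0")
    case True
    from main[OF assms(1) True] show ?thesis using that by blast
  next
    case False
    then have "c * b = d * a" "c \<noteq> 0 \<or> d \<noteq> 0" using assms(2) by auto
    from main[OF this] show ?thesis using that by blast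
  qed
qed

text \<open>Signs are free here, and the two congruences make the entries of the singular matrix
  even, so that it can be halved over the integers.\<close>

definition reps :: "nat \<Rightarrow> int \<Rightarrow> (int \<Rightarrow> bool) \<Rightarrow> (int \<times> int \<times> int) set" where
  "reps N p E = {(a,b,c). a\<^sup>2 + b\<^sup>2 = c\<^sup>2 + p\<^sup>2 \<and> c\<^sup>2 + p\<^sup>2 \<le> int N \<and> even (b - p) \<and> even (a - c) \<and> E c}"

text \<open>In terms of Gaussian integers, \<open>a + ib\<close> is the product of \<open>z\<close> and \<open>w\<close>, and \<open>c + ip\<close> that of
  the conjugate of \<open>z\<close> and \<open>w\<close>.\<close>

definition rep_of :: "(int \<times> int) \<times> (int \<times> int) \<Rightarrow> int \<times> int \<times> int" where
  "rep_of x = (case x of (z,w) \<Rightarrow> (fst z * fst w - snd z * snd w, fst z * snd w + snd z * fst w, dot2 z w))"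

lemma rep_of_image:
  assumes p: "p \<noteq> 0"
  shows "reps N p E = rep_of ` {(z,w) \<in> pairs N p E. primitive w}"
proof
  show "rep_of ` {(z,w) \<in> pairs N p E. primitive w} \<subseteq> reps N p E"
  proof
    fix t assume "t \<in> rep_of ` {(z,w) \<in> pairs N p E. primitive w}"
    then obtain z w where t: "t = rep_of (z, w)" and d: "det2 z w = p" and c: "(dot2 z w)\<^sup>2 + p\<^sup>2 \<le> int N" "E (dot2 z w)"
      by (auto simp: pairs_def)
    have "(fst z * fst w - snd z * snd w)\<^sup>2 + (fst z * snd w + snd z * fst w)\<^sup>2 = (dot2 z w)\<^sup>2 + (det2 z w)\<^sup>2"
      by (simp add: dot2_def det2_def power2_eq_square algebra_simps)
    then show "t \<in> reps N p E" using c unfolding t reps_def rep_of_def d[symmetric]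
      by (simp add: dot2_def det2_def)
  qed
next
  show "reps N p E \<subseteq> rep_of ` {(z,w) \<in> pairs N p E. primitive w}"
  proof
    fix t assume "t \<in> reps N p E"
    then obtain a b c where t: "t = (a, b, c)" and e: "a\<^sup>2 + b\<^sup>2 = c\<^sup>2 + p\<^sup>2" "c\<^sup>2 + p\<^sup>2 \<le> int N" "even (b - p)" "even (a - c)" "E c"
      by (auto simp: reps_def)
    obtain s where s: "b - p = 2 * s" using e(3) by (elim evenE)
    obtain r where r: "a - c = 2 * r" using e(4) by (elim evenE)
    have bs: "b = p + 2 * s" and ar: "a = c + 2 * r" using s r by auto
    \<comment> \<open>The numbers \<open>c + r\<close>, \<open>s + p\<close>, \<open>s\<close>,
      \<open>- r\<close> are the halves of \<open>c + a\<close>, \<open>b + p\<close>,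
      \<open>b - p\<close>, \<open>c - a\<close>; this is the vanishing of the determinant of the
      halved matrix.\<close>
    have "(c + r) * (- r) = (s + p) * s"
    proof -
      have "4 * ((c + r) * (- r)) = c\<^sup>2 - a\<^sup>2" unfolding ar by (simp add: power2_eq_square algebra_simps)
      also have "\<dots> = b\<^sup>2 - p\<^sup>2" using e(1) by simp
      also have "\<dots> = 4 * ((s + p) * s)" unfolding bs by (simp add: power2_eq_square algebra_simps)
      finally show ?thesis by (subst (asm) mult_cancel_left) simp
    qed
    moreover have "c + r \<noteq> 0 \<or> s + p \<noteq> 0 \<or> s \<noteq> 0 \<or> - r \<noteq> 0" using p by auto
    ultimately obtain z1 z2 w1 w2 where w: "coprime w1 w2" "c + r = z1 * w1" "s + p = z1 * w2" "s = z2 * w1" "- r = z2 * w2"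
      by (rule rank_one)
    have d: "dot2 (z1, z2) (w1, w2) = c" using w by (simp add: dot2_def)
    have d2: "det2 (z1, z2) (w1, w2) = p" using w by (simp add: det2_def)
    have "z1 * w1 - z2 * w2 = a" "z1 * w2 + z2 * w1 = b" using w unfolding ar bs by linarith+
    then have "t = rep_of ((z1, z2), (w1, w2))" using d by (simp add: t rep_of_def)
    moreover have "((z1, z2), (w1, w2)) \<in> {(z,w) \<in> pairs N p E. primitive w}"
      using d d2 w e by (simp add: pairs_def primitive_def)
    ultimately show "t \<in> rep_of ` {(z,w) \<in> pairs N p E. primitive w}" by blast
  qed
qed

text \<open>The triple together with \<open>p\<close> determines all four products of a coordinate
  of \<open>z\<close> with a coordinate of \<open>w\<close>, hence the direction of
  \<open>w\<close>; a primitive vector is determined by its direction up to sign, and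
  \<open>z\<close> changes sign with it.\<close>

lemma rep_of_fiber:
  assumes p: "p \<noteq> 0" and x: "(z, w) \<in> prim_pairs N p E"
  shows "{x' \<in> prim_pairs N p E. rep_of x' = rep_of (z, w)} = {(z, w), ((- fst z, - snd z), (- fst w, - snd w))}"
proof -
  obtain z1 z2 w1 w2 where zw: "z = (z1, z2)" "w = (w1, w2)" by (metis prod.exhaust)
  have d: "det2 z w = p" and pr: "primitive z" "primitive w" using x by (auto simp: prim_pairs_def pairs_def)
  have neg: "((- fst z, - snd z), (- fst w, - snd w)) \<in> prim_pairs N p E"
    using x by (simp add: prim_pairs_def pairs_def neg_pair_props primitive_def)
  have "x' = (z, w) \<or> x' = ((- fst z, - snd z), (- fst w, - snd w))"
    if x': "x' \<in> prim_pairs N p E" "rep_of x' = rep_of (z, w)" for x'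
  proof -
    obtain y1 y2 v1 v2 where yv: "x' = ((y1, y2), (v1, v2))" by (metis prod.exhaust)
    have cop: "coprime v1 v2" "coprime w1 w2" using x' pr by (auto simp: yv zw prim_pairs_def primitive_def)
    have d': "y1 * v2 - y2 * v1 = p" using x' by (simp add: yv prim_pairs_def pairs_def det2_def)
    have dd: "z1 * w2 - z2 * w1 = p" using d by (simp add: zw det2_def)
    have "y1 * v1 - y2 * v2 = z1 * w1 - z2 * w2" "y1 * v2 + y2 * v1 = z1 * w2 + z2 * w1" "y1 * v1 + y2 * v2 = z1 * w1 + z2 * w2"
      using x'(2) by (auto simp: rep_of_def yv zw dot2_def)
    \<comment> \<open>The determinant and the three components of \<open>rep_of\<close> are the sums
      and differences of the two diagonal and of the two off-diagonal products.\<close>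
    then have m: "y1 * v1 = z1 * w1" "y2 * v2 = z2 * w2" "y1 * v2 = z1 * w2" "y2 * v1 = z2 * w1" using d' dd by linarith+
    have "w1 * v2 = w2 * v1"
    proof (cases "z1 = 0")
      case False
      have "z1 * (w1 * v2) = (y1 * v1) * v2" unfolding m by simp
      also have "\<dots> = (y1 * v2) * v1" by simp
      also have "\<dots> = z1 * (w2 * v1)" unfolding m by simp
      finally show ?thesis using False by simp
    next
      case True
      then have z2: "z2 \<noteq> 0" using dd p by auto
      have "z2 * (w1 * v2) = (y2 * v1) * v2" unfolding m by simp
      also have "\<dots> = (y2 * v2) * v1" by simp
      also have "\<dots> = z2 * (w2 * v1)" unfolding m by simp
      finally show ?thesis using z2 by simp
    qed
    then consider "v1 = w1" "v2 = w2" | "v1 = - w1" "v2 = - w2" using parallel_primitive[OF cop(2,1)] by blast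
    then show ?thesis
    proof cases
      case 1
      have "w1 \<noteq> 0 \<or> w2 \<noteq> 0" using cop by auto
      then have "y1 = z1 \<and> y2 = z2" using m unfolding 1 by auto
      then show ?thesis by (simp add: yv zw 1)
    next
      case 2
      have "w1 \<noteq> 0 \<or> w2 \<noteq> 0" using cop by auto
      moreover have "(- y1) * w1 = z1 * w1" "(- y2) * w2 = z2 * w2" "(- y1) * w2 = z1 * w2" "(- y2) * w1 = z2 * w1"
        using m unfolding 2 by simp_all
      ultimately have "- y1 = z1 \<and> - y2 = z2" by (metis mult_right_cancel)
      then show ?thesis by (auto simp: yv zw 2)
    qed
  qed
  moreover have "rep_of ((- fst z, - snd z), (- fst w, - snd w)) = rep_of (z, w)" by (simp add: rep_of_def dot2_def)
  ultimately show ?thesis using x neg by auto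
qed

text \<open>On \<open>prim_pairs\<close> the map is exactly two-to-one; the images of
  \<open>bad_pairs\<close> are merely counted as an error.\<close>

lemma card_reps:
  assumes p: "p \<noteq> 0"
  shows "card (prim_pairs N p E) \<le> 2 * card (reps N p E)"
    "2 * card (reps N p E) \<le> card (prim_pairs N p E) + 2 * card (bad_pairs N p E)" "finite (reps N p E)"
proof -
  have fp: "finite (pairs N p E)" using finite_pairs p by blast
  have "prim_pairs N p E \<subseteq> pairs N p E" "bad_pairs N p E \<subseteq> pairs N p E" by (auto simp: prim_pairs_def bad_pairs_def)
  then have fin: "finite (prim_pairs N p E)" "finite (bad_pairs N p E)" using fp finite_subset by blast+
  have "card (prim_pairs N p E) = 2 * card (rep_of ` prim_pairs N p E)"
  proof (rule card_two_to_one[OF fin(1)])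
    fix x assume x: "x \<in> prim_pairs N p E"
    obtain z w where zw: "x = (z, w)" by (cases x)
    have "w \<noteq> (- fst w, - snd w)" using x by (auto simp: zw prim_pairs_def primitive_def prod_eq_iff)
    then show "card {x' \<in> prim_pairs N p E. rep_of x' = rep_of x} = 2"
      unfolding zw rep_of_fiber[OF p x[unfolded zw]] by auto
  qed
  moreover have r: "reps N p E = rep_of ` prim_pairs N p E \<union> rep_of ` bad_pairs N p E"
  proof -
    have "{(z,w) \<in> pairs N p E. primitive w} = prim_pairs N p E \<union> bad_pairs N p E"
      by (auto simp: prim_pairs_def bad_pairs_def)
    then show ?thesis unfolding rep_of_image[OF p] by (simp only: image_Un)
  qed
  moreover show "finite (reps N p E)" unfolding r using fin by auto
  moreover from this have "card (rep_of ` prim_pairs N p E) \<le> card (reps N p E)" unfolding r by (intro card_mono) auto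
  moreover have "card (reps N p E) \<le> card (rep_of ` prim_pairs N p E) + card (rep_of ` bad_pairs N p E)"
    unfolding r by (rule card_Un_le)
  moreover have "card (rep_of ` bad_pairs N p E) \<le> card (bad_pairs N p E)" using fin by (intro card_image_le)
  ultimately show "card (prim_pairs N p E) \<le> 2 * card (reps N p E)"
    "2 * card (reps N p E) \<le> card (prim_pairs N p E) + 2 * card (bad_pairs N p E)" by linarith+
qed

section \<open>Signs and parities: back to solutions in positive integers\<close>

definition pos_reps :: "nat \<Rightarrow> int \<Rightarrow> (int \<Rightarrow> bool) \<Rightarrow> (int \<times> int \<times> int) set" where
  "pos_reps N p E = {(a,b,c) \<in> reps N p E. a > 0 \<and> b > 0 \<and> c > 0}"

text \<open>The eight sign changes of \<open>a\<close>, \<open>b\<close>, \<open>c\<close> preserve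
  \<open>reps\<close>, which accounts for the triples without a zero. If one coordinate is 0, a
  second one of size at most \<open>Y\<close> and the sign of the third determine the triple: at
  most \<open>2 (2 Y + 1) \<le> 6 Y\<close> cases for each of the three coordinates.\<close>

lemma card_pos_reps:
  assumes p: "p \<noteq> 0" and E: "\<And>c. E (- c) = E c" and N: "N \<ge> 1"
  defines "Y \<equiv> nat \<lfloor>sqrt (real N)\<rfloor>"
  shows "8 * card (pos_reps N p E) \<le> card (reps N p E)" "card (reps N p E) \<le> 8 * card (pos_reps N p E) + 18 * Y"
proof -
  define Rz where "Rz = {(a,b,c) \<in> reps N p E. a \<noteq> 0 \<and> b \<noteq> 0 \<and> c \<noteq> 0}"
  have fr: "finite (reps N p E)" using card_reps(3)[OF p] .
  have Rsub: "Rz \<subseteq> reps N p E" by (auto simp: Rz_def)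

  define S where "S = {-1, 1::int}"
  have inv: "(s * a, t * b, u * c) \<in> reps N p E \<longleftrightarrow> (a, b, c) \<in> reps N p E" if "s \<in> S" "t \<in> S" "u \<in> S" for s t u a b c
  proof -
    have "(s * a)\<^sup>2 = a\<^sup>2" "(t * b)\<^sup>2 = b\<^sup>2" "(u * c)\<^sup>2 = c\<^sup>2" using that by (auto simp: S_def)
    moreover have "even (t * b - p) = even (b - p)" "even (s * a - u * c) = even (a - c)" using that by (auto simp: S_def)
    moreover have "E (u * c) = E c"
    proof (cases "u = 1")
      case False
      then have "u * c = - c" using that(3) by (simp add: S_def)
      then show ?thesis by (simp only: E)
    qed simp
    ultimately show ?thesis by (simp only: reps_def mem_Collect_eq case_prod_conv)
  qed
  have S0: "s \<noteq> 0" if "s \<in> S" for s using that by (auto simp: S_def)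
  have sgS: "sgn a \<in> S" if "a \<noteq> 0" for a using that by (auto simp: S_def sgn_if)
  have ab: "\<bar>a\<bar> = sgn a * a" for a :: int by (simp add: abs_sgn mult.commute)
  define f where "f = (\<lambda>((a,b,c),(s,t,u)). (s * a, t * b, u * c) :: int \<times> int \<times> int)"
  have bij: "bij_betw f (pos_reps N p E \<times> (S \<times> S \<times> S)) Rz"
  proof (rule bij_betw_byWitness[where f' = "\<lambda>(a,b,c). ((\<bar>a\<bar>,\<bar>b\<bar>,\<bar>c\<bar>),(sgn a, sgn b, sgn c))"])
    show "\<forall>x\<in>pos_reps N p E \<times> (S \<times> S \<times> S). (\<lambda>(a,b,c). ((\<bar>a\<bar>,\<bar>b\<bar>,\<bar>c\<bar>),(sgn a, sgn b, sgn c))) (f x) = x"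
      by (auto simp: f_def pos_reps_def S_def)
    show "\<forall>x\<in>Rz. f ((\<lambda>(a,b,c). ((\<bar>a\<bar>,\<bar>b\<bar>,\<bar>c\<bar>),(sgn a, sgn b, sgn c))) x) = x"
      by (auto simp: f_def sgn_mult_abs)
    show "f ` (pos_reps N p E \<times> (S \<times> S \<times> S)) \<subseteq> Rz"
      by (auto simp: f_def pos_reps_def Rz_def inv S0)
    show "(\<lambda>(a,b,c). ((\<bar>a\<bar>,\<bar>b\<bar>,\<bar>c\<bar>),(sgn a, sgn b, sgn c))) ` Rz \<subseteq> pos_reps N p E \<times> (S \<times> S \<times> S)"
    proof
      fix x assume "x \<in> (\<lambda>(a,b,c). ((\<bar>a\<bar>,\<bar>b\<bar>,\<bar>c\<bar>),(sgn a, sgn b, sgn c))) ` Rz"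
      then obtain a b c where x: "x = ((\<bar>a\<bar>,\<bar>b\<bar>,\<bar>c\<bar>),(sgn a, sgn b, sgn c))" and r: "(a, b, c) \<in> reps N p E"
        and nz: "a \<noteq> 0" "b \<noteq> 0" "c \<noteq> 0" by (auto simp: Rz_def)
      have "(\<bar>a\<bar>,\<bar>b\<bar>,\<bar>c\<bar>) \<in> reps N p E" unfolding ab using inv[OF sgS sgS sgS] nz r by blast
      then show "x \<in> pos_reps N p E \<times> (S \<times> S \<times> S)" unfolding x using sgS nz by (simp add: pos_reps_def)
    qed
  qed
  have "card Rz = card (pos_reps N p E \<times> (S \<times> S \<times> S))" using bij_betw_same_card[OF bij] by simp
  also have "\<dots> = 8 * card (pos_reps N p E)" by (simp add: card_cartesian_product S_def)
  finally have cz: "card Rz = 8 * card (pos_reps N p E)" .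
  then show "8 * card (pos_reps N p E) \<le> card (reps N p E)" using card_mono[OF fr Rsub] by simp
  have Y1: "Y \<ge> 1" unfolding Y_def using floor_sqrt_bounds(1)[OF N] .
  define T where "T = {- int Y..int Y} \<times> (UNIV :: bool set)"
  have cT: "card T \<le> 6 * Y" using Y1 by (simp add: T_def card_cartesian_product)
  have fT: "finite T" by (simp add: T_def)
  have inY: "x \<in> {- int Y..int Y}" if "x\<^sup>2 \<le> int N" for x using abs_le_floor_sqrt[OF that] by (auto simp: Y_def abs_le_iff)
  have sq: "x = y" if "x\<^sup>2 = y\<^sup>2" "(x > 0) = (y > 0)" for x y :: int
    using that by (auto simp: power2_eq_iff)
  have A: "card {(a,b,c) \<in> reps N p E. a = 0} \<le> card T"
  proof (rule card_inj_on_le[where f = "\<lambda>(a,b,c). (c, b > 0)"])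
    show "inj_on (\<lambda>(a,b,c). (c, b > 0)) {(a,b,c) \<in> reps N p E. a = 0}"
    proof (rule inj_onI)
      fix x y assume x: "x \<in> {(a,b,c) \<in> reps N p E. a = 0}" and y: "y \<in> {(a,b,c) \<in> reps N p E. a = 0}"
        and e: "(\<lambda>(a,b,c). (c, b > 0)) x = (\<lambda>(a,b,c). (c, b > 0)) y"
      obtain a b c a' b' c' where xy: "x = (a,b,c)" "y = (a',b',c')" by (metis prod.exhaust)
      have "a = 0" "a' = 0" "b\<^sup>2 = c\<^sup>2 + p\<^sup>2" "b'\<^sup>2 = c'\<^sup>2 + p\<^sup>2" using x y by (auto simp: xy reps_def)
      moreover have "c = c'" "(b > 0) = (b' > 0)" using e by (auto simp: xy)
      ultimately show "x = y" using sq[of b b'] by (simp add: xy)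
    qed
    show "(\<lambda>(a,b,c). (c, b > 0)) ` {(a,b,c) \<in> reps N p E. a = 0} \<subseteq> T"
    proof
      fix x assume "x \<in> (\<lambda>(a,b,c). (c, b > 0)) ` {(a,b,c) \<in> reps N p E. a = 0}"
      then obtain a b c where r: "(a,b,c) \<in> reps N p E" "a = 0" and x: "x = (c, b > 0)" by auto
      have "a\<^sup>2 + b\<^sup>2 = c\<^sup>2 + p\<^sup>2" "c\<^sup>2 + p\<^sup>2 \<le> int N" using r by (auto simp: reps_def)
      then have "c\<^sup>2 \<le> int N" using zero_le_power2[of p] zero_le_power2[of b] by linarith
      then show "x \<in> T" unfolding x T_def using inY by blast
    qed
  qed (rule fT)
  have B: "card {(a,b,c) \<in> reps N p E. b = 0} \<le> card T"
  proof (rule card_inj_on_le[where f = "\<lambda>(a,b,c). (c, a > 0)"])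
    show "inj_on (\<lambda>(a,b,c). (c, a > 0)) {(a,b,c) \<in> reps N p E. b = 0}"
    proof (rule inj_onI)
      fix x y assume x: "x \<in> {(a,b,c) \<in> reps N p E. b = 0}" and y: "y \<in> {(a,b,c) \<in> reps N p E. b = 0}"
        and e: "(\<lambda>(a,b,c). (c, a > 0)) x = (\<lambda>(a,b,c). (c, a > 0)) y"
      obtain a b c a' b' c' where xy: "x = (a,b,c)" "y = (a',b',c')" by (metis prod.exhaust)
      have "b = 0" "b' = 0" "a\<^sup>2 = c\<^sup>2 + p\<^sup>2" "a'\<^sup>2 = c'\<^sup>2 + p\<^sup>2" using x y by (auto simp: xy reps_def)
      moreover have "c = c'" "(a > 0) = (a' > 0)" using e by (auto simp: xy)
      ultimately show "x = y" using sq[of a a'] by (simp add: xy)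
    qed
    show "(\<lambda>(a,b,c). (c, a > 0)) ` {(a,b,c) \<in> reps N p E. b = 0} \<subseteq> T"
    proof
      fix x assume "x \<in> (\<lambda>(a,b,c). (c, a > 0)) ` {(a,b,c) \<in> reps N p E. b = 0}"
      then obtain a b c where r: "(a,b,c) \<in> reps N p E" "b = 0" and x: "x = (c, a > 0)" by auto
      have "a\<^sup>2 + b\<^sup>2 = c\<^sup>2 + p\<^sup>2" "c\<^sup>2 + p\<^sup>2 \<le> int N" using r by (auto simp: reps_def)
      then have "c\<^sup>2 \<le> int N" using zero_le_power2[of p] zero_le_power2[of b] by linarith
      then show "x \<in> T" unfolding x T_def using inY by blast
    qed
  qed (rule fT)
  have C: "card {(a,b,c) \<in> reps N p E. c = 0} \<le> card T"
  proof (rule card_inj_on_le[where f = "\<lambda>(a,b,c). (a, b > 0)"])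
    show "inj_on (\<lambda>(a,b,c). (a, b > 0)) {(a,b,c) \<in> reps N p E. c = 0}"
    proof (rule inj_onI)
      fix x y assume x: "x \<in> {(a,b,c) \<in> reps N p E. c = 0}" and y: "y \<in> {(a,b,c) \<in> reps N p E. c = 0}"
        and e: "(\<lambda>(a,b,c). (a, b > 0)) x = (\<lambda>(a,b,c). (a, b > 0)) y"
      obtain a b c a' b' c' where xy: "x = (a,b,c)" "y = (a',b',c')" by (metis prod.exhaust)
      have "c = 0" "c' = 0" "b\<^sup>2 = p\<^sup>2 - a\<^sup>2" "b'\<^sup>2 = p\<^sup>2 - a'\<^sup>2" using x y by (auto simp: xy reps_def)
      moreover have "a = a'" "(b > 0) = (b' > 0)" using e by (auto simp: xy)
      ultimately show "x = y" using sq[of b b'] by (simp add: xy)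
    qed
    show "(\<lambda>(a,b,c). (a, b > 0)) ` {(a,b,c) \<in> reps N p E. c = 0} \<subseteq> T"
    proof
      fix x assume "x \<in> (\<lambda>(a,b,c). (a, b > 0)) ` {(a,b,c) \<in> reps N p E. c = 0}"
      then obtain a b c where r: "(a,b,c) \<in> reps N p E" "c = 0" and x: "x = (a, b > 0)" by auto
      have "a\<^sup>2 + b\<^sup>2 = c\<^sup>2 + p\<^sup>2" "c\<^sup>2 + p\<^sup>2 \<le> int N" using r by (auto simp: reps_def)
      then have "a\<^sup>2 \<le> int N" using zero_le_power2[of p] zero_le_power2[of b] by linarith
      then show "x \<in> T" unfolding x T_def using inY by blast
    qed
  qed (rule fT)
  define ZA ZB ZC where "ZA = {(a,b,c) \<in> reps N p E. a = 0}" and "ZB = {(a,b,c) \<in> reps N p E. b = 0}"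
    and "ZC = {(a,b,c) \<in> reps N p E. c = 0}"
  have "reps N p E = Rz \<union> (ZA \<union> (ZB \<union> ZC))" by (auto simp: Rz_def ZA_def ZB_def ZC_def)
  then have "card (reps N p E) = card (Rz \<union> (ZA \<union> (ZB \<union> ZC)))" by (rule arg_cong)
  moreover have "card ZA \<le> card T" "card ZB \<le> card T" "card ZC \<le> card T" using A B C unfolding ZA_def ZB_def ZC_def .
  ultimately show "card (reps N p E) \<le> 8 * card (pos_reps N p E) + 18 * Y"
    using card_Un_le[of Rz "ZA \<union> (ZB \<union> ZC)"] card_Un_le[of ZA "ZB \<union> ZC"] card_Un_le[of ZB ZC] cz cT by linarith
qed

definition sols :: "nat \<Rightarrow> nat \<Rightarrow> (nat \<times> nat \<times> nat) set" where
  "sols N p = {(a,b,c). 0 < a \<and> 0 < b \<and> 0 < c \<and> a\<^sup>2 + b\<^sup>2 = c\<^sup>2 + p\<^sup>2 \<and> c\<^sup>2 + p\<^sup>2 \<le> N}"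

lemma sols_int:
  "(a,b,c) \<in> sols N p \<longleftrightarrow> 0 < a \<and> 0 < b \<and> 0 < c \<and> (int a)\<^sup>2 + (int b)\<^sup>2 = (int c)\<^sup>2 + (int p)\<^sup>2 \<and> (int c)\<^sup>2 + (int p)\<^sup>2 \<le> int N"
proof -
  have "a\<^sup>2 + b\<^sup>2 = c\<^sup>2 + p\<^sup>2 \<longleftrightarrow> int (a\<^sup>2 + b\<^sup>2) = int (c\<^sup>2 + p\<^sup>2)" by (simp only: of_nat_eq_iff)
  moreover have "c\<^sup>2 + p\<^sup>2 \<le> N \<longleftrightarrow> int (c\<^sup>2 + p\<^sup>2) \<le> int N" by (simp only: of_nat_le_iff)
  ultimately show ?thesis by (simp add: sols_def)
qed

text \<open>Parity alone leaves open the case of \<open>a\<close>, \<open>b\<close> even and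
  \<open>c\<close>, \<open>p\<close> odd; it is excluded modulo 4, where the two sides are 0 and
  2.\<close>

lemma sum_squares_parity:
  fixes a b c p :: int
  assumes eq: "a\<^sup>2 + b\<^sup>2 = c\<^sup>2 + p\<^sup>2" and p: "odd p"
  shows "odd b \<Longrightarrow> even (a - c)" "even b \<Longrightarrow> odd a \<and> even c"
proof -
  have "even (a\<^sup>2 + b\<^sup>2) \<longleftrightarrow> even (c\<^sup>2 + p\<^sup>2)" using eq by simp
  then have par: "(even a \<longleftrightarrow> even b) \<longleftrightarrow> (even c \<longleftrightarrow> even p)" by simp
  show "even (a - c)" if "odd b" using that par p by auto
  show "odd a \<and> even c" if b: "even b"
  proof -
    have "even c"
    proof (rule ccontr)
      assume c: "odd c"
      then have a: "even a" using par b p by auto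
      obtain a' b' c' p' where s: "a = 2 * a'" "b = 2 * b'" "c = 2 * c' + 1" "p = 2 * p' + 1"
        using a b c p by (metis evenE oddE)
      have "4 * (a' * a' + b' * b') = 4 * (c' * c' + c' + p' * p' + p') + 2"
        using eq unfolding s by (simp add: power2_eq_square algebra_simps)
      then show False by presburger
    qed
    then show "odd a \<and> even c" using par b p by auto
  qed
qed

text \<open>If \<open>b\<close> is odd, the congruences of \<open>reps\<close> hold as they stand.
  If \<open>b\<close> is even, then \<open>a\<close> is odd and \<open>c\<close> even, and they hold
  after exchanging \<open>a\<close> and \<open>b\<close>. The second class consists of the
  representations with even \<open>c\<close>, which is the origin of the parameter
  \<open>E\<close>.\<close>

lemma card_sols_odd:
  assumes p: "odd p"
  shows "card (sols N p) = card (pos_reps N (int p) (\<lambda>_. True)) + card (pos_reps N (int p) even)"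
proof -
  have p0: "int p \<noteq> 0" using p by (cases "p = 0") auto
  have op: "odd (int p)" using p by simp
  define So where "So = {(a,b,c) \<in> sols N p. odd b}"
  define Se where "Se = {(a,b,c) \<in> sols N p. even b}"
  have b1: "bij_betw (\<lambda>(a,b,c). (int a, int b, int c)) So (pos_reps N (int p) (\<lambda>_. True))"
  proof (rule bij_betw_byWitness[where f' = "\<lambda>(a,b,c). (nat a, nat b, nat c)"])
    show "(\<lambda>(a,b,c). (int a, int b, int c)) ` So \<subseteq> pos_reps N (int p) (\<lambda>_. True)"
    proof
      fix x assume "x \<in> (\<lambda>(a,b,c). (int a, int b, int c)) ` So"
      then obtain a b c where x: "x = (int a, int b, int c)" and s: "(a,b,c) \<in> sols N p" "odd b" by (auto simp: So_def)
      note i = s(1)[unfolded sols_int]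
      have "even (int a - int c)" using sum_squares_parity(1)[of "int a" "int b" "int c" "int p"] i op s(2) by simp
      moreover have "even (int b - int p)" using s(2) op by simp
      ultimately show "x \<in> pos_reps N (int p) (\<lambda>_. True)" using i by (simp add: x pos_reps_def reps_def)
    qed
    show "(\<lambda>(a,b,c). (nat a, nat b, nat c)) ` pos_reps N (int p) (\<lambda>_. True) \<subseteq> So"
    proof
      fix x assume "x \<in> (\<lambda>(a,b,c). (nat a, nat b, nat c)) ` pos_reps N (int p) (\<lambda>_. True)"
      then obtain a b c where x: "x = (nat a, nat b, nat c)" and r: "(a,b,c) \<in> reps N (int p) (\<lambda>_. True)" and pos: "a > 0" "b > 0" "c > 0"
        by (auto simp: pos_reps_def)
      have "(nat a, nat b, nat c) \<in> sols N p" using r pos by (simp add: sols_int reps_def)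
      moreover have "odd b" using r op by (auto simp: reps_def)
      then have "odd (nat b)" using pos by (simp add: even_nat_iff)
      ultimately show "x \<in> So" by (simp add: x So_def)
    qed
  qed (auto simp: pos_reps_def)
  have b2: "bij_betw (\<lambda>(a,b,c). (int b, int a, int c)) Se (pos_reps N (int p) even)"
  proof (rule bij_betw_byWitness[where f' = "\<lambda>(a,b,c). (nat b, nat a, nat c)"])
    show "(\<lambda>(a,b,c). (int b, int a, int c)) ` Se \<subseteq> pos_reps N (int p) even"
    proof
      fix x assume "x \<in> (\<lambda>(a,b,c). (int b, int a, int c)) ` Se"
      then obtain a b c where x: "x = (int b, int a, int c)" and s: "(a,b,c) \<in> sols N p" "even b" by (auto simp: Se_def)
      note i = s(1)[unfolded sols_int]
      have "odd (int a) \<and> even (int c)" using sum_squares_parity(2)[of "int a" "int b" "int c" "int p"] i op s(2) by simp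
      then show "x \<in> pos_reps N (int p) even" using i s(2) op by (simp add: x pos_reps_def reps_def add.commute)
    qed
    show "(\<lambda>(a,b,c). (nat b, nat a, nat c)) ` pos_reps N (int p) even \<subseteq> Se"
    proof
      fix x assume "x \<in> (\<lambda>(a,b,c). (nat b, nat a, nat c)) ` pos_reps N (int p) even"
      then obtain a b c where x: "x = (nat b, nat a, nat c)" and r: "(a,b,c) \<in> reps N (int p) even" and pos: "a > 0" "b > 0" "c > 0"
        by (auto simp: pos_reps_def)
      have "(nat b, nat a, nat c) \<in> sols N p" using r pos by (simp add: sols_int reps_def add.commute)
      moreover have "even a" using r by (auto simp: reps_def)
      then have "even (nat a)" using pos by (simp add: even_nat_iff)
      ultimately show "x \<in> Se" by (simp add: x Se_def)
    qed
  qed (auto simp: pos_reps_def)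
  have fp: "finite (pos_reps N (int p) E)" for E
    by (rule finite_subset[OF _ card_reps(3)[OF p0]]) (auto simp: pos_reps_def)
  have fin: "finite So" "finite Se" using bij_betw_finite[OF b1] bij_betw_finite[OF b2] fp by auto
  have "sols N p = So \<union> Se" by (auto simp: So_def Se_def)
  moreover have "So \<inter> Se = {}" by (auto simp: So_def Se_def)
  ultimately have "card (sols N p) = card So + card Se" using fin by (simp add: card_Un_disjoint)
  then show ?thesis using bij_betw_same_card[OF b1] bij_betw_same_card[OF b2] by simp
qed

text \<open>For \<open>p = 2\<close> the correspondence with \<open>reps\<close> is not one-to-one,
  but an upper bound suffices: a single prime contributes only O(sqrt N ln N). The case of
  \<open>a\<close>, \<open>b\<close> odd is again impossible modulo 4.\<close>

lemma card_sols_two: "card (sols N 2) \<le> 2 * card (reps N 2 (\<lambda>_. True))"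
proof -
  define R where "R = reps N 2 (\<lambda>_. True)"
  have fR: "finite R" unfolding R_def by (rule card_reps(3)) simp
  define f where "f = (\<lambda>(a,b,c). (nat a, nat b, nat c))"
  define g where "g = (\<lambda>(a,b,c). (nat b, nat a, nat c))"
  have "sols N 2 \<subseteq> f ` R \<union> g ` R"
  proof
    fix x assume x: "x \<in> sols N 2"
    obtain a b c where abc: "x = (a,b,c)" by (metis prod.exhaust)
    note i = x[unfolded abc sols_int, simplified]
    have par: "(even a \<longleftrightarrow> even b) \<longleftrightarrow> even c"
    proof -
      have "even ((int a)\<^sup>2 + (int b)\<^sup>2) \<longleftrightarrow> even ((int c)\<^sup>2 + 4)" using i by simp
      then show ?thesis by simp
    qed
    have "(int a, int b, int c) \<in> R \<or> (int b, int a, int c) \<in> R"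
    proof (cases "even b")
      case True
      then have "even (int a - int c)" using par by auto
      then show ?thesis using True i by (auto simp: R_def reps_def)
    next
      case bo: False
      show ?thesis
      proof (cases "even a")
        case True
        then have "even (int b - int c)" using par bo by auto
        then show ?thesis using True i by (auto simp: R_def reps_def add.commute)
      next
        case ao: False
        then have ce: "even c" using par bo by auto
        obtain a' b' c' where s: "a = 2 * a' + 1" "b = 2 * b' + 1" "c = 2 * c'"
          using ao bo ce by (metis evenE oddE)
        have "4 * (int a' * int a' + int a' + int b' * int b' + int b') + 2 = 4 * (int c' * int c' + 1)"
          using i unfolding s by (simp add: power2_eq_square algebra_simps)
        then have False by presburger
        then show ?thesis ..
      qed
    qed
    then show "x \<in> f ` R \<union> g ` R" unfolding abc
    proof
      assume "(int a, int b, int c) \<in> R"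
      then have "f (int a, int b, int c) \<in> f ` R" by (rule imageI)
      then show "(a,b,c) \<in> f ` R \<union> g ` R" by (simp add: f_def)
    next
      assume "(int b, int a, int c) \<in> R"
      then have "g (int b, int a, int c) \<in> g ` R" by (rule imageI)
      then show "(a,b,c) \<in> f ` R \<union> g ` R" by (simp add: g_def)
    qed
  qed
  then have "card (sols N 2) \<le> card (f ` R \<union> g ` R)" using fR by (intro card_mono) auto
  also have "\<dots> \<le> card (f ` R) + card (g ` R)" by (rule card_Un_le)
  also have "\<dots> \<le> card R + card R" using fR by (intro add_mono card_image_le)
  finally show ?thesis by (simp add: R_def)
qed

lemma reps_estimate:
  assumes p: "prime p" and N: "p\<^sup>2 \<le> N"
  defines "Y \<equiv> nat \<lfloor>sqrt (real N)\<rfloor>"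
  shows "\<bar>real (card (reps N (int p) (\<lambda>_. True))) - 2 * sqrt (real N - (real p)\<^sup>2) * disc_sum Y\<bar>
      \<le> 50 * sqrt (real N) + 2 * (sqrt (real N) / real p * (104 + 32 * ln (real N)))"
    "odd p \<Longrightarrow> \<bar>real (card (reps N (int p) even)) - sqrt (real N - (real p)\<^sup>2) * odd_disc_sum Y\<bar>
      \<le> 50 * sqrt (real N) + 2 * (sqrt (real N) / real p * (104 + 32 * ln (real N)))"
proof -
  have p0: "int p \<noteq> 0" using p prime_gt_0_nat[of p] by simp
  have m: "(int p)\<^sup>2 \<le> int N" using N by (simp flip: of_nat_power)
  have D: "real (card (prim_disc Y)) \<le> 9 * sqrt (real N)"
    using card_prim_disc_le[of Y] floor_sqrt_le[of N] unfolding Y_def by linarith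
  define B where "B = sqrt (real N) / real p * (104 + 32 * ln (real N))"
  \<comment> \<open>Halving the error \<open>11 D + 4 bad_pairs\<close> of the doubled count, with
    \<open>D \<le> 9 sqrt N\<close>, gives 49.5, rounded to 50.\<close>
  have gen: "\<bar>real (card (reps N (int p) E)) - M\<bar> \<le> 50 * sqrt (real N) + 2 * B"
    if E: "\<And>c. E (- c) = E c" and M: "\<bar>(\<Sum>w\<in>prim_disc Y. real (card (zfiber N (int p) E w))) - M\<bar> \<le> real (card (prim_disc Y))" for E M
  proof -
    have "\<bar>real (card (prim_pairs N (int p) E)) - 2 * M\<bar> \<le> 11 * real (card (prim_disc Y)) + 2 * real (card (bad_pairs N (int p) E))"
      unfolding Y_def by (rule card_prim_pairs[where E = E, OF m p0 E]) (use M in \<open>simp_all add: Y_def\<close>)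
    moreover have "real (card (bad_pairs N (int p) E)) \<le> B" unfolding B_def by (rule card_bad_pairs[OF p N])
    ultimately show ?thesis using card_reps(1,2)[OF p0, of N E] D unfolding abs_le_iff by linarith
  qed
  show "\<bar>real (card (reps N (int p) (\<lambda>_. True))) - 2 * sqrt (real N - (real p)\<^sup>2) * disc_sum Y\<bar>
      \<le> 50 * sqrt (real N) + 2 * (sqrt (real N) / real p * (104 + 32 * ln (real N)))"
    unfolding B_def[symmetric] by (rule gen) (use zfiber_sum(1)[OF m, of Y] in simp_all)
  show "\<bar>real (card (reps N (int p) even)) - sqrt (real N - (real p)\<^sup>2) * odd_disc_sum Y\<bar>
      \<le> 50 * sqrt (real N) + 2 * (sqrt (real N) / real p * (104 + 32 * ln (real N)))" if "odd p"
    unfolding B_def[symmetric] by (rule gen) (use zfiber_sum(2)[OF m, of Y] that in simp_all)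
qed

text \<open>Eight times the number of solutions is the sum of the two counts of representations,
  with main terms \<open>2 L D\<close> and \<open>L Do\<close>. Here \<open>Do\<close> is
  \<open>2/3 D\<close> and \<open>D\<close> is \<open>6 / pi * ln Y\<close>, so the constant is
  \<open>(2 + 2/3) * 6 / pi / 8 = 2 / pi\<close>. The term with \<open>1 / p\<close> in the error
  comes from the imprimitive vectors.\<close>

lemma sols_estimate:
  obtains K where "K > 0" "\<And>N p. prime p \<Longrightarrow> p\<^sup>2 \<le> N \<Longrightarrow>
    \<bar>real (card (sols N p)) - 2 / pi * (sqrt (real N - (real p)\<^sup>2) * ln (real (nat \<lfloor>sqrt (real N)\<rfloor>)))\<bar>
      \<le> K * (sqrt (real N) * (1 + ln (real N) / real p))"
proof -
  obtain C where C: "\<And>Y. Y \<ge> 1 \<Longrightarrow> \<bar>disc_sum Y - 6 / pi * ln (real Y)\<bar> \<le> C" using disc_sum_asymp by blast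
  have C0: "C \<ge> 0" using C[of 1] by linarith
  define K where "K = 3 * C + 1000"
  show ?thesis
  proof (rule that[of K])
    show "K > 0" using C0 by (simp add: K_def)
    fix N p :: nat assume p: "prime p" and N: "p\<^sup>2 \<le> N"
    define Y where "Y = nat \<lfloor>sqrt (real N)\<rfloor>"
    define s where "s = sqrt (real N)"
    define L where "L = sqrt (real N - (real p)\<^sup>2)"
    define B where "B = s / real p * (104 + 32 * ln (real N))"
    have p2: "p \<ge> 2" using p prime_ge_2_nat by blast
    have N1: "N \<ge> 4" using N power_mono[OF p2, of 2] by simp
    have Y1: "Y \<ge> 1" unfolding Y_def using floor_sqrt_bounds(1)[of N] N1 by simp
    have Ys: "real Y \<le> s" unfolding Y_def s_def by (rule floor_sqrt_le)
    have s0: "s \<ge> 0" by (simp add: s_def)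
    have "real (p\<^sup>2) \<le> real N" using N by (simp only: of_nat_le_iff)
    then have L: "0 \<le> L" "L \<le> s" by (auto simp: L_def s_def)
    have lnN: "ln (real N) \<ge> 0" using N1 by simp
    have B: "B \<le> s * (104 + 32 * (ln (real N) / real p))"
    proof -
      have "104 / real p \<le> 104 / 1" using p2 by (intro divide_left_mono) auto
      then have "(104 + 32 * ln (real N)) / real p \<le> 104 + 32 * (ln (real N) / real p)" by (simp add: add_divide_distrib)
      from mult_left_mono[OF this s0] show ?thesis by (simp add: B_def)
    qed
    define q where "q = ln (real N) / real p"
    have q0: "q \<ge> 0" using lnN by (simp add: q_def)
    have sq: "s * q \<ge> 0" using s0 q0 by simp
    have B': "B \<le> 104 * s + 32 * (s * q)" using B by (simp add: q_def algebra_simps)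
    define l where "l = ln (real Y)"
    have l0: "l \<ge> 0" using Y1 by (simp add: l_def)
    have Kr: "K * (s * (1 + q)) = 3 * (C * s) + 1000 * s + 3 * (C * (s * q)) + 1000 * (s * q)" by (simp add: K_def algebra_simps)
    have Cs: "C * s \<ge> 0" "C * (s * q) \<ge> 0" using C0 s0 sq by auto
    note rT = reps_estimate(1)[OF p N, folded Y_def s_def L_def, folded B_def]
    define mm where "mm = 2 / pi * (L * l)"
    have "\<bar>real (card (sols N p)) - mm\<bar> \<le> K * (s * (1 + q))"
    proof (cases "odd p")
      case True
      have p0: "int p \<noteq> 0" using p2 by simp
      note re = reps_estimate(2)[OF p N True, folded Y_def s_def L_def, folded B_def]
      have N1': "N \<ge> 1" using N1 by simp
      note pT = card_pos_reps[where E = "\<lambda>_. True", OF p0 refl N1', folded Y_def]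
      have ev: "even (- c) = even c" for c :: int by simp
      note pe = card_pos_reps[where E = even, OF p0 ev N1', folded Y_def]
      have F: "real (card (sols N p)) = real (card (pos_reps N (int p) (\<lambda>_. True))) + real (card (pos_reps N (int p) even))"
        using card_sols_odd[OF True] by simp
      define D where "D = disc_sum Y"
      define Do where "Do = odd_disc_sum Y"
      \<comment> \<open>Each of the two counts has error \<open>50 s + 2 B\<close>, and the triples
        with a zero coordinate add \<open>18 Y\<close> twice: 100 + 36 = 136.\<close>
      have r1: "\<bar>8 * real (card (sols N p)) - (2 * L * D + L * Do)\<bar> \<le> 136 * s + 4 * B"
        using rT re pT pe F Ys unfolding D_def Do_def abs_le_iff by linarith
      have "\<bar>Do - 2 / 3 * D\<bar> \<le> 6" unfolding Do_def D_def by (rule odd_disc_sum_approx[OF Y1])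
      moreover have "\<bar>D - 6 / pi * l\<bar> \<le> C" unfolding D_def l_def by (rule C[OF Y1])
      ultimately have "\<bar>2 * D + Do - 8 / 3 * (6 / pi * l)\<bar> \<le> 8 / 3 * C + 6" unfolding abs_le_iff by linarith
      then have "L * \<bar>2 * D + Do - 8 / 3 * (6 / pi * l)\<bar> \<le> s * (8 / 3 * C + 6)" using L s0 C0 by (intro mult_mono) auto
      moreover have "L * \<bar>2 * D + Do - 8 / 3 * (6 / pi * l)\<bar> = \<bar>(2 * L * D + L * Do) - 8 * (mm)\<bar>"
      proof -
        have "(2 * L * D + L * Do) - 8 * (mm) = L * (2 * D + Do - 8 / 3 * (6 / pi * l))" by (simp add: mm_def algebra_simps)
        then show ?thesis using L by (simp add: abs_mult)
      qed
      ultimately have "\<bar>(2 * L * D + L * Do) - 8 * (mm)\<bar> \<le> 8 / 3 * (C * s) + 6 * s" by (simp add: algebra_simps)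
      then have "\<bar>8 * real (card (sols N p)) - 8 * mm\<bar> \<le> (136 * s + 4 * B) + (8 / 3 * (C * s) + 6 * s)"
      proof -
        assume b: "\<bar>2 * L * D + L * Do - 8 * mm\<bar> \<le> 8 / 3 * (C * s) + 6 * s"
        have tri: "\<bar>u - w\<bar> \<le> \<bar>u - v\<bar> + \<bar>v - w\<bar>" for u v w :: real by linarith
        show ?thesis by (rule order_trans[OF tri add_mono[OF r1 b]])
      qed
      moreover have "\<bar>8 * real (card (sols N p)) - 8 * mm\<bar> = 8 * \<bar>real (card (sols N p)) - mm\<bar>"
      proof -
        have "8 * real (card (sols N p)) - 8 * mm = 8 * (real (card (sols N p)) - mm)" by simp
        then show ?thesis by (simp only: abs_mult abs_numeral)
      qed
      ultimately have "8 * \<bar>real (card (sols N p)) - mm\<bar> \<le> 8 / 3 * (C * s) + 6 * s + 136 * s + 4 * B" by linarith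
      moreover have "v \<le> 3 * Cs + 1000 * s + 3 * Csq + 1000 * sq"
        if "8 * v \<le> 8 / 3 * Cs + 6 * s + 136 * s + 4 * B" "B \<le> 104 * s + 32 * sq" "0 \<le> Cs" "0 \<le> Csq" "0 \<le> s" "0 \<le> sq"
        for v Cs s B sq Csq :: real using that by linarith
      ultimately show ?thesis using B' Cs s0 sq unfolding Kr by blast
    next
      case False
      then have p2': "p = 2" using p primes_dvd_imp_eq two_is_prime_nat by blast
      have "real (card (sols N p)) \<le> 2 * real (card (reps N (int p) (\<lambda>_. True)))"
        using card_sols_two[of N] by (simp add: p2')
      then have 1: "real (card (sols N p)) \<le> 4 * (L * disc_sum Y) + 100 * s + 4 * B"
        using rT unfolding abs_le_iff by linarith
      \<comment> \<open>For \<open>p = 2\<close> one has \<open>q = ln N / 2\<close>, so the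
        permitted error \<open>s * q\<close> swallows both the main term and the number of
        solutions.\<close>
      have lq: "l \<le> 2 * q"
      proof -
        have "real Y \<le> real N"
        proof -
          have "s * 1 \<le> s * s" using N1 s0 by (intro mult_left_mono) (auto simp: s_def)
          then show ?thesis using Ys by (simp add: s_def)
        qed
        then have "l \<le> ln (real N)" unfolding l_def using Y1 by (intro ln_mono) auto
        then show ?thesis by (simp add: q_def p2')
      qed
      have "disc_sum Y \<le> 8 + 8 * l" unfolding l_def by (rule disc_sum_le[OF Y1])
      moreover have "disc_sum Y \<ge> 0" unfolding disc_sum_def by (intro sum_nonneg inv_norm_nonneg)
      ultimately have "L * disc_sum Y \<le> s * (8 + 16 * q)" using L s0 lq by (intro mult_mono) auto
      then have 2: "L * disc_sum Y \<le> 8 * s + 16 * (s * q)" by (simp add: algebra_simps)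
      have "mm \<le> 1 * (s * (2 * q))" unfolding mm_def using L l0 lq s0 pi_gt3 by (intro mult_mono) auto
      then have 3: "mm \<le> 2 * (s * q)" by (simp add: mult_ac)
      have "mm \<ge> 0" using L l0 by (simp add: mm_def)
      then show ?thesis using 1 2 3 B' Cs s0 sq unfolding Kr abs_le_iff by linarith
    qed
    then show "\<bar>real (card (sols N p)) - 2 / pi * (sqrt (real N - (real p)\<^sup>2) * ln (real (nat \<lfloor>sqrt (real N)\<rfloor>)))\<bar>
      \<le> K * (sqrt (real N) * (1 + ln (real N) / real p))"
      by (simp add: mm_def L_def l_def Y_def s_def q_def)
  qed
qed

section \<open>The asymptotic formula\<close>

text \<open>The summand decreases, so the sum and the area of the quarter disc differ by at most one
  summand of the largest size, \<open>sqrt N\<close>.\<close>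

lemma quarter_circle_sum:
  assumes N: "N \<ge> 1"
  defines "Y \<equiv> nat \<lfloor>sqrt (real N)\<rfloor>"
  shows "\<bar>(\<Sum>n=1..Y. sqrt (real N - (real n)\<^sup>2)) - pi / 4 * real N\<bar> \<le> sqrt (real N)"
proof -
  define s where "s = sqrt (real N)"
  have s1: "s \<ge> 1" using N by (simp add: s_def)
  have ss: "s\<^sup>2 = real N" by (simp add: s_def)
  have Ys: "real Y \<le> s" unfolding Y_def s_def by (rule floor_sqrt_le)
  have sY: "s < real Y + 1" unfolding Y_def s_def by linarith
  define h where "h t = sqrt (s\<^sup>2 - t\<^sup>2)" for t
  \<comment> \<open>The antiderivative of \<open>h\<close>. It is differentiable only in the open
    interval and merely continuous at \<open>s\<close>, so the comparison uses the mean value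
    theorem.\<close>
  define F where "F t = (t * sqrt (s\<^sup>2 - t\<^sup>2) + s\<^sup>2 * arcsin (t / s)) / 2" for t
  have cont: "continuous_on {a..b} F" if "0 \<le> a" "b \<le> s" for a b
    unfolding F_def using that s1 by (intro continuous_intros) (auto simp: field_simps)
  have deriv: "(F has_real_derivative h t) (at t)" if t: "0 < t" "t < s" for t
  proof -
    have pos: "s\<^sup>2 - t\<^sup>2 > 0" using t power_strict_mono[of t s 2] by simp
    have sq: "sqrt (1 - (t / s)\<^sup>2) = sqrt (s\<^sup>2 - t\<^sup>2) / s"
    proof -
      have "1 - (t / s)\<^sup>2 = (s\<^sup>2 - t\<^sup>2) / s\<^sup>2" using s1 by (simp add: power_divide diff_divide_distrib)
      then show ?thesis using s1 by (simp add: real_sqrt_divide)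
    qed
    have ts: "-1 < t / s" "t / s < 1" using t s1 by (auto simp: field_simps)
    have d1: "((\<lambda>t. sqrt (s\<^sup>2 - t\<^sup>2)) has_real_derivative (- t / sqrt (s\<^sup>2 - t\<^sup>2))) (at t)"
      using pos by (auto intro!: derivative_eq_intros simp: field_simps)
    have d2: "((\<lambda>t. arcsin (t / s)) has_real_derivative (inverse (sqrt (1 - (t / s)\<^sup>2)) * (1 / s))) (at t)"
      by (rule DERIV_chain2[where f = arcsin and g = "\<lambda>t. t / s", OF DERIV_arcsin[OF ts]]) (use s1 in \<open>auto intro!: derivative_eq_intros\<close>)
    have e: "inverse (sqrt (1 - (t / s)\<^sup>2)) * (1 / s) = 1 / sqrt (s\<^sup>2 - t\<^sup>2)"
      unfolding sq using s1 by (simp add: field_simps)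
    define r where "r = sqrt (s\<^sup>2 - t\<^sup>2)"
    have r: "r > 0" "r * r = s\<^sup>2 - t\<^sup>2" using pos by (auto simp: r_def)
    have "(F has_real_derivative (1 * r + (- t / r) * t + s\<^sup>2 * (1 / r)) / 2) (at t)"
      unfolding F_def r_def by (intro DERIV_cdivide DERIV_add DERIV_mult DERIV_ident d1 DERIV_cmult d2[unfolded e])
    also have "(1 * r + (- t / r) * t + s\<^sup>2 * (1 / r)) / 2 = r"
    proof -
      have "(- t / r) * t + s\<^sup>2 * (1 / r) = (s\<^sup>2 - t\<^sup>2) / r" by (simp add: power2_eq_square diff_divide_distrib)
      also have "\<dots> = r" using r by (simp add: field_simps)
      finally show ?thesis by simp
    qed
    finally show ?thesis by (simp add: h_def r_def)
  qed
  have hmono: "h u \<le> h t" if "0 \<le> t" "t \<le> u" for t u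
    unfolding h_def using that by (simp add: power_mono)
  have mvt: "(b - a) * h b \<le> F b - F a" "F b - F a \<le> (b - a) * h a" if ab: "0 \<le> a" "a \<le> b" "b \<le> s" for a b
  proof -
    have "(b - a) * h b \<le> F b - F a \<and> F b - F a \<le> (b - a) * h a"
    proof (cases "a = b")
      case False
      then have lt: "a < b" using ab by simp
      have "\<exists>l z. a < z \<and> z < b \<and> (F has_real_derivative l) (at z) \<and> F b - F a = (b - a) * l"
      proof (rule MVT[OF lt cont[OF ab(1,3)]])
        fix x assume "a < x" "x < b"
        then show "F differentiable (at x)" using deriv[of x] ab real_differentiable_def by force
      qed
      then obtain l z where z: "a < z" "z < b" "(F has_real_derivative l) (at z)" "F b - F a = (b - a) * l" by blast
      have "l = h z" using DERIV_unique[OF z(3) deriv] z ab by simp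
      moreover have "h b \<le> h z" "h z \<le> h a" using hmono z ab by auto
      ultimately show ?thesis using z lt by (auto intro!: mult_left_mono)
    qed simp
    then show "(b - a) * h b \<le> F b - F a" "F b - F a \<le> (b - a) * h a" by auto
  qed
  have F0: "F 0 = 0" by (simp add: F_def)
  have Fs: "F s = pi / 4 * real N" using s1 by (simp add: F_def ss)
  have h0: "h 0 = s" using s1 by (simp add: h_def)
  have hY: "0 \<le> h (real n)" if "n \<le> Y" for n
  proof -
    have "real n \<le> s" using that Ys by linarith
    then have "(real n)\<^sup>2 \<le> s\<^sup>2" by (intro power_mono) auto
    then show ?thesis by (simp add: h_def)
  qed
  have up: "(\<Sum>n=1..m. h (real n)) \<le> F (real m)" if "m \<le> Y" for m using that
  proof (induction m)
    case (Suc m)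
    have "real (Suc m) \<le> s" using Suc Ys by linarith
    then show ?case using Suc mvt(1)[of "real m" "real (Suc m)"] by simp
  qed (simp add: F0)
  have lo: "F (real m) \<le> (\<Sum>n=1..m. h (real n)) + s - h (real m)" if "m \<le> Y" for m using that
  proof (induction m)
    case (Suc m)
    have "real (Suc m) \<le> s" using Suc Ys by linarith
    then show ?case using Suc mvt(2)[of "real m" "real (Suc m)"] by simp
  qed (simp add: F0 h0)
  have "F (real Y) \<le> F s" using mvt(1)[of "real Y" s] Ys by (simp add: h_def)
  moreover have "F s \<le> F (real Y) + h (real Y)"
  proof -
    have "F s - F (real Y) \<le> (s - real Y) * h (real Y)" using mvt(2)[of "real Y" s] Ys by simp
    also have "\<dots> \<le> 1 * h (real Y)" using sY hY[of Y] by (intro mult_right_mono) auto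
    finally show ?thesis by simp
  qed
  ultimately have "\<bar>(\<Sum>n=1..Y. h (real n)) - F s\<bar> \<le> s" using up[of Y] lo[of Y] s1 unfolding abs_le_iff by linarith
  then show ?thesis unfolding Fs by (simp add: h_def ss s_def)
qed

text \<open>The quadruples \<open>(a, b, c, p)\<close> are sorted by \<open>p\<close> instead of by
  the common value \<open>n\<close>.\<close>

lemma S01_eq:
  "S01 (real N) = (\<Sum>p | prime p \<and> p \<le> nat \<lfloor>sqrt (real N)\<rfloor>. real (card (sols N p)))"
proof -
  define Y where "Y = nat \<lfloor>sqrt (real N)\<rfloor>"
  define A where "A n = {(a::nat, b::nat). 0 < a \<and> 0 < b \<and> n = a\<^sup>2 + b\<^sup>2}" for n
  define B where "B n = {(a::nat, p::nat). 0 < a \<and> prime p \<and> n = a\<^sup>2 + p\<^sup>2}" for n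
  define P where "P = {p. prime p \<and> p \<le> Y}"
  have le: "a \<le> n" if "n = a\<^sup>2 + b\<^sup>2" for a b n :: nat
    using that self_le_power[of a 2] by (cases "a = 0") auto
  have fA: "finite (A n)" for n
  proof (rule finite_subset)
    show "A n \<subseteq> {..n} \<times> {..n}"
    proof
      fix x assume "x \<in> A n"
      then obtain a b where x: "x = (a, b)" and n: "n = a\<^sup>2 + b\<^sup>2" by (auto simp: A_def)
      have "n = b\<^sup>2 + a\<^sup>2" using n by simp
      then show "x \<in> {..n} \<times> {..n}" using le[OF n] le[of n b a] by (simp add: x)
    qed
  qed simp
  have fB: "finite (B n)" for n
  proof (rule finite_subset)
    show "B n \<subseteq> {..n} \<times> {..n}"
    proof
      fix x assume "x \<in> B n"
      then obtain a b where x: "x = (a, b)" and n: "n = a\<^sup>2 + b\<^sup>2" by (auto simp: B_def)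
      have "n = b\<^sup>2 + a\<^sup>2" using n by simp
      then show "x \<in> {..n} \<times> {..n}" using le[OF n] le[of n b a] by (simp add: x)
    qed
  qed simp
  have fs: "finite (sols N p)" for p
  proof (rule finite_subset)
    show "sols N p \<subseteq> {..N} \<times> {..N} \<times> {..N}"
    proof
      fix x assume x: "x \<in> sols N p"
      obtain a b c where abc: "x = (a,b,c)" by (metis prod.exhaust)
      have e: "a\<^sup>2 + b\<^sup>2 = c\<^sup>2 + p\<^sup>2" "c\<^sup>2 + p\<^sup>2 \<le> N" using x by (auto simp: abc sols_def)
      have "a \<le> a\<^sup>2 + b\<^sup>2" "b \<le> b\<^sup>2 + a\<^sup>2" "c \<le> c\<^sup>2 + p\<^sup>2" using le by blast+
      then show "x \<in> {..N} \<times> {..N} \<times> {..N}" using e by (auto simp: abc)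
    qed
  qed simp
  have set: "{n. 0 < n \<and> real n \<le> real N} = {1..N}" by auto
  have "S01 (real N) = real (\<Sum>n=1..N. card (A n \<times> B n))"
    unfolding S01_def set r0_def r1_def A_def[symmetric] B_def[symmetric] by (simp add: card_cartesian_product)
  also have "(\<Sum>n=1..N. card (A n \<times> B n)) = card (SIGMA n:{1..N}. A n \<times> B n)"
    using fA fB by (intro card_SigmaI[symmetric]) auto
  also have "\<dots> = card (SIGMA p:P. sols N p)"
  proof (rule bij_betw_same_card[OF bij_betw_byWitness[where
      f = "\<lambda>(n,((a,b),(c,p))). (p,(a,b,c))" and f' = "\<lambda>(p,(a,b,c)). (c\<^sup>2 + p\<^sup>2,((a,b),(c,p)))"]])
    show "(\<lambda>(n,((a,b),(c,p))). (p,(a,b,c))) ` (SIGMA n:{1..N}. A n \<times> B n) \<subseteq> (SIGMA p:P. sols N p)"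
    proof
      fix x assume "x \<in> (\<lambda>(n,((a,b),(c,p))). (p,(a,b,c))) ` (SIGMA n:{1..N}. A n \<times> B n)"
      then obtain y where y: "y \<in> (SIGMA n:{1..N}. A n \<times> B n)" "x = (\<lambda>(n,((a,b),(c,p))). (p,(a,b,c))) y" by blast
      obtain n ab cp where y1: "y = (n, ab, cp)" by (cases y)
      obtain a b where y2: "ab = (a, b)" by (cases ab)
      obtain c p where y3: "cp = (c, p)" by (cases cp)
      have x: "x = (p,(a,b,c))" using y(2) by (simp add: y1 y2 y3)
      have n: "n \<le> N" "0 < a" "0 < b" "n = a\<^sup>2 + b\<^sup>2" "0 < c" "prime p" "n = c\<^sup>2 + p\<^sup>2"
        using y(1) by (auto simp: y1 y2 y3 A_def B_def)
      have "p\<^sup>2 \<le> N" using n by simp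
      then have "(int p)\<^sup>2 \<le> int N" by (simp flip: of_nat_power)
      from abs_le_floor_sqrt[OF this] have "p \<le> Y" by (simp add: Y_def nat_le_iff le_nat_iff)
      then show "x \<in> (SIGMA p:P. sols N p)" using n by (auto simp: x P_def sols_def)
    qed
    show "(\<lambda>(p,(a,b,c)). (c\<^sup>2 + p\<^sup>2,((a,b),(c,p)))) ` (SIGMA p:P. sols N p) \<subseteq> (SIGMA n:{1..N}. A n \<times> B n)"
      by (auto simp: P_def sols_def A_def B_def Suc_le_eq)
  qed (auto simp: A_def B_def P_def sols_def)
  also have "\<dots> = (\<Sum>p\<in>P. card (sols N p))" using fs by (intro card_SigmaI) (auto simp: P_def)
  finally show ?thesis by (simp add: P_def Y_def)
qed

text \<open>The factor \<open>ln Y\<close> in the count for one prime meets the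
  \<open>1 / ln Y\<close> from the prime sum of the decreasing function \<open>h\<close>, and
  \<open>2 / pi\<close> meets the \<open>pi / 4\<close> of the quarter disc. The error obtained is
  O(N / ln N); the factor ln ln of the theorem is only inserted at the end.\<close>

lemma S01_nat_asymp:
  obtains C where "C > 0" "\<And>N. N \<ge> 16 \<Longrightarrow> \<bar>S01 (real N) - real N / 2\<bar> \<le> C * (real N / ln (real N))"
proof -
  obtain C where C: "C > 0" and Cb: "\<And>N h. N \<ge> 2 \<Longrightarrow> (\<And>m n. 1 \<le> m \<Longrightarrow> m \<le> n \<Longrightarrow> n \<le> N \<Longrightarrow> h n \<le> h m) \<Longrightarrow> h N \<ge> 0 \<Longrightarrow>
    \<bar>ln (real N) * (\<Sum>p | prime p \<and> p \<le> N. h p) - (\<Sum>n=1..N. h n)\<bar> \<le> C * h 1 * (real N / ln (real N))"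
    using prime_sum_asymp by blast
  obtain K where K: "K > 0" and Kb: "\<And>N p. prime p \<Longrightarrow> p\<^sup>2 \<le> N \<Longrightarrow>
    \<bar>real (card (sols N p)) - 2 / pi * (sqrt (real N - (real p)\<^sup>2) * ln (real (nat \<lfloor>sqrt (real N)\<rfloor>)))\<bar>
      \<le> K * (sqrt (real N) * (1 + ln (real N) / real p))"
    using sols_estimate by blast
  show ?thesis
  proof (rule that[of "K * (4 * (1 + 2 * C) + 432) + 4 * C + 2"])
    fix N :: nat assume N: "N \<ge> 16"
    define x where "x = real N"
    define s where "s = sqrt x"
    define l where "l = ln x"
    define Y where "Y = nat \<lfloor>sqrt (real N)\<rfloor>"
    define ly where "ly = ln (real Y)"
    define P where "P = {p. prime p \<and> p \<le> Y}"
    define h where "h n = sqrt (real N - (real n)\<^sup>2)" for n :: nat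
    have x16: "x \<ge> 16" using N by (simp add: x_def)
    have s4: "s \<ge> 4" unfolding s_def using x16 by (intro real_le_rsqrt) simp
    have ss: "s * s = x" using x16 by (simp add: s_def)
    have N1: "N \<ge> 1" using N by simp
    have Ys: "real Y \<le> s" unfolding Y_def s_def x_def by (rule floor_sqrt_le)
    have sY: "s \<le> 2 * real Y" unfolding Y_def s_def x_def by (rule floor_sqrt_bounds(3)[OF N1])
    have Y2: "Y \<ge> 2" using sY s4 by linarith
    have l0: "l \<ge> 1" unfolding l_def using x16 exp_le by (subst ln_ge_iff) auto
    \<comment> \<open>\<open>x \<ge> 16\<close> gives \<open>ln 2 \<le> l / 4\<close>, so that
      \<open>ln Y \<ge> ln s - ln 2 \<ge> l / 2 - l / 4\<close>.\<close>
    have lyl: "ly \<ge> l / 4" "ly \<le> l"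
    proof -
      have "ln (16::real) = 4 * ln 2" using ln_realpow[of 2 4] by simp
      then have "4 * ln 2 \<le> l" unfolding l_def using x16 by (metis ln_mono zero_less_numeral)
      moreover have "ln s = l / 2" unfolding l_def s_def using x16 by (simp add: ln_sqrt)
      moreover have "ln s \<le> ln (2 * real Y)" using s4 sY by (intro ln_mono) auto
      moreover have "ln (2 * real Y) = ln 2 + ly" unfolding ly_def using Y2 by (simp add: ln_mult)
      ultimately show "ly \<ge> l / 4" by linarith
      have "ly \<le> ln s" unfolding ly_def using Ys Y2 by (intro ln_mono) auto
      then show "ly \<le> l" using \<open>ln s = l / 2\<close> l0 by linarith
    qed
    have ly0: "ly > 0" using lyl l0 by linarith
    define R where "R = x / l"
    have YR: "s * (real Y / ly) \<le> 4 * R"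
    proof -
      have "s * (real Y / ly) \<le> s * (s / (l / 4))" using s4 Ys lyl l0 by (intro mult_left_mono frac_le) auto
      also have "\<dots> = 4 * R" using ss by (simp add: R_def)
      finally show ?thesis .
    qed
    have l3: "l^3 \<le> 216 * s"
    proof -
      have "l \<le> x powr (1/6) / (1/6)" unfolding l_def using x16 by (intro ln_powr_bound) auto
      then have "l^3 \<le> (6 * x powr (1/6))^3" using l0 by (intro power_mono) auto
      also have "\<dots> = 216 * s" using x16 by (simp add: power_mult_distrib powr_power powr_half_sqrt s_def)
      finally show ?thesis .
    qed
    \<comment> \<open>The prime sum estimate with the constant weight 1 yields a Chebyshev
      bound.\<close>
    have cardP: "real (card P) \<le> (1 + 2 * C) * (real Y / ly)"
    proof -
      have "\<bar>ly * (\<Sum>p\<in>P. 1) - (\<Sum>n=1..Y. 1)\<bar> \<le> C * 1 * (real Y / ly)"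
        unfolding ly_def P_def by (rule Cb[OF Y2]) auto
      then have "ly * real (card P) \<le> real Y + C * (real Y / ly)" by simp
      also have "real Y / ly \<le> real Y / (1/2)"
      proof (rule divide_left_mono)
        have "ln 2 \<le> ln (real Y)" using Y2 by (subst ln_le_cancel_iff) auto
        then show "1/2 \<le> ly" unfolding ly_def using ln2_ge_two_thirds by linarith
      qed (use ly0 in auto)
      finally have "ly * real (card P) \<le> (1 + 2 * C) * real Y" using C by (simp add: algebra_simps mult_left_mono)
      then show ?thesis using ly0 by (simp add: field_simps)
    qed
    define M where "M = (\<Sum>p\<in>P. 2 / pi * (h p * ly))"
    have "\<bar>S01 (real N) - M\<bar> \<le> (\<Sum>p\<in>P. K * (s * (1 + l / real p)))"
    proof -
      have "S01 (real N) - M = (\<Sum>p\<in>P. real (card (sols N p)) - 2 / pi * (h p * ly))"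
        unfolding S01_eq M_def P_def Y_def by (simp add: sum_subtractf)
      also have "\<bar>\<dots>\<bar> \<le> (\<Sum>p\<in>P. \<bar>real (card (sols N p)) - 2 / pi * (h p * ly)\<bar>)" by (rule sum_abs)
      also have "\<dots> \<le> (\<Sum>p\<in>P. K * (s * (1 + l / real p)))"
      proof (rule sum_mono)
        fix p assume p: "p \<in> P"
        then have "real p \<le> s" using Ys by (auto simp: P_def)
        then have "(real p)\<^sup>2 \<le> s\<^sup>2" by (intro power_mono) auto
        then have "real (p\<^sup>2) \<le> real N" using ss by (simp add: power2_eq_square x_def)
        then have "p\<^sup>2 \<le> N" by (simp only: of_nat_le_iff)
        then show "\<bar>real (card (sols N p)) - 2 / pi * (h p * ly)\<bar> \<le> K * (s * (1 + l / real p))"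
          using Kb[of p N] p by (simp add: P_def h_def ly_def Y_def s_def l_def x_def)
      qed
      finally show ?thesis .
    qed
    also have "\<dots> = K * (s * (real (card P) + l * (\<Sum>p\<in>P. 1 / real p)))"
    proof -
      have "(\<Sum>p\<in>P. l / real p) = l * (\<Sum>p\<in>P. 1 / real p)" by (simp add: sum_distrib_left)
      then show ?thesis by (simp add: sum_distrib_left[symmetric] sum.distrib)
    qed
    also have "\<dots> \<le> K * (4 * (1 + 2 * C) * R + 432 * R)"
    proof (rule mult_left_mono)
      \<comment> \<open>The crude harmonic bound is harmless: it costs powers of \<open>l\<close>
        against \<open>s\<close>, which \<open>l^3 \<le> 216 * s\<close> absorbs.\<close>
      have "(\<Sum>p\<in>P. 1 / real p) \<le> (\<Sum>n=1..Y. 1 / real n)"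
        unfolding P_def using prime_ge_1_nat by (intro sum_mono2) auto
      also have "\<dots> \<le> 1 + ly" unfolding ly_def using Y2 by (intro sum_inverse_bounds) auto
      also have "\<dots> \<le> 2 * l" using lyl l0 by linarith
      finally have "l * (\<Sum>p\<in>P. 1 / real p) \<le> l * (2 * l)" using l0 by (intro mult_left_mono) auto
      then have "s * (l * (\<Sum>p\<in>P. 1 / real p)) \<le> s * (l * (2 * l))" by (rule mult_left_mono) (use s4 in simp)
      also have "\<dots> \<le> 432 * R"
      proof -
        have "2 * s * l^3 \<le> 2 * s * (216 * s)" using l3 s4 by (intro mult_left_mono) auto
        then have "s * (l * (2 * l)) * l \<le> 432 * x" using ss by (simp add: power3_eq_cube mult_ac)
        then show ?thesis unfolding R_def using l0 by (simp add: field_simps)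
      qed
      finally have 1: "s * (l * (\<Sum>p\<in>P. 1 / real p)) \<le> 432 * R" .
      have "s * real (card P) \<le> s * ((1 + 2 * C) * (real Y / ly))" using cardP s4 by (intro mult_left_mono) auto
      also have "\<dots> = (1 + 2 * C) * (s * (real Y / ly))" by (simp only: mult_ac)
      also have "\<dots> \<le> (1 + 2 * C) * (4 * R)" using YR C by (intro mult_left_mono) auto
      finally show "s * (real (card P) + l * (\<Sum>p\<in>P. 1 / real p)) \<le> 4 * (1 + 2 * C) * R + 432 * R"
        using 1 by (simp add: algebra_simps)
    qed (use K in simp)
    finally have e1: "\<bar>S01 (real N) - M\<bar> \<le> K * (4 * (1 + 2 * C) + 432) * R" by (simp add: algebra_simps)
    have e2: "\<bar>M - 2 / pi * (\<Sum>n=1..Y. h n)\<bar> \<le> 4 * C * R"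
    proof -
      have "\<bar>ly * (\<Sum>p\<in>P. h p) - (\<Sum>n=1..Y. h n)\<bar> \<le> C * h 1 * (real Y / ly)"
        unfolding ly_def P_def
      proof (rule Cb[OF Y2])
        fix m n :: nat assume "1 \<le> m" "m \<le> n" "n \<le> Y"
        then show "h n \<le> h m" unfolding h_def by (simp add: power_mono)
      next
        have "(real Y)\<^sup>2 \<le> s\<^sup>2" using Ys by (intro power_mono) auto
        then show "h Y \<ge> 0" unfolding h_def using ss by (simp add: power2_eq_square x_def)
      qed
      also have "C * h 1 * (real Y / ly) \<le> C * s * (real Y / ly)"
        using C ly0 by (intro mult_right_mono mult_left_mono) (auto simp: h_def s_def x_def)
      also have "\<dots> \<le> C * (4 * R)" using YR C by (simp only: mult.assoc mult_left_mono less_imp_le)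
      finally have 1: "\<bar>ly * (\<Sum>p\<in>P. h p) - (\<Sum>n=1..Y. h n)\<bar> \<le> C * (4 * R)" .
      have "M - 2 / pi * (\<Sum>n=1..Y. h n) = 2 / pi * (ly * (\<Sum>p\<in>P. h p) - (\<Sum>n=1..Y. h n))"
        unfolding M_def by (simp add: sum_distrib_left algebra_simps)
      moreover have "\<bar>2 / pi\<bar> = 2 / pi" by simp
      ultimately have "\<bar>M - 2 / pi * (\<Sum>n=1..Y. h n)\<bar> = 2 / pi * \<bar>ly * (\<Sum>p\<in>P. h p) - (\<Sum>n=1..Y. h n)\<bar>"
        by (simp only: abs_mult)
      also have "\<dots> \<le> 1 * \<bar>ly * (\<Sum>p\<in>P. h p) - (\<Sum>n=1..Y. h n)\<bar>" using pi_gt3 by (intro mult_right_mono) auto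
      finally show ?thesis using 1 by simp
    qed
    have e3: "\<bar>2 / pi * (\<Sum>n=1..Y. h n) - x / 2\<bar> \<le> 2 * R"
    proof -
      have q: "\<bar>(\<Sum>n=1..Y. h n) - pi / 4 * x\<bar> \<le> s"
        using quarter_circle_sum[OF N1] by (simp add: h_def Y_def x_def s_def)
      have "2 / pi * (\<Sum>n=1..Y. h n) - x / 2 = 2 / pi * ((\<Sum>n=1..Y. h n) - pi / 4 * x)" by (simp add: field_simps)
      moreover have "\<bar>2 / pi\<bar> = 2 / pi" by simp
      ultimately have "\<bar>2 / pi * (\<Sum>n=1..Y. h n) - x / 2\<bar> = 2 / pi * \<bar>(\<Sum>n=1..Y. h n) - pi / 4 * x\<bar>"
        by (simp only: abs_mult)
      also have "\<dots> \<le> 1 * s" using q pi_gt3 by (intro mult_mono) auto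
      also have "\<dots> \<le> 2 * R"
      proof -
        have "l \<le> x powr (1/2) / (1/2)" unfolding l_def using x16 by (intro ln_powr_bound) auto
        then have "l \<le> 2 * s" using x16 by (simp add: powr_half_sqrt s_def)
        then have "s * l \<le> s * (2 * s)" using s4 by (intro mult_left_mono) auto
        then have "s * l \<le> 2 * x" using ss by simp
        then show ?thesis unfolding R_def using l0 by (simp add: field_simps)
      qed
      finally show ?thesis .
    qed
    have "\<bar>S01 (real N) - x / 2\<bar> \<le> K * (4 * (1 + 2 * C) + 432) * R + 4 * C * R + 2 * R"
      using e1 e2 e3 by linarith
    also have "\<dots> = (K * (4 * (1 + 2 * C) + 432) + 4 * C + 2) * R" by (simp only: distrib_right)
    finally show "\<bar>S01 (real N) - real N / 2\<bar> \<le> (K * (4 * (1 + 2 * C) + 432) + 4 * C + 2) * (real N / ln (real N))"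
      by (simp only: x_def R_def l_def)
  qed (use C K in \<open>auto intro!: add_pos_pos\<close>)
qed

theorem theorem1p1:
  "(\<lambda>x::real. S01 x - x / 2) \<in> O[at_top](\<lambda>x. x * ln (ln x) / ln x)"
proof -
  obtain C where C: "C > 0" and Cb: "\<And>N. N \<ge> 16 \<Longrightarrow> \<bar>S01 (real N) - real N / 2\<bar> \<le> C * (real N / ln (real N))"
    using S01_nat_asymp by blast
  show ?thesis
  \<comment> \<open>From \<open>exp (exp 1)\<close> on, \<open>ln (ln x) \<ge> 1\<close>, so
    multiplying by it only enlarges the bound; 17 makes the integer part at least 16. The extra 1 in
    the constant pays for replacing \<open>x\<close> by its integer part in
    \<open>x / 2\<close>.\<close>
  proof (rule bigoI[where c = "2 * C + 1"], rule eventually_at_top_linorderI[of "max 17 (exp (exp 1))"])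
    fix x :: real assume "x \<ge> max 17 (exp (exp 1))"
    then have x: "x \<ge> 17" and exp_bound: "exp (exp 1) \<le> x" by auto
    define N where "N = nat \<lfloor>x\<rfloor>"
    have Nx: "real N \<le> x" "x < real N + 1" using x unfolding N_def by linarith+
    have N16: "N \<ge> 16" using Nx x by linarith
    have "real n \<le> x \<longleftrightarrow> real n \<le> real N" for n :: nat
    proof
      assume "real n \<le> x"
      then have "n \<le> N" unfolding N_def by (rule le_nat_floor)
      then show "real n \<le> real N" by (simp only: of_nat_le_iff)
    qed (use Nx in linarith)
    then have S: "S01 x = S01 (real N)" unfolding S01_def by (simp only:)
    have lnx: "ln x \<ge> exp 1" using x exp_bound by (subst ln_ge_iff) auto
    have lnx1: "ln x \<ge> 1" using lnx exp_ge_add_one_self[of 1] by linarith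
    have lln: "ln (ln x) \<ge> 1" using lnx lnx1 by (subst ln_ge_iff) auto
    have lnN: "ln (real N) \<ge> ln x / 2"
    proof -
      have "x \<le> real N * real N"
      proof -
        have "x \<le> 16 * real N" using Nx x by linarith
        also have "\<dots> \<le> real N * real N" using N16 by (intro mult_right_mono) auto
        finally show ?thesis .
      qed
      then have "ln x \<le> ln (real N * real N)" using x by (intro ln_mono) auto
      then show ?thesis using N16 by (simp add: ln_mult)
    qed
    have "real N / ln (real N) \<le> x / (ln x / 2)" using Nx lnN lnx1 x by (intro frac_le) auto
    also have "x / (ln x / 2) = 2 * (x / ln x)" by simp
    finally have "C * (real N / ln (real N)) \<le> C * (2 * (x / ln x))" using C by (intro mult_left_mono) auto
    then have "\<bar>S01 (real N) - real N / 2\<bar> \<le> C * (2 * (x / ln x))" using Cb[OF N16] by linarith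
    moreover have "\<bar>real N / 2 - x / 2\<bar> \<le> x / ln x"
    proof -
      have "ln x \<le> x" using x ln_le_minus_one[of x] by linarith
      then have "1 \<le> x / ln x" using lnx1 by (subst le_divide_eq_1_pos) linarith+
      then show ?thesis using Nx by linarith
    qed
    ultimately have "\<bar>S01 x - x / 2\<bar> \<le> C * (2 * (x / ln x)) + x / ln x" unfolding S by linarith
    also have "\<dots> = (2 * C + 1) * (x / ln x)" by (simp add: algebra_simps)
    also have "\<dots> \<le> (2 * C + 1) * (x / ln x * ln (ln x))"
    proof (intro mult_left_mono)
      have "x / ln x * 1 \<le> x / ln x * ln (ln x)" using lln lnx1 x by (intro mult_left_mono) auto
      then show "x / ln x \<le> x / ln x * ln (ln x)" by simp
    qed (use C in auto)
    finally have "\<bar>S01 x - x / 2\<bar> \<le> (2 * C + 1) * (x * ln (ln x) / ln x)" by simp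
    also have "\<dots> \<le> (2 * C + 1) * norm (x * ln (ln x) / ln x)"
      unfolding real_norm_def by (intro mult_left_mono abs_ge_self) (use C in simp)
    finally show "norm (S01 x - x / 2) \<le> (2 * C + 1) * norm (x * ln (ln x) / ln x)" by simp
  qed
qed

end
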